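(* A connected 4-valent vertex-transitive graph admits a strong clique if and only if it is isomorphic to one of the graphs $K_{4,4}$, $K_5$, $K_3[2K_1]$, $L(K_{3,3})$, $H_n$ (for some $n$), $\mathrm{Cay}(\mathbb{Z}_{3k},\{\pm1,\pm k\})$ (for some $k$), or $C_3\square C_n$ (for some $n$). In particular, every 4-valent vertex-transitive graph admitting a strong clique is localizable.
   Context: All graphs are finite and simple. A clique is strong if it intersects every inclusion-maximal independent set; a graph is localizable if its vertex set can be partitioned into strong cliques. $\Gamma_1[\Gamma_2]$ is the lexicographic product: vertex set $V(\Gamma_1)\times V(\Gamma_2)$, $(u,x)\sim(v,y)$ iff $uv\in E(\Gamma_1)$, or $u=v$ and $xy\in E(\Gamma_2)$; $2K_1$ is the edgeless graph on 2 vertices. $L(K_{3,3})$ is the line graph of $K_{3,3}$. $\Gamma_1\square\Gamma_2$ is the Cartesian product: $(x_1,y_1)\sim(x_2,y_2)$ iff ($x_1=x_2$ and $y_1y_2\in E(\Gamma_2)$) or ($y_1=y_2$ and $x_1x_2\in E(\Gamma_1)$). For a group $G$ and inverse-closed $S\subseteq G\setminus\{1\}$, $\mathrm{Cay}(G,S)$ has vertex set $G$ with $x\sim y$ iff $x^{-1}y\in S$. For $n\ge2$, $H_n$ is the graph on $\{x_i,y_i,z_i,w_i: 1\le i\le n\}$ in which for each $i$ the vertices $x_i,y_i,z_i,w_i$ are pairwise adjacent, and additionally $z_i\sim x_{i+1}$, $w_i\sim y_{i+1}$ for $i=1,\dots,n-1$, and $z_n\sim x_1$, $w_n\sim y_1$.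 A graph is vertex-transitive if its automorphism group acts transitively on its vertices. *)

theory Defs
  imports
    "Graph_Theory.Pair_Digraph"
    "Graph_Theory.Digraph_Component"
    "Graph_Theory.Digraph_Isomorphism"
    "Graph_Theory.Kuratowski"
    "HOL-Algebra.Elementary_Groups"
    "HOL-Library.Disjoint_Sets"
begin

text \<open>
  A finite simple graph is a \<^locale>\<open>pair_graph\<close>: a finite vertex set \<^const>\<open>pverts\<close> with a
  symmetric irreflexive relation \<^const>\<open>parcs\<close> on it, each edge occurring in both orientations.
\<close>

definition clique :: "'a pair_pre_digraph \<Rightarrow> 'a set \<Rightarrow> bool" where
  "clique G C \<longleftrightarrow> C \<subseteq> pverts G \<and> (\<forall>u\<in>C. \<forall>v\<in>C. u \<noteq> v \<longrightarrow> (u, v) \<in> parcs G)"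

definition independent_set :: "'a pair_pre_digraph \<Rightarrow> 'a set \<Rightarrow> bool" where
  "independent_set G I \<longleftrightarrow> I \<subseteq> pverts G \<and> (\<forall>u\<in>I. \<forall>v\<in>I. (u, v) \<notin> parcs G)"

definition maximal_independent_set :: "'a pair_pre_digraph \<Rightarrow> 'a set \<Rightarrow> bool" where
  "maximal_independent_set G I \<longleftrightarrow>
     independent_set G I \<and> (\<forall>J. independent_set G J \<and> I \<subseteq> J \<longrightarrow> J = I)"

definition strong_clique :: "'a pair_pre_digraph \<Rightarrow> 'a set \<Rightarrow> bool" where
  "strong_clique G C \<longleftrightarrow> clique G C \<and> (\<forall>I. maximal_independent_set G I \<longrightarrow> C \<inter> I \<noteq> {})"

definition localizable :: "'a pair_pre_digraph \<Rightarrow> bool" where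
  "localizable G \<longleftrightarrow> (\<exists>P. partition_on (pverts G) P \<and> (\<forall>C\<in>P. strong_clique G C))"

text \<open>In a symmetric digraph without parallel arcs the out-degree is the number of neighbours.\<close>

definition valent :: "nat \<Rightarrow> 'a pair_pre_digraph \<Rightarrow> bool" where
  "valent d G \<longleftrightarrow> (\<forall>v\<in>pverts G. out_degree (with_proj G) v = d)"

definition automorphism ::
    "'a pair_pre_digraph \<Rightarrow> ('a, 'a \<times> 'a, 'a, 'a \<times> 'a) digraph_isomorphism \<Rightarrow> bool" where
  "automorphism G f \<longleftrightarrow>
     pre_digraph.digraph_isomorphism (with_proj G) f \<and> app_iso f (with_proj G) = with_proj G"

definition vertex_transitive :: "'a pair_pre_digraph \<Rightarrow> bool" where
  "vertex_transitive G \<longleftrightarrow>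
     (\<forall>u\<in>pverts G. \<forall>v\<in>pverts G. \<exists>f. automorphism G f \<and> iso_verts f u = v)"

definition complete_graph :: "nat \<Rightarrow> nat pair_pre_digraph" where
  "complete_graph n = \<lparr>pverts = {..<n}, parcs = {(i, j). i < n \<and> j < n \<and> i \<noteq> j}\<rparr>"

definition complete_bipartite_graph :: "nat \<Rightarrow> nat \<Rightarrow> (nat + nat) pair_pre_digraph" where
  "complete_bipartite_graph m n =
     \<lparr>pverts = {..<m} <+> {..<n},
      parcs = (Inl ` {..<m}) \<times> (Inr ` {..<n}) \<union> (Inr ` {..<n}) \<times> (Inl ` {..<m})\<rparr>"

definition edgeless_graph :: "nat \<Rightarrow> nat pair_pre_digraph" where
  "edgeless_graph n = \<lparr>pverts = {..<n}, parcs = {}\<rparr>"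

text \<open>A simple graph, and the usual \<open>n\<close>-cycle, only for \<open>n \<ge> 3\<close>.\<close>

definition cycle_graph :: "nat \<Rightarrow> nat pair_pre_digraph" where
  "cycle_graph n =
     \<lparr>pverts = {..<n},
      parcs = {(i, j). i < n \<and> j < n \<and> (j = Suc i mod n \<or> i = Suc j mod n)}\<rparr>"

definition lexicographic_product ::
    "'a pair_pre_digraph \<Rightarrow> 'b pair_pre_digraph \<Rightarrow> ('a \<times> 'b) pair_pre_digraph" where
  "lexicographic_product G H =
     \<lparr>pverts = pverts G \<times> pverts H,
      parcs = {((u, x), (v, y)).
        (u, x) \<in> pverts G \<times> pverts H \<and> (v, y) \<in> pverts G \<times> pverts H \<and>
        ((u, v) \<in> parcs G \<or> (u = v \<and> (x, y) \<in> parcs H))}\<rparr>"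

definition cartesian_product ::
    "'a pair_pre_digraph \<Rightarrow> 'b pair_pre_digraph \<Rightarrow> ('a \<times> 'b) pair_pre_digraph" where
  "cartesian_product G H =
     \<lparr>pverts = pverts G \<times> pverts H,
      parcs = {((x1, x2), (y1, y2)).
        (x1, x2) \<in> pverts G \<times> pverts H \<and> (y1, y2) \<in> pverts G \<times> pverts H \<and>
        ((x1 = y1 \<and> (x2, y2) \<in> parcs H) \<or> (x2 = y2 \<and> (x1, y1) \<in> parcs G))}\<rparr>"

definition edge_sets :: "'a pair_pre_digraph \<Rightarrow> 'a set set" where
  "edge_sets G = {{u, v} | u v. (u, v) \<in> parcs G}"

definition line_graph :: "'a pair_pre_digraph \<Rightarrow> 'a set pair_pre_digraph" where
  "line_graph G =
     \<lparr>pverts = edge_sets G,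
      parcs = {(e, f). e \<in> edge_sets G \<and> f \<in> edge_sets G \<and> e \<noteq> f \<and> e \<inter> f \<noteq> {}}\<rparr>"

definition cayley_graph :: "('a, 'b) monoid_scheme \<Rightarrow> 'a set \<Rightarrow> 'a pair_pre_digraph" where
  "cayley_graph A S =
     \<lparr>pverts = carrier A,
      parcs = {(x, y). x \<in> carrier A \<and> y \<in> carrier A \<and> inv\<^bsub>A\<^esub> x \<otimes>\<^bsub>A\<^esub> y \<in> S}\<rparr>"

text \<open>
  The elements of \<^term>\<open>integer_mod_group n\<close> are the representatives \<open>0, \<dots>, n - 1\<close>, so the
  connection set \<open>{\<plusminus>1, \<plusminus>k}\<close> is reduced modulo \<open>3k\<close>.
\<close>

definition cayley_Z3k :: "nat \<Rightarrow> int pair_pre_digraph" where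
  "cayley_Z3k k =
     cayley_graph (integer_mod_group (3 * k))
       ((\<lambda>a. a mod (3 * int k)) ` {1, - 1, int k, - int k})"

datatype H_letter = Hx | Hy | Hz | Hw

text \<open>The pair \<open>(Hx, i)\<close> stands for the vertex \<open>x\<^sub>i\<close>, and similarly for the other letters.\<close>

definition H_verts :: "nat \<Rightarrow> (H_letter \<times> nat) set" where
  "H_verts n = {Hx, Hy, Hz, Hw} \<times> {1..n}"

definition H_succ :: "nat \<Rightarrow> nat \<Rightarrow> nat" where
  "H_succ n i = (if i = n then 1 else i + 1)"

definition H_links :: "nat \<Rightarrow> (H_letter \<times> nat) rel" where
  "H_links n =
     (\<Union>i\<in>{1..n}. {((Hz, i), (Hx, H_succ n i)), ((Hw, i), (Hy, H_succ n i))})"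

definition H_graph :: "nat \<Rightarrow> (H_letter \<times> nat) pair_pre_digraph" where
  "H_graph n =
     \<lparr>pverts = H_verts n,
      parcs = {((a, i), (b, i)) | a b i. i \<in> {1..n} \<and> a \<noteq> b} \<union> H_links n \<union> (H_links n)\<inverse>\<rparr>"

lemma complete_graph_is_complete: "complete_digraph n (with_proj (complete_graph n))"
  unfolding complete_digraph_pair_def by (auto simp: complete_graph_def)

lemma complete_bipartite_graph_is_complete_bipartite:
  "complete_bipartite_digraph m n (with_proj (complete_bipartite_graph m n))"
  unfolding complete_bipartite_digraph_pair_def
  by (rule conjI, simp add: complete_bipartite_graph_def,
      rule exI[of _ "Inl ` {..<m}"], rule exI[of _ "Inr ` {..<n}"])
     (auto simp: complete_bipartite_graph_def card_image)

lemma pair_graphI_rel: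
  assumes "finite (pverts G)" "parcs G \<subseteq> pverts G \<times> pverts G" "sym (parcs G)" "irrefl (parcs G)"
  shows "pair_graph G"
proof -
  have "finite (parcs G)"
    using assms(1,2) by (meson finite_SigmaI finite_subset)
  then show ?thesis
    using assms by unfold_locales (auto simp: symmetric_def irrefl_def)
qed

lemma pair_graph_cycle_graph: "n \<ge> 3 \<Longrightarrow> pair_graph (cycle_graph n)"
  by (rule pair_graphI_rel)
     (auto simp: cycle_graph_def irrefl_def mod_Suc split: if_splits intro!: symI)

lemma pair_graph_H_graph:
  assumes "n \<ge> 2"
  shows "pair_graph (H_graph n)"
proof (rule pair_graphI_rel)
  have UNIV: "a \<in> {Hx, Hy, Hz, Hw}" for a
    by (cases a) auto
  show "finite (pverts (H_graph n))"
    by (simp add: H_graph_def H_verts_def)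
  show "parcs (H_graph n) \<subseteq> pverts (H_graph n) \<times> pverts (H_graph n)"
    using assms UNIV by (fastforce simp: H_graph_def H_verts_def H_links_def H_succ_def)
  show "sym (parcs (H_graph n))"
    by (auto simp: H_graph_def sym_def)
  show "irrefl (parcs (H_graph n))"
    by (auto simp: H_graph_def H_links_def irrefl_def)
qed

text \<open>
  For \<^const>\<open>with_proj\<close> graphs, the arc components of a library isomorphism are
  determined by the vertex map, and one recovers adjacency-preserving bijections.
\<close>

lemma pair_isomorphism_imp_bij:
  assumes "pre_digraph.digraph_isomorphism (with_proj G) h" "app_iso h (with_proj G) = with_proj H"
  defines "f \<equiv> iso_verts h"
  shows "bij_betw f (pverts G) (pverts H)"
    and "u \<in> pverts G \<Longrightarrow> v \<in> pverts G \<Longrightarrow> (u, v) \<in> parcs G \<longleftrightarrow> (f u, f v) \<in> parcs H"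
proof -
  have V: "pverts H = f ` pverts G" and A: "parcs H = iso_arcs h ` parcs G"
    and t: "iso_tail h = fst" and hd: "iso_head h = snd"
    using assms(2) unfolding f_def app_iso_def with_proj_def by auto
  interpret wf_digraph "with_proj G"
    using assms(1) by (simp add: pre_digraph.digraph_isomorphism_def)
  have inj: "inj_on f (pverts G)"
    using assms(1) by (simp add: pre_digraph.digraph_isomorphism_def f_def)
  then show "bij_betw f (pverts G) (pverts H)"
    by (simp add: bij_betw_def V)
  have arc: "iso_arcs h a = (f (fst a), f (snd a))" if "a \<in> parcs G" for a
    using assms(1) that t hd
    by (auto simp: pre_digraph.digraph_isomorphism_def f_def prod_eq_iff)
  have wf: "fst a \<in> pverts G" "snd a \<in> pverts G" if "a \<in> parcs G" for a
    using wellformed[of a] that by auto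
  show "(u, v) \<in> parcs G \<longleftrightarrow> (f u, f v) \<in> parcs H" if "u \<in> pverts G" "v \<in> pverts G"
  proof
    assume "(u, v) \<in> parcs G"
    then show "(f u, f v) \<in> parcs H"
      using arc[of "(u, v)"] unfolding A by (metis fst_conv snd_conv imageI)
  next
    assume "(f u, f v) \<in> parcs H"
    then obtain a where a: "a \<in> parcs G" "f (fst a) = f u" "f (snd a) = f v"
      unfolding A using arc by (metis (no_types, lifting) imageE prod.inject)
    then have "fst a = u" "snd a = v"
      using inj wf[OF a(1)] that by (auto dest: inj_onD)
    with a(1) show "(u, v) \<in> parcs G"
      by (metis prod.collapse)
  qed
qed

lemma bij_imp_pair_isomorphism:
  assumes G: "pair_wf_digraph G" and H: "pair_wf_digraph H"
    and bij: "bij_betw f (pverts G) (pverts H)"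
    and adj: "\<And>u v. u \<in> pverts G \<Longrightarrow> v \<in> pverts G \<Longrightarrow> (u, v) \<in> parcs G \<longleftrightarrow> (f u, f v) \<in> parcs H"
  defines "h \<equiv> \<lparr>iso_verts = f, iso_arcs = map_prod f f, iso_head = snd, iso_tail = fst\<rparr>"
  shows "pre_digraph.digraph_isomorphism (with_proj G) h" "app_iso h (with_proj G) = with_proj H"
proof -
  interpret G: pair_wf_digraph G by fact
  interpret H: pair_wf_digraph H by fact
  have wf: "parcs G \<subseteq> pverts G \<times> pverts G" "parcs H \<subseteq> pverts H \<times> pverts H"
    using G.wellformed' H.wellformed' by auto
  have inj: "inj_on f (pverts G)" and img: "f ` pverts G = pverts H"
    using bij by (auto simp: bij_betw_def)
  have "inj_on (map_prod f f) (parcs G)"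
    using map_prod_inj_on[OF inj inj] wf(1) by (rule inj_on_subset)
  then show "pre_digraph.digraph_isomorphism (with_proj G) h"
    using inj G.wf_digraph_axioms
    by (simp add: pre_digraph.digraph_isomorphism_def h_def)
  have "map_prod f f ` parcs G = parcs H"
  proof
    show "map_prod f f ` parcs G \<subseteq> parcs H"
      using adj wf(1) by auto
    show "parcs H \<subseteq> map_prod f f ` parcs G"
    proof
      fix e assume e: "e \<in> parcs H"
      then have "fst e \<in> f ` pverts G" "snd e \<in> f ` pverts G"
        using wf(2) img by auto
      then obtain u v where uv: "u \<in> pverts G" "v \<in> pverts G" "e = map_prod f f (u, v)"
        by (auto simp: prod_eq_iff)
      then have "(u, v) \<in> parcs G"
        using e adj[of u v] by simp
      then show "e \<in> map_prod f f ` parcs G"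
        using uv(3) by blast
    qed
  qed
  then show "app_iso h (with_proj G) = with_proj H"
    by (simp add: app_iso_def with_proj_def h_def img)
qed

lemma digraph_iso_pair_iff:
  assumes "pair_wf_digraph G" "pair_wf_digraph H"
  shows "digraph_iso (with_proj G) (with_proj H) \<longleftrightarrow>
    (\<exists>f. bij_betw f (pverts G) (pverts H) \<and>
         (\<forall>u\<in>pverts G. \<forall>v\<in>pverts G. (u, v) \<in> parcs G \<longleftrightarrow> (f u, f v) \<in> parcs H))"
proof
  assume "digraph_iso (with_proj G) (with_proj H)"
  then obtain h where "pre_digraph.digraph_isomorphism (with_proj G) h"
    "app_iso h (with_proj G) = with_proj H"
    unfolding digraph_iso_def by metis
  from pair_isomorphism_imp_bij[OF this]
  show "\<exists>f. bij_betw f (pverts G) (pverts H) \<and>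
         (\<forall>u\<in>pverts G. \<forall>v\<in>pverts G. (u, v) \<in> parcs G \<longleftrightarrow> (f u, f v) \<in> parcs H)"
    by blast
next
  assume "\<exists>f. bij_betw f (pverts G) (pverts H) \<and>
         (\<forall>u\<in>pverts G. \<forall>v\<in>pverts G. (u, v) \<in> parcs G \<longleftrightarrow> (f u, f v) \<in> parcs H)"
  then obtain f where "bij_betw f (pverts G) (pverts H)"
    "\<And>u v. u \<in> pverts G \<Longrightarrow> v \<in> pverts G \<Longrightarrow> (u, v) \<in> parcs G \<longleftrightarrow> (f u, f v) \<in> parcs H"
    by blast
  from bij_imp_pair_isomorphism[OF assms this]
  show "digraph_iso (with_proj G) (with_proj H)"
    unfolding digraph_iso_def by metis
qed

lemma vertex_transitive_iff:
  assumes "pair_wf_digraph G"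
  shows "vertex_transitive G \<longleftrightarrow>
    (\<forall>a\<in>pverts G. \<forall>b\<in>pverts G. \<exists>f. bij_betw f (pverts G) (pverts G) \<and>
       (\<forall>u\<in>pverts G. \<forall>v\<in>pverts G. (u, v) \<in> parcs G \<longleftrightarrow> (f u, f v) \<in> parcs G) \<and> f a = b)"
    (is "_ \<longleftrightarrow> ?R")
proof
  assume L: "vertex_transitive G"
  show ?R
  proof (intro ballI)
    fix a b assume "a \<in> pverts G" "b \<in> pverts G"
    then obtain h where "automorphism G h" "iso_verts h a = b"
      using L unfolding vertex_transitive_def by blast
    then show "\<exists>f. bij_betw f (pverts G) (pverts G) \<and>
       (\<forall>u\<in>pverts G. \<forall>v\<in>pverts G. (u, v) \<in> parcs G \<longleftrightarrow> (f u, f v) \<in> parcs G) \<and> f a = b"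
      using pair_isomorphism_imp_bij[of G h G] unfolding automorphism_def by blast
  qed
next
  assume R: ?R
  show "vertex_transitive G"
    unfolding vertex_transitive_def
  proof (intro ballI)
    fix a b assume "a \<in> pverts G" "b \<in> pverts G"
    then obtain f where f: "bij_betw f (pverts G) (pverts G)"
      "\<And>u v. u \<in> pverts G \<Longrightarrow> v \<in> pverts G \<Longrightarrow> (u, v) \<in> parcs G \<longleftrightarrow> (f u, f v) \<in> parcs G"
      and "f a = b"
      using R by meson
    then show "\<exists>h. automorphism G h \<and> iso_verts h a = b"
      using bij_imp_pair_isomorphism[OF assms assms f] unfolding automorphism_def
      by (metis digraph_isomorphism.select_convs(1))
  qed
qed

end

theory Submission
  imports Defs
begin

text \<open>
  Let \<open>w\<close> be the size of a strong clique. Averaging \<open>card (f ` Q \<inter> I)\<close> over all automorphisms \<open>f\<close>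
  (clique--coclique bound) shows that no clique has more than \<open>w\<close> vertices and that every clique
  with \<open>w\<close> vertices is strong, that is, no independent set dominates it; by transitivity each
  vertex lies in such a clique. Now \<open>w\<close> ranges over \<open>2, \<dots>, 5\<close>. The cases \<open>w = 5\<close> and \<open>w = 2\<close> give
  \<open>K\<^sub>5\<close> and \<open>K\<^sub>4\<^sub>,\<^sub>4\<close> at once. If \<open>w = 4\<close>, the cliques of size 4 partition the vertices, the remaining
  edges form a perfect matching, and in each clique they lead in pairs to adjacent cliques, which
  arranges the cliques into a cycle and yields \<open>H\<^sub>n\<close>. If \<open>w = 3\<close> and two triangles share an edge, their
  apexes are twins, so every vertex has a twin and the graph is the octahedron. If triangles share at
  most vertices, and some vertex lies in two of them, the graph is \<open>C\<^sub>3 \<box> C\<^sub>3\<close>. Otherwise the triangles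
  partition the vertices, and counting multiplicities of the edges between triangles shows that any
  two adjacent triangles are joined by a perfect matching; the triangles form a cycle, and
  its monodromy, a permutation of a triangle, fixes all vertices (giving \<open>C\<^sub>3 \<box> C\<^sub>n\<close>) or none (giving
  the Cayley graph).

  All of this is local, so for a disconnected graph one finds a union of components that is
  partitioned into cliques of size \<open>w\<close>, and its translates cover the graph.
\<close>

section \<open>Cliques in vertex-transitive graphs\<close>

text \<open>Strongness enters the local analysis in one form (\<open>no_dominating\<close>): if
  every vertex of a clique of size w chooses a neighbour, the chosen vertices are not independent.
  Only 5 - w edges at a vertex leave such a clique, so few choices remain, and transitivity copies
  what is found at one vertex to all others. No case builds an isomorphism directly; each one only
  gives an injective map from a listed graph X to G that preserves edges. Both graphs have valency
  4, so the image is closed under adjacency. This makes the map an isomorphism when G is connected,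
  and otherwise it locates the union of components to be translated. The hard case is that of
  disjoint triangles: two of them may a priori be joined by one, two or three edges, and every
  mixture other than three throughout has to be refuted. L(K_{3,3}) is C_3 \<box> C_3, so it is
  found as the prism with n = 3. The Cayley graph is a triangle for k = 1 and the octahedron for k =
  2, so the classification produces it with k \<ge> 3.\<close>

locale strong_vt_graph =
  fixes G :: "'a pair_pre_digraph" and C :: "'a set"
  assumes pair_graph: "pair_graph G"
    and valent: "valent 4 G"
    and transitive: "vertex_transitive G"
    and strong: "strong_clique G C"
begin

abbreviation V :: "'a set" where "V \<equiv> pverts G"

abbreviation E :: "'a \<Rightarrow> 'a \<Rightarrow> bool" where "E u v \<equiv> (u, v) \<in> parcs G"

definition nbs :: "'a \<Rightarrow> 'a set" where "nbs v = {u. E v u}"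

text \<open>The maps are the identity outside \<open>V\<close>. This makes \<open>auts\<close>
  finite and closed under composition and inverses, so that one can average over it.\<close>

definition auts :: "('a \<Rightarrow> 'a) set" where
  "auts = {f. f permutes V \<and> (\<forall>u v. E (f u) (f v) \<longleftrightarrow> E u v)}"

lemma E_V: "E u v \<Longrightarrow> u \<in> V" "E u v \<Longrightarrow> v \<in> V"
proof -
  interpret pair_graph G by (rule pair_graph)
  show "E u v \<Longrightarrow> u \<in> V" "E u v \<Longrightarrow> v \<in> V"
    by (auto dest: in_arcsD1 in_arcsD2)
qed

lemma E_irrefl [simp]: "\<not> E v v"
proof -
  interpret pair_graph G by (rule pair_graph)
  show ?thesis using no_loops' by blast
qed

lemma E_sym: "E u v \<Longrightarrow> E v u"
proof -
  interpret pair_graph G by (rule pair_graph)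
  show "E u v \<Longrightarrow> E v u" using arcs_symmetric by blast
qed

lemma E_commute: "E u v \<longleftrightarrow> E v u"
  using E_sym by blast

lemma finite_V: "finite V"
proof -
  interpret pair_graph G by (rule pair_graph)
  show ?thesis using finite_verts by simp
qed

lemma finite_nbs [simp]: "finite (nbs v)"
  by (rule finite_subset[OF _ finite_V]) (auto simp: nbs_def E_V)

lemma card_nbs: "v \<in> V \<Longrightarrow> card (nbs v) = 4"
proof -
  assume v: "v \<in> V"
  have "out_arcs (with_proj G) v = Pair v ` nbs v"
    by (auto simp: out_arcs_def nbs_def)
  then have "out_degree (with_proj G) v = card (nbs v)"
    by (simp add: out_degree_def card_image inj_on_def)
  then show ?thesis using valent v by (simp add: valent_def)
qed

lemma wf: "pair_wf_digraph G"
  by unfold_locales (auto dest: E_V)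

lemma ex_aut:
  assumes "a \<in> V" "b \<in> V"
  shows "\<exists>f\<in>auts. f a = b"
proof -
  obtain f where f: "bij_betw f V V" "\<forall>u\<in>V. \<forall>v\<in>V. E u v \<longleftrightarrow> E (f u) (f v)" "f a = b"
    using transitive assms unfolding vertex_transitive_iff[OF wf] by meson
  define g where "g x = (if x \<in> V then f x else x)" for x
  have "bij_betw g V V"
    using f(1) by (subst bij_betw_cong[where g = f]) (auto simp: g_def)
  then have perm: "g permutes V"
    by (rule bij_imp_permutes) (simp add: g_def)
  have "E (g u) (g v) \<longleftrightarrow> E u v" for u v
  proof (cases "u \<in> V \<and> v \<in> V")
    case True
    then show ?thesis using f(2) by (simp add: g_def)
  next
    case False
    then show ?thesis
      using E_V[of "g u" "g v"] E_V[of u v] permutes_in_image[OF perm] by blast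
  qed
  then have "g \<in> auts" using perm by (simp add: auts_def)
  moreover have "g a = b" using f(3) assms(1) by (simp add: g_def)
  ultimately show ?thesis by blast
qed

lemma autD:
  assumes "f \<in> auts"
  shows "E (f u) (f v) \<longleftrightarrow> E u v" "f u = f v \<longleftrightarrow> u = v" "f u \<in> V \<longleftrightarrow> u \<in> V" "surj f"
proof -
  have p: "f permutes V" using assms unfolding auts_def by blast
  show "E (f u) (f v) \<longleftrightarrow> E u v" using assms unfolding auts_def by blast
  show "f u = f v \<longleftrightarrow> u = v" by (rule inj_eq[OF permutes_inj[OF p]])
  show "f u \<in> V \<longleftrightarrow> u \<in> V" by (rule permutes_in_image[OF p])
  show "surj f" by (rule permutes_surj[OF p])
qed

lemma aut_comp: "f \<in> auts \<Longrightarrow> g \<in> auts \<Longrightarrow> f \<circ> g \<in> auts"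
  by (auto simp: auts_def permutes_compose)

lemma aut_inv: "f \<in> auts \<Longrightarrow> inv_into UNIV f \<in> auts"
proof -
  assume f: "f \<in> auts"
  have p: "f permutes V" using f by (simp add: auts_def)
  have "E (inv_into UNIV f u) (inv_into UNIV f v) \<longleftrightarrow> E u v" for u v
    using autD(1)[OF f, of "inv_into UNIV f u" "inv_into UNIV f v"] by (simp add: permutes_inverses[OF p])
  then show ?thesis using p by (simp add: auts_def permutes_inv)
qed

section \<open>Counting over the automorphism group\<close>

lemma finite_auts: "finite auts"
  by (rule finite_subset[OF _ finite_permutations[OF finite_V]]) (auto simp: auts_def)

lemma clique_image:
  assumes "f \<in> auts" "clique G Q"
  shows "clique G (f ` Q)" "card (f ` Q) = card Q"
  using assms autD[OF assms(1)] by (auto simp: clique_def card_image inj_on_def subset_iff)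

text \<open>Orbit-stabilizer counting: composition with an automorphism taking \<open>v\<close> to
  \<open>v'\<close> matches the maps with value \<open>v\<close> at \<open>u\<close> with those of
  value \<open>v'\<close>, so the value at \<open>u\<close> splits \<open>auts\<close> into
  \<open>card V\<close> classes of equal size.\<close>

lemma card_auts_mapping:
  assumes "u \<in> V" "v \<in> V"
  shows "card {f \<in> auts. f u = v} * card V = card auts"
proof -
  have eq: "card {f \<in> auts. f u = v'} = card {f \<in> auts. f u = v}" if "v' \<in> V" for v'
  proof -
    obtain g where g: "g \<in> auts" "g v = v'" using ex_aut assms(2) \<open>v' \<in> V\<close> by blast
    have inv_g: "inv_into UNIV g (g x) = x" "g (inv_into UNIV g x) = x" for x
      using g(1) permutes_inverses[of g V] by (simp_all add: auts_def)
    have "bij_betw (\<lambda>f. g \<circ> f) {f \<in> auts. f u = v} {f \<in> auts. f u = v'}"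
    proof (rule bij_betwI[where g = "\<lambda>f. inv_into UNIV g \<circ> f"])
      show "(\<lambda>f. g \<circ> f) \<in> {f \<in> auts. f u = v} \<rightarrow> {f \<in> auts. f u = v'}"
        using g aut_comp[OF g(1)] by simp
      show "(\<lambda>f. inv_into UNIV g \<circ> f) \<in> {f \<in> auts. f u = v'} \<rightarrow> {f \<in> auts. f u = v}"
        using g aut_comp[OF aut_inv[OF g(1)]] inv_g(1)[of v] by auto
    qed (simp_all add: fun_eq_iff inv_g)
    then show ?thesis by (simp add: bij_betw_same_card)
  qed
  have "f u \<in> V" if "f \<in> auts" for f
    using autD(3)[OF that] assms(1) by simp
  then have "auts = (\<Union>v'\<in>V. {f \<in> auts. f u = v'})"
    by auto
  then have "card auts = card (\<Union>v'\<in>V. {f \<in> auts. f u = v'})" by simp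
  also have "\<dots> = (\<Sum>v'\<in>V. card {f \<in> auts. f u = v'})"
    by (rule card_UN_disjoint) (use finite_V finite_auts in auto)
  also have "\<dots> = card V * card {f \<in> auts. f u = v}"
    using eq by simp
  finally show ?thesis by simp
qed

text \<open>Double counting of the triples of \<open>f\<close>, \<open>q\<close> in \<open>Q\<close>
  and \<open>i\<close> in \<open>I\<close> with \<open>f q = i\<close>: by
  \<open>card_auts_mapping\<close> every pair \<open>q\<close>, \<open>i\<close> belongs to the same
  number of maps.\<close>

lemma sum_card_aut_image_Int:
  assumes "Q \<subseteq> V" "I \<subseteq> V"
  shows "(\<Sum>f\<in>auts. card (f ` Q \<inter> I)) * card V = card Q * card I * card auts"
proof -
  have fin: "finite Q" "finite I" using assms finite_V finite_subset by blast+
  have "card (f ` Q \<inter> I) = (\<Sum>q\<in>Q. \<Sum>i\<in>I. if f q = i then 1 else 0)" if "f \<in> auts" for f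
  proof -
    have "f ` Q \<inter> I = f ` {q \<in> Q. f q \<in> I}" by auto
    moreover have "inj_on f {q \<in> Q. f q \<in> I}" using autD(2)[OF that] by (auto simp: inj_on_def)
    ultimately have "card (f ` Q \<inter> I) = card {q \<in> Q. f q \<in> I}" by (simp add: card_image)
    also have "\<dots> = (\<Sum>q\<in>Q. if f q \<in> I then 1 else 0)"
      using fin(1) by (simp add: sum.If_cases Int_def)
    also have "\<dots> = (\<Sum>q\<in>Q. \<Sum>i\<in>I. if f q = i then 1 else 0)"
      using fin(2) by (intro sum.cong) auto
    finally show ?thesis .
  qed
  then have "(\<Sum>f\<in>auts. card (f ` Q \<inter> I)) = (\<Sum>f\<in>auts. \<Sum>q\<in>Q. \<Sum>i\<in>I. if f q = i then 1 else 0)"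
    by simp
  also have "\<dots> = (\<Sum>q\<in>Q. \<Sum>f\<in>auts. \<Sum>i\<in>I. if f q = i then 1 else 0)"
    by (rule sum.swap)
  also have "\<dots> = (\<Sum>q\<in>Q. \<Sum>i\<in>I. \<Sum>f\<in>auts. if f q = i then 1 else 0)"
    by (intro sum.cong refl sum.swap)
  also have "\<dots> = (\<Sum>q\<in>Q. \<Sum>i\<in>I. card {f \<in> auts. f q = i})"
    using finite_auts by (simp add: sum.If_cases Int_def)
  finally have "(\<Sum>f\<in>auts. card (f ` Q \<inter> I)) * card V
      = (\<Sum>q\<in>Q. \<Sum>i\<in>I. card {f \<in> auts. f q = i} * card V)"
    by (simp add: sum_distrib_right)
  also have "\<dots> = (\<Sum>q\<in>Q. \<Sum>i\<in>I. card auts)"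
    using assms by (intro sum.cong refl card_auts_mapping) auto
  finally show ?thesis by simp
qed

section \<open>The clique-coclique bound\<close>

lemma clique_Int_independent:
  assumes "clique G Q" "independent_set G I"
  shows "card (Q \<inter> I) \<le> 1"
proof -
  have fin: "finite (Q \<inter> I)"
    using assms finite_V by (meson clique_def finite_Int finite_subset)
  have "\<forall>x\<in>Q \<inter> I. \<forall>y\<in>Q \<inter> I. x = y"
    using assms unfolding clique_def independent_set_def by blast
  with fin show ?thesis by (metis card_le_Suc0_iff_eq One_nat_def)
qed

lemma maximal_independent_ex:
  assumes "independent_set G I"
  shows "\<exists>J. maximal_independent_set G J \<and> I \<subseteq> J"
proof -
  have "finite {J. independent_set G J}"
    by (rule finite_subset[of _ "Pow V"]) (auto simp: independent_set_def finite_V)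
  from finite_has_maximal2[OF this, of I] assms
  show ?thesis by (auto simp: maximal_independent_set_def)
qed

lemma maximal_independent_image:
  assumes f: "f \<in> auts" and I: "maximal_independent_set G I"
  shows "maximal_independent_set G (f ` I)"
proof -
  have ind: "independent_set G (h ` J)" if "h \<in> auts" "independent_set G J" for h J
    using that autD[OF that(1)] by (auto simp: independent_set_def)
  have inv_f: "inv_into UNIV f ` f ` A = A" "f ` inv_into UNIV f ` A = A" for A
    using f permutes_inv_o[of f V] by (simp_all add: auts_def image_comp)
  have "J = f ` I" if "independent_set G J" "f ` I \<subseteq> J" for J
  proof -
    have "I \<subseteq> inv_into UNIV f ` J" using image_mono[OF that(2), of "inv_into UNIV f"] by (simp add: inv_f)
    then have "inv_into UNIV f ` J = I"
      using I ind[OF aut_inv[OF f] that(1)] by (auto simp: maximal_independent_set_def)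
    then show ?thesis using inv_f(2) by metis
  qed
  then show ?thesis
    using I ind[OF f] by (auto simp: maximal_independent_set_def)
qed

text \<open>For a maximal independent \<open>I\<close>, every image of \<open>C\<close> meets
  \<open>I\<close> in exactly one vertex, so \<open>card C * card I = card V\<close>. Images of
  \<open>Q\<close> meet \<open>I\<close> at most once, which gives the bound. If the sizes agree,
  all terms of the sum for \<open>Q\<close> must be 1, in particular the term of \<open>id\<close>,
  which is \<open>card (Q \<inter> I)\<close>.\<close>

lemma card_clique_le:
  assumes Q: "clique G Q"
  shows "card Q \<le> card C"
    and "card Q = card C \<Longrightarrow> strong_clique G Q"
proof -
  have C: "clique G C" using strong by (simp add: strong_clique_def)
  have hit: "card (f ` C \<inter> I) = 1" if f: "f \<in> auts" and I: "maximal_independent_set G I" for f I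
  proof -
    \<comment> \<open>Rather than moving \<open>C\<close>, the automorphism is undone on
      \<open>I\<close>, which remains maximal independent.\<close>
    have "C \<inter> inv_into UNIV f ` I \<noteq> {}"
      using strong maximal_independent_image[OF aut_inv[OF f] I] by (simp add: strong_clique_def)
    then obtain c i where "c \<in> C" "i \<in> I" "c = inv_into UNIV f i" by auto
    then have "f c = i"
      using f permutes_inverses[of f V] by (simp add: auts_def)
    then have "f c \<in> f ` C \<inter> I"
      using \<open>c \<in> C\<close> \<open>i \<in> I\<close> by blast
    moreover have "finite (f ` C \<inter> I)"
      using C finite_V by (meson clique_def finite_imageI finite_Int finite_subset)
    ultimately have "card (f ` C \<inter> I) \<noteq> 0" by auto
    moreover have "card (f ` C \<inter> I) \<le> 1"
      using clique_Int_independent clique_image[OF f C] I by (simp add: maximal_independent_set_def)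
    ultimately show ?thesis by simp
  qed
  have V: "C \<subseteq> V" "Q \<subseteq> V" using C Q by (simp_all add: clique_def)
  have id: "id \<in> auts" by (simp add: auts_def permutes_id)
  then have auts_pos: "card auts > 0" using finite_auts card_gt_0_iff by blast
  have *: "card Q * card I \<le> card C * card I \<and> card I > 0 \<and>
      (card Q = card C \<longrightarrow> Q \<inter> I \<noteq> {})" if I: "maximal_independent_set G I" for I
  proof -
    have IV: "I \<subseteq> V" and ind: "independent_set G I"
      using I by (auto simp: maximal_independent_set_def independent_set_def)
    have "(\<Sum>f\<in>auts. card (f ` C \<inter> I)) = card auts"
      using hit[OF _ I] by simp
    then have eq: "card auts * card V = card C * card I * card auts"
      using sum_card_aut_image_Int[OF V(1) IV] by simp
    have "I \<noteq> {}" using hit[OF id I] by auto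
    then have pos: "card I > 0" using IV finite_V by (simp add: card_gt_0_iff finite_subset)
    have V_pos: "card V > 0" using \<open>I \<noteq> {}\<close> IV finite_V by (auto simp: card_gt_0_iff)
    have le1: "card (f ` Q \<inter> I) \<le> 1" if "f \<in> auts" for f
      using clique_Int_independent[OF clique_image(1)[OF that Q] ind] .
    then have "(\<Sum>f\<in>auts. card (f ` Q \<inter> I)) \<le> card auts"
      using sum_mono[of auts "\<lambda>f. card (f ` Q \<inter> I)" "\<lambda>_. 1"] by simp
    then have "card Q * card I * card auts \<le> card auts * card V"
      using sum_card_aut_image_Int[OF V(2) IV] by (metis mult_le_mono1)
    then have le: "card Q * card I \<le> card C * card I"
      using eq auts_pos by simp
    have "Q \<inter> I \<noteq> {}" if "card Q = card C"
    proof
      assume "Q \<inter> I = {}"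
      have "(\<Sum>f\<in>auts. card (f ` Q \<inter> I)) * card V = card auts * card V"
        using sum_card_aut_image_Int[OF V(2) IV] eq that by metis
      then have "(\<Sum>f\<in>auts. card (f ` Q \<inter> I)) = (\<Sum>f\<in>auts. 1)"
        using V_pos by simp
      then have "card (id ` Q \<inter> I) = 1"
        using sum_mono_inv[of "\<lambda>f. card (f ` Q \<inter> I)" auts "\<lambda>_. 1" id] le1 id finite_auts by blast
      with \<open>Q \<inter> I = {}\<close> show False by simp
    qed
    with le pos show ?thesis by blast
  qed
  have "independent_set G {}" by (simp add: independent_set_def)
  then obtain I where "maximal_independent_set G I" using maximal_independent_ex by blast
  with * show "card Q \<le> card C" by (metis mult_le_cancel2)
  show "strong_clique G Q" if "card Q = card C"
    using * Q that by (auto simp: strong_clique_def)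
qed

text \<open>A maximal independent set containing \<open>I\<close> meets the strong clique
  \<open>Q\<close>, and a common vertex has no neighbour in that set.\<close>

lemma no_dominating:
  assumes "clique G Q" "card Q = card C" "independent_set G I"
  shows "\<exists>q\<in>Q. \<forall>i\<in>I. \<not> E q i"
proof (rule ccontr)
  assume dom: "\<not> ?thesis"
  obtain J where J: "maximal_independent_set G J" "I \<subseteq> J"
    using maximal_independent_ex assms(3) by blast
  then obtain q where "q \<in> Q" "q \<in> J"
    using card_clique_le(2)[OF assms(1,2)] by (auto simp: strong_clique_def)
  from dom \<open>q \<in> Q\<close> obtain i where "i \<in> I" "E q i" by blast
  moreover have "\<not> E q i" if "i \<in> J" for i
    using J(1) \<open>q \<in> J\<close> that unfolding maximal_independent_set_def independent_set_def by blast
  ultimately show False using J(2) by blast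
qed

lemma C_clique: "clique G C" and C_nonempty: "C \<noteq> {}"
proof -
  show "clique G C" using strong by (simp add: strong_clique_def)
  have "independent_set G {}" by (simp add: independent_set_def)
  then obtain I where "maximal_independent_set G I" using maximal_independent_ex by blast
  then show "C \<noteq> {}" using strong by (auto simp: strong_clique_def)
qed

lemma finite_clique: "clique G Q \<Longrightarrow> finite Q"
  using finite_V by (auto simp: clique_def dest: finite_subset)

lemma ex_clique:
  assumes "v \<in> V"
  shows "\<exists>Q. clique G Q \<and> card Q = card C \<and> v \<in> Q"
proof -
  obtain c where "c \<in> C" using C_nonempty by blast
  then obtain f where f: "f \<in> auts" "f c = v"
    using ex_aut assms C_clique by (auto simp: clique_def)
  then show ?thesis
    using clique_image[OF f(1) C_clique] \<open>c \<in> C\<close> by blast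
qed

lemma clique_subset_nbs: "clique G Q \<Longrightarrow> v \<in> Q \<Longrightarrow> Q - {v} \<subseteq> nbs v"
  by (auto simp: clique_def nbs_def)

lemma card_C: "card C \<in> {2, 3, 4, 5}"
proof -
  obtain v where v: "v \<in> C" using C_nonempty by blast
  then have vV: "v \<in> V" using C_clique by (auto simp: clique_def)
  have fin: "finite C" using finite_clique C_clique by blast
  have "card (C - {v}) \<le> 4"
    using card_mono[OF finite_nbs clique_subset_nbs[OF C_clique v]] card_nbs[OF vV] by simp
  then have "card C \<le> 5" using v fin by simp
  moreover obtain u where "E v u"
    using card_nbs[OF vV] by (metis card.empty ex_in_conv mem_Collect_eq nbs_def zero_neq_numeral)
  then have "clique G {v, u}" "card {v, u} = 2"
    using E_V E_sym by (auto simp: clique_def card_insert_if)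
  then have "2 \<le> card C" using card_clique_le(1) by metis
  ultimately show ?thesis by auto
qed

end

section \<open>Embeddings of regular graphs\<close>

text \<open>The colouring \<open>p\<close> exhibits a partition into cliques of the size \<open>w\<close>.\<close>

definition tiled_graph :: "nat \<Rightarrow> 'b pair_pre_digraph \<Rightarrow> bool" where
  "tiled_graph w X \<longleftrightarrow> pair_wf_digraph X \<and> pverts X \<noteq> {} \<and>
     (\<forall>x\<in>pverts X. \<exists>N. card N = 4 \<and> (\<forall>y\<in>N. (x, y) \<in> parcs X)) \<and>
     (\<exists>p :: 'b \<Rightarrow> nat. \<forall>x\<in>pverts X. clique X {y \<in> pverts X. p y = p x} \<and>
        card {y \<in> pverts X. p y = p x} = w)"

lemma cliqueD: "clique X Q \<Longrightarrow> x \<in> Q \<Longrightarrow> y \<in> Q \<Longrightarrow> x \<noteq> y \<Longrightarrow> (x, y) \<in> parcs X"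
  by (auto simp: clique_def)

lemma connected_closed_set:
  assumes conn: "Digraph_Component.connected (with_proj G)" and sym: "\<And>u v. (u, v) \<in> parcs G \<Longrightarrow> (v, u) \<in> parcs G"
    and K: "K \<noteq> {}" "K \<subseteq> pverts G" and closed: "\<And>u v. u \<in> K \<Longrightarrow> (u, v) \<in> parcs G \<Longrightarrow> v \<in> K"
  shows "K = pverts G"
proof -
  obtain k where k: "k \<in> K" using K by blast
  have "v \<in> K" if "v \<in> pverts G" for v
  proof -
    let ?M = "mk_symmetric (with_proj G)"
    have "k \<rightarrow>\<^sup>*\<^bsub>?M\<^esub> v"
      using conn k K that unfolding Digraph_Component.connected_def strongly_connected_def
      by (auto simp: mk_symmetric_def)
    then have "(k, v) \<in> rtrancl_on (verts ?M) (arcs_ends ?M)"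
      by (simp add: reachable_def)
    then show ?thesis
    proof (induction rule: rtrancl_on_induct)
      case base
      show ?case by (rule k)
    next
      case (step x y)
      then have "(x, y) \<in> parcs G \<or> (y, x) \<in> parcs G"
        by (auto simp: mk_symmetric_def arcs_ends_def arc_to_ends_def)
      then show ?case using step closed sym by blast
    qed
  qed
  then show ?thesis using K by blast
qed

context strong_vt_graph
begin

text \<open>Non-edges need no condition: equal valencies imply that they are preserved too
  (\<open>embeds_iso\<close>).\<close>

definition embeds :: "'b pair_pre_digraph \<Rightarrow> ('b \<Rightarrow> 'a) \<Rightarrow> bool" where
  "embeds X f \<longleftrightarrow> inj_on f (pverts X) \<and> f ` pverts X \<subseteq> V \<and> (\<forall>x y. (x, y) \<in> parcs X \<longrightarrow> E (f x) (f y))"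

text \<open>The images of four neighbours of \<open>x\<close> already exhaust the four neighbours of
  \<open>f x\<close>. Hence the image of \<open>f\<close> is closed under adjacency, and every edge
  between image vertices comes from an edge of \<open>X\<close>.\<close>

lemma embeds_nbs:
  assumes X: "tiled_graph w X" and f: "embeds X f" and x: "x \<in> pverts X" and v: "E (f x) v"
  shows "\<exists>y\<in>pverts X. (x, y) \<in> parcs X \<and> v = f y"
proof -
  interpret pair_wf_digraph X using X by (simp add: tiled_graph_def)
  obtain N where N: "card N = 4" "\<forall>y\<in>N. (x, y) \<in> parcs X"
    using X x unfolding tiled_graph_def by blast
  then have NX: "N \<subseteq> pverts X" using in_arcsD2 by blast
  then have "inj_on f N" using f inj_on_subset by (auto simp: embeds_def)
  then have "card (f ` N) = 4" using N by (simp add: card_image)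
  moreover have "f ` N \<subseteq> nbs (f x)" using N f by (auto simp: embeds_def nbs_def)
  moreover have "card (nbs (f x)) = 4" using E_V(1)[OF v] by (rule card_nbs)
  ultimately have "f ` N = nbs (f x)" by (metis card_subset_eq finite_nbs)
  then have "v \<in> f ` N" using v by (simp add: nbs_def)
  then show ?thesis using N NX by auto
qed

lemma embeds_iso:
  assumes X: "tiled_graph w X" and f: "embeds X f"
    and conn: "Digraph_Component.connected (with_proj G)"
  shows "digraph_iso (with_proj G) (with_proj X)"
proof -
  have wfX: "pair_wf_digraph X" using X by (simp add: tiled_graph_def)
  have "f ` pverts X = V"
  proof (rule connected_closed_set[OF conn E_sym])
    show "f ` pverts X \<noteq> {}" using X by (simp add: tiled_graph_def)
    show "f ` pverts X \<subseteq> V" using f by (simp add: embeds_def)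
  qed (use embeds_nbs[OF X f] in auto)
  then have bij: "bij_betw f (pverts X) V" using f by (simp add: embeds_def bij_betw_def)
  have adj: "(x, y) \<in> parcs X \<longleftrightarrow> E (f x) (f y)" if "x \<in> pverts X" "y \<in> pverts X" for x y
    using embeds_nbs[OF X f that(1), of "f y"] that f
    by (auto simp: embeds_def dest: inj_onD)
  let ?g = "the_inv_into (pverts X) f"
  have "bij_betw ?g V (pverts X)" by (rule bij_betw_the_inv_into[OF bij])
  moreover have "E u v \<longleftrightarrow> (?g u, ?g v) \<in> parcs X" if "u \<in> V" "v \<in> V" for u v
  proof -
    have *: "?g x \<in> pverts X \<and> f (?g x) = x" if "x \<in> V" for x
      using bij that f_the_inv_into_f_bij_betw[OF bij, of x] calculation
      by (auto simp: bij_betw_def)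
    then show ?thesis using adj[of "?g u" "?g v"] that by simp
  qed
  ultimately show ?thesis
    unfolding digraph_iso_pair_iff[OF wf wfX] by blast
qed

section \<open>Covering a graph by translates of a partitioned union of components\<close>

definition clique_partitioned :: "'a set \<Rightarrow> 'a set set \<Rightarrow> bool" where
  "clique_partitioned U P \<longleftrightarrow> U \<subseteq> V \<and> (\<forall>u\<in>U. \<forall>v. E u v \<longrightarrow> v \<in> U) \<and> partition_on U P \<and>
     (\<forall>Q\<in>P. clique G Q \<and> card Q = card C)"

text \<open>Move \<open>K\<close> by an automorphism that takes \<open>k\<close> to
  \<open>v\<close>. Since \<open>U\<close> is closed under adjacency, a moved clique either lies
  inside \<open>U\<close> or misses it; adding the cliques that miss \<open>U\<close> to
  \<open>P\<close> keeps the union disjoint.\<close>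

lemma clique_partitioned_extend:
  assumes U: "clique_partitioned U P" and K: "clique_partitioned K R"
    and v: "v \<in> V - U" and k: "k \<in> K"
  shows "\<exists>W P'. clique_partitioned W P' \<and> U \<subset> W"
proof -
  obtain f where f: "f \<in> auts" "f k = v"
    using ex_aut[of k v] K k v by (auto simp: clique_partitioned_def)
  let ?R = "{f ` Q |Q. Q \<in> R \<and> f ` Q \<inter> U = {}}"
  have KR: "K = \<Union>R" "{} \<notin> R" "disjoint R" using K by (auto simp: clique_partitioned_def partition_on_def)
  have UP: "U = \<Union>P" "{} \<notin> P" "disjoint P" using U by (auto simp: clique_partitioned_def partition_on_def)
  have inU: "f ` Q \<subseteq> U" if Q: "Q \<in> R" "f ` Q \<inter> U \<noteq> {}" for Q
  proof -
    have "clique G (f ` Q)"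
      using K Q clique_image[OF f(1)] by (auto simp: clique_partitioned_def)
    moreover obtain a where "a \<in> f ` Q" "a \<in> U" using Q(2) by blast
    ultimately have "y = a \<or> E a y" if "y \<in> f ` Q" for y
      using that cliqueD by metis
    then show ?thesis using \<open>a \<in> U\<close> U unfolding clique_partitioned_def by blast
  qed
  have W: "\<Union>(P \<union> ?R) = U \<union> f ` K"
  proof (intro equalityI subsetI)
    fix y assume "y \<in> U \<union> f ` K"
    then show "y \<in> \<Union>(P \<union> ?R)"
    proof (cases "y \<in> U")
      case True
      then show ?thesis using UP(1) by simp
    next
      case False
      with \<open>y \<in> U \<union> f ` K\<close> obtain Q where Q: "Q \<in> R" "y \<in> f ` Q" using KR(1) by auto
      then have "f ` Q \<inter> U = {}" using inU[of Q] False by auto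
      with Q show ?thesis by auto
    qed
  qed (use KR(1) UP(1) in auto)
  have "clique_partitioned (U \<union> f ` K) (P \<union> ?R)"
    unfolding clique_partitioned_def
  proof (intro conjI ballI allI impI)
    show "U \<union> f ` K \<subseteq> V"
      using U K autD(3)[OF f(1)] by (auto simp: clique_partitioned_def)
    show "y \<in> U \<union> f ` K" if x: "x \<in> U \<union> f ` K" and e: "E x y" for x y
    proof (cases "x \<in> U")
      case True
      then show ?thesis using U e by (auto simp: clique_partitioned_def)
    next
      case False
      then obtain x' where x': "x' \<in> K" "x = f x'" using x by blast
      obtain y' where "y = f y'" using autD(4)[OF f(1)] by (metis surjD)
      then have "E x' y'" using e x' autD(1)[OF f(1)] by simp
      then show ?thesis using K x' \<open>y = f y'\<close> by (auto simp: clique_partitioned_def)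
    qed
    show "partition_on (U \<union> f ` K) (P \<union> ?R)"
    proof (rule partition_onI)
      show "\<Union>(P \<union> ?R) = U \<union> f ` K" by (rule W)
      show "{} \<notin> P \<union> ?R"
        using UP(2) KR(2) by auto
      show "disjnt p q" if pq: "p \<in> P \<union> ?R" "q \<in> P \<union> ?R" "p \<noteq> q" for p q
      proof -
        have PP: "a \<inter> b = {}" if "a \<in> P" "b \<in> P" "a \<noteq> b" for a b
          using UP(3) that by (auto simp: disjoint_def)
        have PR: "a \<inter> b = {}" if "a \<in> P" "b \<in> ?R" for a b
          using UP(1) that by blast
        have RR: "a \<inter> b = {}" if ab: "a \<in> ?R" "b \<in> ?R" "a \<noteq> b" for a b
        proof -
          obtain a' b' where q: "a' \<in> R" "b' \<in> R" "a = f ` a'" "b = f ` b'" using ab by blast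
          then have "a' \<inter> b' = {}" using KR(3) ab(3) by (auto simp: disjoint_def)
          then show ?thesis using q autD(2)[OF f(1)] by auto
        qed
        consider "p \<in> P" "q \<in> P" | "p \<in> P" "q \<in> ?R" | "p \<in> ?R" "q \<in> P" | "p \<in> ?R" "q \<in> ?R"
          using Un_iff[THEN iffD1, OF pq(1)] Un_iff[THEN iffD1, OF pq(2)] by argo
        then have "p \<inter> q = {}"
        proof cases
          case 1 then show ?thesis using PP pq(3) by simp
        next
          case 2 then show ?thesis by (rule PR)
        next
          case 3 then show ?thesis using PR[of q p] by (simp add: Int_commute)
        next
          case 4 then show ?thesis by (rule RR) (rule pq(3))
        qed
        then show ?thesis by (simp add: disjnt_def)
      qed
    qed
    fix Q assume "Q \<in> P \<union> ?R"
    then show "clique G Q" "card Q = card C"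
      using U K clique_image[OF f(1)] by (auto simp: clique_partitioned_def)
  qed
  moreover have "U \<subset> U \<union> f ` K" using v k f(2) by auto
  ultimately show ?thesis by blast
qed

text \<open>A maximal partitioned union of components is all of \<open>V\<close>, because a
  translate of \<open>K\<close> reaches any vertex left out. All cliques used have the size of
  \<open>C\<close>, hence are strong by \<open>card_clique_le\<close>.\<close>

lemma localizable_if_clique_partitioned:
  assumes K: "clique_partitioned K R" "K \<noteq> {}"
  shows "localizable G"
proof -
  let ?S = "{U. \<exists>P. clique_partitioned U P}"
  have "finite ?S"
    by (rule finite_subset[of _ "Pow V"]) (auto simp: clique_partitioned_def finite_V)
  moreover have "K \<in> ?S" using K by blast
  ultimately have "\<exists>U\<in>?S. K \<subseteq> U \<and> (\<forall>W\<in>?S. U \<subseteq> W \<longrightarrow> U = W)"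
    by (rule finite_has_maximal2)
  then obtain U P where P: "clique_partitioned U P" and max: "\<forall>W\<in>?S. U \<subseteq> W \<longrightarrow> U = W"
    by auto
  have "U = V"
  proof (rule ccontr)
    assume "U \<noteq> V"
    then obtain v where "v \<in> V - U" using P by (auto simp: clique_partitioned_def)
    moreover obtain k where "k \<in> K" using K by blast
    ultimately obtain W P' where "clique_partitioned W P'" "U \<subset> W"
      using clique_partitioned_extend[OF P K(1)] by metis
    then show False using max by auto
  qed
  then show ?thesis
    using P card_clique_le(2) by (auto simp: localizable_def clique_partitioned_def)
qed

lemma embeds_localizable:
  assumes X: "tiled_graph (card C) X" and f: "embeds X f"
  shows "localizable G"
proof -
  let ?fib = "\<lambda>p x. {y \<in> pverts X. p y = p x}"
  obtain p :: "_ \<Rightarrow> nat" where p: "\<And>x. x \<in> pverts X \<Longrightarrow> clique X (?fib p x) \<and> card (?fib p x) = card C"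
    using X unfolding tiled_graph_def by blast
  have inj: "inj_on f (pverts X)" using f by (simp add: embeds_def)
  have "clique_partitioned (f ` pverts X) {f ` ?fib p x |x. x \<in> pverts X}"
    unfolding clique_partitioned_def
  proof (intro conjI ballI allI impI)
    show "f ` pverts X \<subseteq> V" using f by (simp add: embeds_def)
    show "v \<in> f ` pverts X" if "u \<in> f ` pverts X" "E u v" for u v
      using embeds_nbs[OF X f] that by auto
    show "partition_on (f ` pverts X) {f ` ?fib p x |x. x \<in> pverts X}"
    proof (rule partition_onI)
      show "disjnt a b" if "a \<in> {f ` ?fib p x |x. x \<in> pverts X}" "b \<in> {f ` ?fib p x |x. x \<in> pverts X}"
        "a \<noteq> b" for a b
      proof -
        obtain x y where xy: "x \<in> pverts X" "y \<in> pverts X" "a = f ` ?fib p x" "b = f ` ?fib p y"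
          using \<open>a \<in> _\<close> \<open>b \<in> _\<close> by blast
        then have "p x \<noteq> p y" using \<open>a \<noteq> b\<close> by auto
        then have "?fib p x \<inter> ?fib p y = {}" by auto
        moreover have "f ` (?fib p x \<inter> ?fib p y) = a \<inter> b"
          unfolding xy by (rule inj_on_image_Int[OF inj]) auto
        ultimately show ?thesis by (simp add: disjnt_def)
      qed
    qed auto
    fix Q assume "Q \<in> {f ` ?fib p x |x. x \<in> pverts X}"
    then obtain x where x: "x \<in> pverts X" "Q = f ` ?fib p x" by blast
    have "inj_on f (?fib p x)" using inj by (rule inj_on_subset) auto
    then show "card Q = card C" using p x by (simp add: card_image)
    show "clique G Q"
      unfolding clique_def
    proof (intro conjI ballI impI)
      show "Q \<subseteq> V" using f x(2) by (auto simp: embeds_def)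
      fix u v assume "u \<in> Q" "v \<in> Q" "u \<noteq> v"
      then obtain y z where "y \<in> ?fib p x" "z \<in> ?fib p x" "u = f y" "v = f z" "y \<noteq> z"
        unfolding x(2) by blast
      then show "E u v" using cliqueD[of X "?fib p x" y z] p[OF x(1)] f by (simp add: embeds_def)
    qed
  qed
  then show ?thesis
    using X by (intro localizable_if_clique_partitioned) (auto simp: tiled_graph_def)
qed

end

text \<open>The cycle is a path of maximal length: its last vertex has a second neighbour, which can only be
  the first vertex of the path.\<close>

lemma two_regular_cycle:
  fixes R :: "'b \<Rightarrow> 'b \<Rightarrow> bool"
  assumes W: "finite W" "W \<noteq> {}"
    and R: "\<And>x y. R x y \<Longrightarrow> R y x" "\<And>x y. R x y \<Longrightarrow> y \<in> W" "\<And>x. \<not> R x x"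
    and deg: "\<And>x. x \<in> W \<Longrightarrow> card {y. R x y} = 2"
  shows "\<exists>n\<ge>3. \<exists>g :: nat \<Rightarrow> 'b. inj_on g {..<n} \<and> g ` {..<n} \<subseteq> W \<and> (\<forall>i<n. R (g i) (g (Suc i mod n)))"
proof -
  define path where "path n g \<longleftrightarrow> n \<ge> 1 \<and> inj_on g {..<n} \<and> g ` {..<n} \<subseteq> W \<and> (\<forall>i. Suc i < n \<longrightarrow> R (g i) (g (Suc i)))"
    for n and g :: "nat \<Rightarrow> 'b"
  have le: "n \<le> card W" if "path n g" for n g
    using that card_inj_on_le[of g "{..<n}" W] W by (auto simp: path_def)
  obtain w where "w \<in> W" using W by blast
  then have "path 1 (\<lambda>_. w)" by (auto simp: path_def inj_on_def)
  then have ex: "\<exists>g. path 1 g" by blast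
  define n where "n = (GREATEST n. \<exists>g. path n g)"
  have "\<exists>g. path n g"
    unfolding n_def by (rule GreatestI_nat[where b = "card W"]) (use ex le in blast)+
  then obtain g where g: "path n g" by blast
  have max: "m \<le> n" if "path m h" for m h
    unfolding n_def by (rule Greatest_le_nat[where b = "card W"]) (use that le in blast)+
  have n1: "n \<ge> 1" and inj: "inj_on g {..<n}" and gW: "g ` {..<n} \<subseteq> W"
    and step: "\<And>i. Suc i < n \<Longrightarrow> R (g i) (g (Suc i))" using g by (auto simp: path_def)
  define l where "l = n - 1"
  have l: "l < n" "n = Suc l" using n1 by (auto simp: l_def)
  have on_path: "y \<in> g ` {..<n}" if "R (g l) y" for y
  proof (rule ccontr)
    assume y: "y \<notin> g ` {..<n}"
    have "path (Suc n) (g(n := y))"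
      unfolding path_def
    proof (intro conjI allI impI)
      show "inj_on (g(n := y)) {..<Suc n}"
        using inj y by (auto simp: lessThan_Suc inj_on_def)
      show "g(n := y) ` {..<Suc n} \<subseteq> W"
        using gW R(2)[OF that] by (auto simp: lessThan_Suc)
      show "R ((g(n := y)) i) ((g(n := y)) (Suc i))" if "Suc i < Suc n" for i
        using step[of i] that \<open>R (g l) y\<close> l by (cases "Suc i = n") auto
    qed simp
    then show False using max by fastforce
  qed
  have lW: "g i \<in> W" if "i < n" for i using gW that by auto
  have "card {y. R (g l) y} = 2" using deg lW l by blast
  then obtain y1 y2 where y: "{y. R (g l) y} = {y1, y2}" "y1 \<noteq> y2" by (auto simp: card_2_iff)
  then have "R (g l) y1" "R (g l) y2" by auto
  then obtain j1 j2 where j: "j1 < n" "j2 < n" "y1 = g j1" "y2 = g j2"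
    using on_path by (meson imageE lessThan_iff)
  \<comment> \<open>Both indices are below \<open>l\<close> and they differ, so the smaller one
    satisfies \<open>Suc j < l\<close>: it is not the predecessor of the last vertex.\<close>
  define j where "j = min j1 j2"
  have "R (g l) (g j)" "j < n" "j1 \<noteq> j2"
    using j y \<open>R (g l) y1\<close> \<open>R (g l) y2\<close> by (auto simp: j_def min_def)
  have "j1 \<noteq> l" "j2 \<noteq> l" using R(3) j \<open>R (g l) y1\<close> \<open>R (g l) y2\<close> by auto
  then have jl: "Suc j < l" using j \<open>j1 \<noteq> j2\<close> l by (auto simp: j_def min_def)
  have "j = 0"
  proof (rule ccontr)
    \<comment> \<open>An inner vertex \<open>g j\<close> would have three neighbours: its two
      neighbours on the path and \<open>g l\<close>.\<close>
    assume "j \<noteq> 0"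
    then obtain i where i: "j = Suc i" using not0_implies_Suc by blast
    have "{g i, g (Suc j), g l} \<subseteq> {y. R (g j) y}"
      using R(1) step[of i] step[of j] \<open>R (g l) (g j)\<close> \<open>j < n\<close> jl l i by auto
    moreover have "finite {y. R (g j) y}"
      using W(1) by (rule finite_subset[rotated]) (use R(2) in auto)
    ultimately have "card {g i, g (Suc j), g l} \<le> 2"
      using deg[OF lW[OF \<open>j < n\<close>]] card_mono by metis
    moreover have "card {g i, g (Suc j), g l} = 3"
    proof -
      have "g a \<noteq> g b" if "a < n" "b < n" "a \<noteq> b" for a b
        using inj that by (auto simp: inj_on_def)
      then have "g i \<noteq> g (Suc j)" "g i \<noteq> g l" "g (Suc j) \<noteq> g l" using i jl l by simp_all
      then show ?thesis by simp
    qed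
    ultimately show False by simp
  qed
  have "R (g i) (g (Suc i mod n))" if "i < n" for i
  proof (cases "i = l")
    case True
    then show ?thesis using \<open>R (g l) (g j)\<close> \<open>j = 0\<close> l by simp
  next
    case False
    then show ?thesis using step[of i] that l by simp
  qed
  moreover have "n \<ge> 3" using jl l by simp
  ultimately show ?thesis using inj gW by blast
qed

section \<open>The graphs of the list\<close>

lemma maximal_independent_dominates:
  assumes X: "sym (parcs X)" "irrefl (parcs X)" and I: "maximal_independent_set X I"
    and a: "a \<in> pverts X" "a \<notin> I"
  shows "\<exists>i\<in>I. (a, i) \<in> parcs X"
proof (rule ccontr)
  assume no: "\<not> ?thesis"
  have ind: "independent_set X I" and max: "\<And>J. independent_set X J \<Longrightarrow> I \<subseteq> J \<Longrightarrow> J = I"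
    using I by (auto simp: maximal_independent_set_def)
  have "independent_set X (insert a I)"
    using ind a no symD[OF X(1)] irreflD[OF X(2)] unfolding independent_set_def by blast
  then have "insert a I = I" by (rule max) auto
  with a show False by auto
qed

text \<open>If \<open>I\<close> missed \<open>D\<close>, maximality would give \<open>a\<close> and
  \<open>b\<close> neighbours in \<open>I\<close> outside \<open>D\<close>, and these are adjacent
  by \<open>adj\<close>. The choice \<open>a = b\<close> is allowed.\<close>

lemma strong_cliqueI2:
  assumes X: "sym (parcs X)" "irrefl (parcs X)" and D: "clique X D" "a \<in> D" "b \<in> D"
    and adj: "\<And>x y. (a, x) \<in> parcs X \<Longrightarrow> (b, y) \<in> parcs X \<Longrightarrow> x \<notin> D \<Longrightarrow> y \<notin> D \<Longrightarrow> (x, y) \<in> parcs X"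
  shows "strong_clique X D"
  unfolding strong_clique_def
proof (intro conjI allI impI notI)
  fix I assume I: "maximal_independent_set X I" and "D \<inter> I = {}"
  then have "a \<notin> I" "b \<notin> I" using D by auto
  moreover have "a \<in> pverts X" "b \<in> pverts X" using D by (auto simp: clique_def)
  ultimately obtain x y where "x \<in> I" "(a, x) \<in> parcs X" "y \<in> I" "(b, y) \<in> parcs X"
    using maximal_independent_dominates[OF X I] by blast
  moreover have "(x, y) \<notin> parcs X" using I calculation
    by (auto simp: maximal_independent_set_def independent_set_def)
  ultimately show False using adj \<open>D \<inter> I = {}\<close> by blast
qed (rule D)

text \<open>Pigeonhole: the outside neighbours lie in two triangles, \<open>a1 b1 c1\<close> and
  \<open>a2 b2 c2\<close>. An independent set dominating \<open>a\<close>, \<open>b\<close>,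
  \<open>c\<close> from outside would pick three of them, two of which carry the same index and so
  are adjacent.\<close>

lemma strong_cliqueI3:
  assumes X: "sym (parcs X)" "irrefl (parcs X)" and D: "clique X {a, b, c}"
    and a: "\<And>y. (a, y) \<in> parcs X \<Longrightarrow> y \<notin> {a, b, c} \<Longrightarrow> y = a1 \<or> y = a2"
    and b: "\<And>y. (b, y) \<in> parcs X \<Longrightarrow> y \<notin> {a, b, c} \<Longrightarrow> y = b1 \<or> y = b2"
    and c: "\<And>y. (c, y) \<in> parcs X \<Longrightarrow> y \<notin> {a, b, c} \<Longrightarrow> y = c1 \<or> y = c2"
    and 1: "(a1, b1) \<in> parcs X" "(b1, c1) \<in> parcs X" "(a1, c1) \<in> parcs X"
    and 2: "(a2, b2) \<in> parcs X" "(b2, c2) \<in> parcs X" "(a2, c2) \<in> parcs X"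
  shows "strong_clique X {a, b, c}"
  unfolding strong_clique_def
proof (intro conjI allI impI notI)
  fix I assume I: "maximal_independent_set X I" and dis: "{a, b, c} \<inter> I = {}"
  have dom: "\<exists>i\<in>I. (v, i) \<in> parcs X" if "v \<in> {a, b, c}" for v
    using maximal_independent_dominates[OF X I, of v] dis that D by (auto simp: clique_def)
  have "a1 \<in> I \<or> a2 \<in> I" "b1 \<in> I \<or> b2 \<in> I" "c1 \<in> I \<or> c2 \<in> I"
    using dom[of a] dom[of b] dom[of c] dis a b c by blast+
  moreover have ind: "(x, y) \<notin> parcs X" if "x \<in> I" "y \<in> I" for x y
    using I that by (auto simp: maximal_independent_set_def independent_set_def)
  ultimately show False using 1 2 by blast
qed (rule D)

lemma iso_strong_clique:
  assumes G: "pair_wf_digraph G" and X: "pair_wf_digraph X"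
    and iso: "digraph_iso (with_proj G) (with_proj X)" and D: "strong_clique X D"
  shows "\<exists>C. strong_clique G C"
proof -
  obtain f where bij: "bij_betw f (pverts G) (pverts X)"
    and adj: "\<forall>u\<in>pverts G. \<forall>v\<in>pverts G. (u, v) \<in> parcs G \<longleftrightarrow> (f u, f v) \<in> parcs X"
    using iso unfolding digraph_iso_pair_iff[OF G X] by blast
  have inj: "inj_on f (pverts G)" and img: "f ` pverts G = pverts X"
    using bij by (auto simp: bij_betw_def)
  define C where "C = {v \<in> pverts G. f v \<in> D}"
  have "clique G C"
    unfolding clique_def
  proof (intro conjI ballI impI)
    fix u v assume uv: "u \<in> C" "v \<in> C" "u \<noteq> v"
    then have "f u \<noteq> f v" using inj by (auto simp: C_def inj_on_def)
    then have "(f u, f v) \<in> parcs X"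
      using uv D cliqueD[of X D "f u" "f v"] by (simp add: C_def strong_clique_def)
    then show "(u, v) \<in> parcs G" using uv adj by (simp add: C_def)
  qed (simp add: C_def)
  moreover have "C \<inter> I \<noteq> {}" if I: "maximal_independent_set G I" for I
  proof -
    have IG: "I \<subseteq> pverts G" using I by (simp add: maximal_independent_set_def independent_set_def)
    have "independent_set X (f ` I)"
      unfolding independent_set_def
    proof (intro conjI ballI)
      show "f ` I \<subseteq> pverts X" using IG img by blast
      fix x y assume "x \<in> f ` I" "y \<in> f ` I"
      then obtain u v where uv: "u \<in> I" "v \<in> I" "x = f u" "y = f v" by blast
      then have "(u, v) \<notin> parcs G" using I by (simp add: maximal_independent_set_def independent_set_def)
      then show "(x, y) \<notin> parcs X" using uv IG adj by (simp add: subset_iff)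
    qed
    moreover have "J = f ` I" if J: "independent_set X J" "f ` I \<subseteq> J" for J
    proof -
      let ?J = "{v \<in> pverts G. f v \<in> J}"
      have "independent_set G ?J" using J(1) adj by (simp add: independent_set_def)
      moreover have "I \<subseteq> ?J" using IG J by auto
      ultimately have "?J = I" using I by (simp add: maximal_independent_set_def)
      have "J \<subseteq> f ` ?J" using J(1) img by (auto simp: independent_set_def)
      then show ?thesis using J(2) \<open>?J = I\<close> by simp
    qed
    ultimately have "maximal_independent_set X (f ` I)" by (simp add: maximal_independent_set_def)
    then have "D \<inter> f ` I \<noteq> {}" using D by (simp add: strong_clique_def)
    then show ?thesis using IG by (auto simp: C_def)
  qed
  ultimately have "strong_clique G C" by (simp add: strong_clique_def)
  then show ?thesis by blast
qed

section \<open>Partitions of the listed graphs into cliques\<close>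

lemma less_numeral_cases:
  "(i::nat) < 2 \<longleftrightarrow> i = 0 \<or> i = 1"
  "(i::nat) < 3 \<longleftrightarrow> i = 0 \<or> i = 1 \<or> i = 2"
  "(i::nat) < 4 \<longleftrightarrow> i = 0 \<or> i = 1 \<or> i = 2 \<or> i = 3"
  by linarith+

lemma pair_wf_digraphI: "parcs X \<subseteq> pverts X \<times> pverts X \<Longrightarrow> pair_wf_digraph X"
  by unfold_locales auto

lemma tiled_complete_graph: "tiled_graph 5 (complete_graph 5)"
  unfolding tiled_graph_def
proof (intro conjI ballI)
  show "pair_wf_digraph (complete_graph 5)"
    by (rule pair_wf_digraphI) (auto simp: complete_graph_def)
  show "\<exists>N. card N = 4 \<and> (\<forall>y\<in>N. (x, y) \<in> parcs (complete_graph 5))" if "x \<in> pverts (complete_graph 5)" for x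
    using that by (intro exI[of _ "{..<5} - {x}"]) (auto simp: complete_graph_def)
  show "\<exists>p :: nat \<Rightarrow> nat. \<forall>x\<in>pverts (complete_graph 5). clique (complete_graph 5) {y \<in> pverts (complete_graph 5). p y = p x} \<and>
        card {y \<in> pverts (complete_graph 5). p y = p x} = 5"
    by (rule exI[of _ "\<lambda>_. 0"]) (auto simp: complete_graph_def clique_def)
qed (simp add: complete_graph_def lessThan_empty_iff)

lemma tiled_complete_bipartite_graph: "tiled_graph 2 (complete_bipartite_graph 4 4)"
proof -
  let ?X = "complete_bipartite_graph 4 4"
  have V: "pverts ?X = {..<4} <+> {..<4}" by (simp add: complete_bipartite_graph_def)
  let ?p = "\<lambda>x :: nat + nat. case x of Inl i \<Rightarrow> i | Inr i \<Rightarrow> i"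
  have fib: "{y \<in> pverts ?X. ?p y = ?p x} = {Inl (?p x), Inr (?p x)}" if "x \<in> pverts ?X" for x
  proof (rule Set.set_eqI)
    fix y show "y \<in> {y \<in> pverts ?X. ?p y = ?p x} \<longleftrightarrow> y \<in> {Inl (?p x), Inr (?p x)}"
      using that unfolding V by (cases y; cases x) auto
  qed
  show ?thesis
    unfolding tiled_graph_def
  proof (intro conjI ballI)
    show "pair_wf_digraph ?X"
      by (rule pair_wf_digraphI) (auto simp: complete_bipartite_graph_def)
    show "pverts ?X \<noteq> {}" unfolding V by (auto simp: lessThan_empty_iff)
    show "\<exists>N. card N = 4 \<and> (\<forall>y\<in>N. (x, y) \<in> parcs ?X)" if x: "x \<in> pverts ?X" for x
    proof (cases x)
      case (Inl i)
      then show ?thesis using x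
        by (intro exI[of _ "Inr ` {..<4}"]) (auto simp: complete_bipartite_graph_def card_image)
    next
      case (Inr i)
      then show ?thesis using x
        by (intro exI[of _ "Inl ` {..<4}"]) (auto simp: complete_bipartite_graph_def card_image)
    qed
    show "\<exists>p :: nat + nat \<Rightarrow> nat. \<forall>x\<in>pverts ?X. clique ?X {y \<in> pverts ?X. p y = p x} \<and>
        card {y \<in> pverts ?X. p y = p x} = 2"
    proof (rule exI[of _ ?p], intro ballI)
      fix x assume x: "x \<in> pverts ?X"
      have "?p x < 4" using x by (auto simp: V)
      then have "clique ?X {Inl (?p x), Inr (?p x)}"
        by (auto simp: clique_def complete_bipartite_graph_def)
      then show "clique ?X {y \<in> pverts ?X. ?p y = ?p x} \<and> card {y \<in> pverts ?X. ?p y = ?p x} = 2"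
        unfolding fib[OF x] by simp
    qed
  qed
qed

lemma tiled_lexicographic_product:
  "tiled_graph 3 (lexicographic_product (complete_graph 3) (edgeless_graph 2))" (is "tiled_graph 3 ?X")
proof -
  have V: "pverts ?X = {..<3} \<times> {..<2}"
    by (simp add: lexicographic_product_def complete_graph_def edgeless_graph_def)
  have A: "parcs ?X = {((u, x), (v, y)). u < 3 \<and> x < 2 \<and> v < 3 \<and> y < 2 \<and> u \<noteq> v}"
    by (auto simp: lexicographic_product_def complete_graph_def edgeless_graph_def)
  have fib: "{y \<in> pverts ?X. snd y = snd x} = {..<3} \<times> {snd x}" if "x \<in> pverts ?X" for x
    using that unfolding V by auto
  show ?thesis
    unfolding tiled_graph_def
  proof (intro conjI ballI)
    show "pair_wf_digraph ?X"
      by (rule pair_wf_digraphI) (auto simp: A V)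
    show "pverts ?X \<noteq> {}" unfolding V by (auto simp: lessThan_empty_iff)
    show "\<exists>N. card N = 4 \<and> (\<forall>y\<in>N. (x, y) \<in> parcs ?X)" if x: "x \<in> pverts ?X" for x
      using x by (intro exI[of _ "({..<3} - {fst x}) \<times> {..<2}"]) (auto simp: A V card_cartesian_product)
    show "\<exists>p :: nat \<times> nat \<Rightarrow> nat. \<forall>x\<in>pverts ?X. clique ?X {y \<in> pverts ?X. p y = p x} \<and>
        card {y \<in> pverts ?X. p y = p x} = 3"
      by (rule exI[of _ snd], intro ballI, subst (1 2) fib) (auto simp: clique_def A V card_cartesian_product)
  qed
qed

lemma prism_verts: "pverts (cartesian_product (cycle_graph 3) (cycle_graph n)) = {..<3} \<times> {..<n}"
  by (simp add: cartesian_product_def cycle_graph_def)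

lemma prism_arcs:
  assumes "n \<ge> 3"
  shows "((r, i), (s, j)) \<in> parcs (cartesian_product (cycle_graph 3) (cycle_graph n)) \<longleftrightarrow>
    r < 3 \<and> s < 3 \<and> i < n \<and> j < n \<and> ((i = j \<and> r \<noteq> s) \<or> (r = s \<and> (j = Suc i mod n \<or> i = Suc j mod n)))"
proof -
  have verts: "pverts (cycle_graph m) = {..<m}" for m by (simp add: cycle_graph_def)
  have arcs: "(a, b) \<in> parcs (cycle_graph m) \<longleftrightarrow> a < m \<and> b < m \<and> (b = Suc a mod m \<or> a = Suc b mod m)" for a b m
    by (simp add: cycle_graph_def)
  have tri: "(r, s) \<in> parcs (cycle_graph 3) \<longleftrightarrow> r \<noteq> s" if "r < 3" "s < 3"
  proof -
    have "r = 0 \<or> r = 1 \<or> r = 2" "s = 0 \<or> s = 1 \<or> s = 2" using that by linarith+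
    then show ?thesis unfolding arcs by (elim disjE) simp_all
  qed
  have "((r, i), (s, j)) \<in> parcs (cartesian_product (cycle_graph 3) (cycle_graph n)) \<longleftrightarrow>
    r < 3 \<and> i < n \<and> s < 3 \<and> j < n \<and>
    ((r = s \<and> (i, j) \<in> parcs (cycle_graph n)) \<or> (i = j \<and> (r, s) \<in> parcs (cycle_graph 3)))"
    by (simp add: cartesian_product_def verts)
  then show ?thesis using tri arcs[of i j n] by argo
qed

lemma tiled_prism:
  assumes n: "n \<ge> 3"
  shows "tiled_graph 3 (cartesian_product (cycle_graph 3) (cycle_graph n))" (is "tiled_graph 3 ?X")
proof -
  note A = prism_arcs[OF n] and V = prism_verts[of n]
  have fib: "{y \<in> pverts ?X. snd y = snd x} = {..<3} \<times> {snd x}" if "x \<in> pverts ?X" for x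
    using that unfolding V by auto
  show ?thesis
    unfolding tiled_graph_def
  proof (intro conjI ballI)
    show "pair_wf_digraph ?X"
      by (rule pair_wf_digraphI) (auto simp: A V)
    show "pverts ?X \<noteq> {}" unfolding V using n by (auto simp: lessThan_empty_iff)
    show "\<exists>N. card N = 4 \<and> (\<forall>y\<in>N. (x, y) \<in> parcs ?X)" if x: "x \<in> pverts ?X" for x
    proof -
      obtain r i where x: "x = (r, i)" "r < 3" "i < n" using x V by auto
      \<comment> \<open>The cyclic predecessor of \<open>i\<close>; it differs from the successor
        because \<open>n \<ge> 3\<close>.\<close>
      define l where "l = (if i = 0 then n - 1 else i - 1)"
      have l: "l < n" "Suc l mod n = i" "l \<noteq> Suc i mod n"
        using x(3) n by (auto simp: l_def mod_Suc)
      let ?N = "({..<3} - {r}) \<times> {i} \<union> {(r, Suc i mod n), (r, l)}"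
      have "card ?N = 2 + 2"
        using l(3) x by (subst card_Un_disjoint) (auto simp: card_cartesian_product)
      then show ?thesis using x l n by (intro exI[of _ ?N]) (auto simp: A)
    qed
    show "\<exists>p :: nat \<times> nat \<Rightarrow> nat. \<forall>x\<in>pverts ?X. clique ?X {y \<in> pverts ?X. p y = p x} \<and>
        card {y \<in> pverts ?X. p y = p x} = 3"
      by (rule exI[of _ snd], intro ballI, subst (1 2) fib) (auto simp: clique_def A V card_cartesian_product)
  qed
qed

lemma tiled_H_graph:
  assumes n: "n \<ge> 2"
  shows "tiled_graph 4 (H_graph n)" (is "tiled_graph 4 ?X")
proof -
  have UNIV: "(UNIV :: H_letter set) = {Hx, Hy, Hz, Hw}"
    using H_letter.exhaust by auto
  have V: "pverts ?X = UNIV \<times> {1..n}" by (simp add: H_graph_def H_verts_def UNIV)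
  have fin: "finite (UNIV :: H_letter set)" unfolding UNIV by simp
  have fib: "{y \<in> pverts ?X. snd y = snd x} = UNIV \<times> {snd x}" if "x \<in> pverts ?X" for x
    using that unfolding V by auto
  have in_block: "((a, i), (b, i)) \<in> parcs ?X" if "i \<in> {1..n}" "a \<noteq> b" for a b i
    using that by (auto simp: H_graph_def)
  have link: "\<exists>b j. j \<noteq> i \<and> ((a, i), (b, j)) \<in> parcs ?X" if i: "i \<in> {1..n}" for a i
  proof -
    have s: "H_succ n i \<noteq> i" using i n by (auto simp: H_succ_def)
    obtain l where l: "l \<in> {1..n}" "H_succ n l = i" "l \<noteq> i"
    proof (cases "i = 1")
      case True
      then show ?thesis using that[of n] n by (simp add: H_succ_def)
    next
      case False
      then have "i - 1 \<in> {1..n}" "H_succ n (i - 1) = i" "i - 1 \<noteq> i"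
        using i by (auto simp: H_succ_def)
      then show ?thesis by (rule that)
    qed
    show ?thesis
    proof (cases a)
      case Hx
      then show ?thesis using l by (intro exI[of _ Hz] exI[of _ l]) (auto simp: H_graph_def H_links_def)
    next
      case Hy
      then show ?thesis using l by (intro exI[of _ Hw] exI[of _ l]) (auto simp: H_graph_def H_links_def)
    next
      case Hz
      then show ?thesis using i s by (intro exI[of _ Hx] exI[of _ "H_succ n i"]) (auto simp: H_graph_def H_links_def)
    next
      case Hw
      then show ?thesis using i s by (intro exI[of _ Hy] exI[of _ "H_succ n i"]) (auto simp: H_graph_def H_links_def)
    qed
  qed
  show ?thesis
    unfolding tiled_graph_def
  proof (intro conjI ballI)
    show "pair_wf_digraph ?X"
    proof -
      interpret pair_graph ?X by (rule pair_graph_H_graph[OF n])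
      show ?thesis by unfold_locales
    qed
    show "pverts ?X \<noteq> {}" unfolding V using n by auto
    show "\<exists>N. card N = 4 \<and> (\<forall>y\<in>N. (x, y) \<in> parcs ?X)" if x: "x \<in> pverts ?X" for x
    proof -
      obtain a i where x: "x = (a, i)" "i \<in> {1..n}" using x V by auto
      obtain b j where b: "j \<noteq> i" "((a, i), (b, j)) \<in> parcs ?X" using link[OF x(2)] by blast
      have "card (UNIV - {a}) = 3"
        unfolding UNIV by (cases a) (simp_all add: insert_Diff_if)
      then have "card ((UNIV - {a}) \<times> {i}) = 3" by (simp add: card_cartesian_product)
      moreover have "(b, j) \<notin> (UNIV - {a}) \<times> {i}" "finite ((UNIV - {a}) \<times> {i})" using b fin by auto
      ultimately have "card (insert (b, j) ((UNIV - {a}) \<times> {i})) = 4" by simp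
      then show ?thesis
        using x b in_block by (intro exI[of _ "insert (b, j) ((UNIV - {a}) \<times> {i})"]) auto
    qed
    show "\<exists>p :: H_letter \<times> nat \<Rightarrow> nat. \<forall>x\<in>pverts ?X. clique ?X {y \<in> pverts ?X. p y = p x} \<and>
        card {y \<in> pverts ?X. p y = p x} = 4"
    proof (rule exI[of _ snd], intro ballI)
      fix x assume x: "x \<in> pverts ?X"
      have "card (UNIV \<times> {snd x} :: (H_letter \<times> nat) set) = 4"
        by (simp add: card_cartesian_product UNIV)
      moreover have "clique ?X (UNIV \<times> {snd x})"
        using x V in_block by (auto simp: clique_def)
      ultimately show "clique ?X {y \<in> pverts ?X. snd y = snd x} \<and> card {y \<in> pverts ?X. snd y = snd x} = 4"
        unfolding fib[OF x] by blast
    qed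
  qed
qed

lemma cayley_Z3k_verts: "k \<ge> 1 \<Longrightarrow> pverts (cayley_Z3k k) = {0..<3 * int k}"
  by (simp add: cayley_Z3k_def cayley_graph_def carrier_integer_mod_group)

lemma cayley_Z3k_arcs:
  assumes k: "k \<ge> 1"
  shows "(x, y) \<in> parcs (cayley_Z3k k) \<longleftrightarrow> x \<in> {0..<3 * int k} \<and> y \<in> {0..<3 * int k} \<and>
    (\<exists>a\<in>{1, - 1, int k, - int k}. y = (x + a) mod (3 * int k))"
proof -
  have "((- x) mod (3 * int k) + y) mod (3 * int k) = a mod (3 * int k) \<longleftrightarrow> y = (x + a) mod (3 * int k)"
    if "y \<in> {0..<3 * int k}" for a
  proof -
    have "((- x) mod (3 * int k) + y) mod (3 * int k) = (y - x) mod (3 * int k)"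
      by (simp add: mod_add_left_eq)
    moreover have "(y - x) mod (3 * int k) = a mod (3 * int k) \<longleftrightarrow> y mod (3 * int k) = (x + a) mod (3 * int k)"
      by (simp add: mod_eq_dvd_iff algebra_simps)
    ultimately show ?thesis using that by simp
  qed
  then have eq: "((- x) mod (3 * int k) + y) mod (3 * int k) \<in> (\<lambda>a. a mod (3 * int k)) ` S \<longleftrightarrow>
      (\<exists>a\<in>S. y = (x + a) mod (3 * int k))" if "y \<in> {0..<3 * int k}" for S
    using that unfolding image_iff by blast
  show ?thesis
  proof (cases "x \<in> {0..<3 * int k} \<and> y \<in> {0..<3 * int k}")
    case True
    then have "(x, y) \<in> parcs (cayley_Z3k k) \<longleftrightarrow>
        ((- x) mod (3 * int k) + y) mod (3 * int k) \<in> (\<lambda>a. a mod (3 * int k)) ` {1, - 1, int k, - int k}"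
      using k by (simp add: cayley_Z3k_def cayley_graph_def carrier_integer_mod_group del: image_insert)
    then show ?thesis using True eq by blast
  next
    case False
    then show ?thesis using k
      by (simp add: cayley_Z3k_def cayley_graph_def carrier_integer_mod_group del: image_insert) blast
  qed
qed

text \<open>Arcs are described through arbitrary integer representatives, which avoids case
  distinctions at the wrap-around.\<close>

lemma cayley_Z3k_arc_mod:
  assumes k: "k \<ge> 1" and d: "(3 * int k) dvd t - s - a" "a \<in> {1, - 1, int k, - int k}"
  shows "(s mod (3 * int k), t mod (3 * int k)) \<in> parcs (cayley_Z3k k)"
proof -
  have "t mod (3 * int k) = (s + a) mod (3 * int k)"
    using d(1) by (simp add: mod_eq_dvd_iff algebra_simps)
  then have "t mod (3 * int k) = (s mod (3 * int k) + a) mod (3 * int k)"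
    by (simp add: mod_add_left_eq)
  then show ?thesis unfolding cayley_Z3k_arcs[OF k] using d(2) k by auto
qed

text \<open>The cliques are the cosets of the subgroup of order 3 generated by \<open>k\<close>, so
  the colour is the residue modulo \<open>k\<close>.\<close>

lemma tiled_cayley_Z3k:
  assumes k: "k \<ge> 3"
  shows "tiled_graph 3 (cayley_Z3k k)" (is "tiled_graph 3 ?X")
proof -
  have k1: "k \<ge> 1" using k by simp
  note A = cayley_Z3k_arcs[OF k1] and V = cayley_Z3k_verts[OF k1]
  have fib: "{y \<in> pverts ?X. nat (y mod int k) = nat (x mod int k)} =
     {x mod int k, x mod int k + int k, x mod int k + 2 * int k}" (is "_ = ?F x") if "x \<in> pverts ?X" for x
  proof (intro equalityI subsetI)
    fix y assume "y \<in> {y \<in> pverts ?X. nat (y mod int k) = nat (x mod int k)}"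
    then have y: "0 \<le> y" "y < 3 * int k" "y mod int k = x mod int k"
      using k by (auto simp: V eq_nat_nat_iff)
    then have "y = int k * (y div int k) + x mod int k" by (metis mult_div_mod_eq)
    moreover have "0 \<le> y div int k" using y k by (simp add: pos_imp_zdiv_nonneg_iff)
    moreover have "y div int k < 3"
    proof -
      have "0 \<le> x mod int k" using k by simp
      then have "int k * (y div int k) < int k * 3" using \<open>y = _\<close> y(2) by linarith
      then show ?thesis using k by (simp add: mult_less_cancel_left_pos)
    qed
    ultimately have "y div int k \<in> {0, 1, 2}" by auto
    with \<open>y = _\<close> show "y \<in> ?F x" by auto
  next
    fix y assume y: "y \<in> ?F x"
    have "0 \<le> x mod int k" "x mod int k < int k" using k by auto
    then have "0 \<le> y" "y < 3 * int k" using y by auto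
    moreover have "y mod int k = x mod int k" using y by auto
    ultimately show "y \<in> {y \<in> pverts ?X. nat (y mod int k) = nat (x mod int k)}"
      by (simp add: V)
  qed
  show ?thesis
    unfolding tiled_graph_def
  proof (intro conjI ballI)
    show "pair_wf_digraph ?X"
      by (rule pair_wf_digraphI) (auto simp: A V)
    show "pverts ?X \<noteq> {}" unfolding V using k by auto
    show "\<exists>N. card N = 4 \<and> (\<forall>y\<in>N. (x, y) \<in> parcs ?X)" if x: "x \<in> pverts ?X" for x
    proof -
      let ?N = "(\<lambda>a. (x + a) mod (3 * int k)) ` {1, - 1, int k, - int k}"
      have "a = b" if "a \<in> {1, - 1, int k, - int k}" "b \<in> {1, - 1, int k, - int k}"
        "(x + a) mod (3 * int k) = (x + b) mod (3 * int k)" for a b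
      proof (rule ccontr)
        assume "a \<noteq> b"
        have "3 * int k dvd a - b" using that(3) by (simp add: mod_eq_dvd_iff)
        \<comment> \<open>Two elements of the connection set differ by at most 2k, so a nonzero
          difference is no multiple of 3k.\<close>
        then have "3 * int k \<le> \<bar>a - b\<bar>"
          using \<open>a \<noteq> b\<close> dvd_imp_le_int[of "a - b" "3 * int k"] by simp
        then show False using that(1,2) k by auto
      qed
      then have "inj_on (\<lambda>a. (x + a) mod (3 * int k)) {1, - 1, int k, - int k}"
        unfolding inj_on_def by blast
      then have "card ?N = card {1, - 1, int k, - int k}" by (rule card_image)
      also have "\<dots> = 4" using k by simp
      finally show ?thesis using x V k by (intro exI[of _ ?N]) (auto simp: A)
    qed
    show "\<exists>p :: int \<Rightarrow> nat. \<forall>x\<in>pverts ?X. clique ?X {y \<in> pverts ?X. p y = p x} \<and>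
        card {y \<in> pverts ?X. p y = p x} = 3"
    proof (rule exI[of _ "\<lambda>x. nat (x mod int k)"], intro ballI)
      fix x assume x: "x \<in> pverts ?X"
      define r where "r = x mod int k"
      have r: "0 \<le> r" "r < int k" using k by (auto simp: r_def)
      have m: "r mod (3 * int k) = r" "(r + int k) mod (3 * int k) = r + int k"
        "(r + 2 * int k) mod (3 * int k) = r + 2 * int k" using r by auto
      have arcs: "(r, r + int k) \<in> parcs ?X" "(r + int k, r) \<in> parcs ?X"
        "(r + int k, r + 2 * int k) \<in> parcs ?X" "(r + 2 * int k, r + int k) \<in> parcs ?X"
        "(r, r + 2 * int k) \<in> parcs ?X" "(r + 2 * int k, r) \<in> parcs ?X"
        using cayley_Z3k_arc_mod[OF k1, of "r + int k" r "int k"]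
          cayley_Z3k_arc_mod[OF k1, of r "r + int k" "- int k"]
          cayley_Z3k_arc_mod[OF k1, of "r + 2 * int k" "r + int k" "int k"]
          cayley_Z3k_arc_mod[OF k1, of "r + int k" "r + 2 * int k" "- int k"]
          cayley_Z3k_arc_mod[OF k1, of "r + 2 * int k" r "- int k"]
          cayley_Z3k_arc_mod[OF k1, of r "r + 2 * int k" "int k"]
        unfolding m by auto
      have "{r, r + int k, r + 2 * int k} \<subseteq> pverts ?X" unfolding V using r by auto
      then have "clique ?X {r, r + int k, r + 2 * int k}"
        unfolding clique_def using arcs by auto
      moreover have "card {r, r + int k, r + 2 * int k} = 3" using k by simp
      ultimately show "clique ?X {y \<in> pverts ?X. nat (y mod int k) = nat (x mod int k)} \<and>
         card {y \<in> pverts ?X. nat (y mod int k) = nat (x mod int k)} = 3"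
        unfolding fib[OF x] r_def by blast
    qed
  qed
qed


section \<open>A strong clique in each listed graph\<close>

lemma strong_clique_complete_graph: "strong_clique (complete_graph 5) {..<5}"
  \<comment> \<open>No arc leaves the clique, so \<open>adj\<close> holds vacuously and one vertex
    can serve as both \<open>a\<close> and \<open>b\<close>.\<close>
  by (rule strong_cliqueI2[of _ _ 0 0])
    (auto simp: complete_graph_def clique_def irrefl_def intro!: symI)

lemma strong_clique_complete_bipartite_graph:
  "strong_clique (complete_bipartite_graph 4 4) {Inl 0, Inr 0}"
  by (rule strong_cliqueI2[of _ _ "Inl 0" "Inr 0"])
    (auto simp: complete_bipartite_graph_def clique_def irrefl_def intro!: symI)

lemma strong_clique_lexicographic_product:
  "\<exists>D. strong_clique (lexicographic_product (complete_graph 3) (edgeless_graph 2)) D"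
proof -
  let ?X = "lexicographic_product (complete_graph 3) (edgeless_graph 2)"
  have V: "pverts ?X = {..<3} \<times> {..<2}"
    by (simp add: lexicographic_product_def complete_graph_def edgeless_graph_def)
  have A: "parcs ?X = {((u, x), (v, y)). u < 3 \<and> x < 2 \<and> v < 3 \<and> y < 2 \<and> u \<noteq> v}"
    by (auto simp: lexicographic_product_def complete_graph_def edgeless_graph_def)
  have "strong_clique ?X {(0, 0), (1, 0), (2, 0)}"
    \<comment> \<open>The three opposite vertices form a single triangle, and each vertex of the
      clique is adjacent to two of them. Two cyclic labellings of that one triangle serve as the two
      triangles of the criterion.\<close>
    by (rule strong_cliqueI3[where ?a1.0 = "(1, 1)" and ?b1.0 = "(2, 1)" and ?c1.0 = "(0, 1)"
          and ?a2.0 = "(2, 1)" and ?b2.0 = "(0, 1)" and ?c2.0 = "(1, 1)"])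
      (auto simp: A V clique_def irrefl_def less_numeral_cases intro!: symI)
  then show ?thesis by blast
qed

text \<open>The clique consists of the three edges at one vertex of K_{3,3}; the edges at the other
  two vertices of the same side form the two triangles of \<open>strong_cliqueI3\<close>.\<close>

lemma strong_clique_line_graph:
  "\<exists>D. strong_clique (line_graph (complete_bipartite_graph 3 3)) D"
proof -
  let ?X = "line_graph (complete_bipartite_graph 3 3)"
  let ?e = "\<lambda>i j :: nat. {Inl i, Inr j} :: (nat + nat) set"
  have V: "pverts ?X = {?e i j |i j. i < 3 \<and> j < 3}"
    by (auto simp: line_graph_def edge_sets_def complete_bipartite_graph_def insert_commute)
  have eq: "?e i j = ?e i' j' \<longleftrightarrow> i = i' \<and> j = j'" for i j i' j'
    by (auto simp: doubleton_eq_iff)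
  have A: "(?e i j, ?e i' j') \<in> parcs ?X \<longleftrightarrow> i < 3 \<and> j < 3 \<and> i' < 3 \<and> j' < 3 \<and> (i = i') \<noteq> (j = j')"
    for i j i' j'
  proof -
    have "(?e i j, ?e i' j') \<in> parcs ?X \<longleftrightarrow> ?e i j \<in> pverts ?X \<and> ?e i' j' \<in> pverts ?X \<and>
        ?e i j \<noteq> ?e i' j' \<and> ?e i j \<inter> ?e i' j' \<noteq> {}"
      by (auto simp: line_graph_def)
    also have "\<dots> \<longleftrightarrow> i < 3 \<and> j < 3 \<and> i' < 3 \<and> j' < 3 \<and> (i = i') \<noteq> (j = j')"
      unfolding V using eq by auto
    finally show ?thesis .
  qed
  have AV: "\<exists>i j. y = ?e i j \<and> i < 3 \<and> j < 3" if "(x, y) \<in> parcs ?X" for x y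
    using that V by (auto simp: line_graph_def)
  have nb: "y = ?e 1 j \<or> y = ?e 2 j" if y: "(?e 0 j, y) \<in> parcs ?X" "y \<notin> {?e 0 0, ?e 0 1, ?e 0 2}" for y j
  proof -
    obtain i' j' where y': "y = ?e i' j'" "i' < 3" "j' < 3" using AV[OF y(1)] by blast
    then have "(0 = i') \<noteq> (j = j')" using y(1) A by simp
    moreover have "i' \<noteq> 0" using y(2) y' eq by (auto simp: less_numeral_cases)
    ultimately show ?thesis using y' by (auto simp: less_numeral_cases)
  qed
  have "strong_clique ?X {?e 0 0, ?e 0 1, ?e 0 2}"
  proof (rule strong_cliqueI3[OF _ _ _ nb nb nb])
    show "sym (parcs ?X)" "irrefl (parcs ?X)"
      by (auto simp: line_graph_def irrefl_def intro!: symI)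
    have "?e 0 j \<in> pverts ?X" if "j < 3" for j
      unfolding V using that zero_less_numeral by blast
    then have "{?e 0 0, ?e 0 1, ?e 0 2} \<subseteq> pverts ?X" by simp
    then show "clique ?X {?e 0 0, ?e 0 1, ?e 0 2}"
      unfolding clique_def using A by simp
    show "(?e 1 0, ?e 1 1) \<in> parcs ?X" "(?e 1 1, ?e 1 2) \<in> parcs ?X" "(?e 1 0, ?e 1 2) \<in> parcs ?X"
      "(?e 2 0, ?e 2 1) \<in> parcs ?X" "(?e 2 1, ?e 2 2) \<in> parcs ?X" "(?e 2 0, ?e 2 2) \<in> parcs ?X"
      unfolding A by simp_all
  qed
  then show ?thesis by blast
qed

text \<open>The layer with index 0 is strong by \<open>strong_cliqueI3\<close>; the two triangles
  outside it are the layers 1 and \<open>n - 1\<close>.\<close>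

lemma strong_clique_prism:
  assumes n: "n \<ge> 3"
  shows "\<exists>D. strong_clique (cartesian_product (cycle_graph 3) (cycle_graph n)) D"
proof -
  let ?X = "cartesian_product (cycle_graph 3) (cycle_graph n)"
  note A = prism_arcs[OF n] and V = prism_verts[of n]
  have m: "Suc 0 mod n = 1" "n - 1 \<noteq> 0" using n by auto
  have nb: "y = (r, 1) \<or> y = (r, n - 1)" if y: "((r, 0), y) \<in> parcs ?X" "y \<notin> {(0, 0), (1, 0), (2, 0)}" for y r
  proof -
    obtain s j where sj: "y = (s, j)" by (cases y)
    have *: "s < 3" "j < n" "(0 = j \<and> r \<noteq> s) \<or> (r = s \<and> (j = Suc 0 mod n \<or> 0 = Suc j mod n))"
      using y(1) unfolding sj A by auto
    then have "j \<noteq> 0" using y(2) sj by (auto simp: less_numeral_cases)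
    then show ?thesis using * m sj by (auto simp: mod_Suc split: if_splits)
  qed
  have "strong_clique ?X {(0, 0), (1, 0), (2, 0)}"
  proof (rule strong_cliqueI3[OF _ _ _ nb nb nb])
    show "sym (parcs ?X)"
    proof (rule symI)
      fix x y assume "(x, y) \<in> parcs ?X"
      then show "(y, x) \<in> parcs ?X" by (cases x; cases y) (auto simp: A)
    qed
    show "irrefl (parcs ?X)"
      using n by (auto simp: irrefl_def A mod_Suc split: if_splits)
    show "clique ?X {(0, 0), (1, 0), (2, 0)}"
      using n by (auto simp: clique_def V A)
  qed (use n in \<open>auto simp: A\<close>)
  then show ?thesis by blast
qed

text \<open>The outside neighbours of \<open>x_1\<close> and \<open>y_1\<close> are
  \<open>z_n\<close> and \<open>w_n\<close>, which lie in one block and hence are adjacent.\<close>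

lemma strong_clique_H_graph:
  assumes n: "n \<ge> 2"
  shows "\<exists>D. strong_clique (H_graph n) D"
proof -
  let ?X = "H_graph n"
  have UNIV: "(UNIV :: H_letter set) = {Hx, Hy, Hz, Hw}"
    using H_letter.exhaust by auto
  let ?D = "UNIV \<times> {1} :: (H_letter \<times> nat) set"
  interpret pair_graph ?X by (rule pair_graph_H_graph[OF n])
  have x: "v = (Hz, n)" if "((Hx, 1), v) \<in> parcs ?X" "v \<notin> ?D" for v
    using that by (auto simp: H_graph_def H_links_def H_succ_def split: if_splits)
  have y: "v = (Hw, n)" if "((Hy, 1), v) \<in> parcs ?X" "v \<notin> ?D" for v
    using that by (auto simp: H_graph_def H_links_def H_succ_def split: if_splits)
  have "strong_clique ?X ?D"
  proof (rule strong_cliqueI2[of _ _ "(Hx, 1)" "(Hy, 1)"])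
    show "sym (parcs ?X)" using arcs_symmetric by (auto intro: symI)
    show "irrefl (parcs ?X)" using no_loops' by (auto simp: irrefl_def)
    show "clique ?X ?D"
      using n by (auto simp: clique_def H_graph_def H_verts_def UNIV[symmetric])
    show "(u, v) \<in> parcs ?X" if "((Hx, 1), u) \<in> parcs ?X" "((Hy, 1), v) \<in> parcs ?X" "u \<notin> ?D" "v \<notin> ?D" for u v
      using x[OF that(1,3)] y[OF that(2,4)] n by (auto simp: H_graph_def)
  qed auto
  then show ?thesis by blast
qed

text \<open>The subgroup \<open>?T\<close> generated by \<open>k\<close> is strong: neighbours
  outside it lie in its translates by 1 and by -1, which are the two triangles of
  \<open>strong_cliqueI3\<close>.\<close>

lemma strong_clique_cayley_Z3k:
  assumes k: "k \<ge> 1"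
  shows "\<exists>D. strong_clique (cayley_Z3k k) D"
proof -
  let ?X = "cayley_Z3k k"
  note A = cayley_Z3k_arcs[OF k] and V = cayley_Z3k_verts[OF k]
  let ?m = "\<lambda>a. a mod (3 * int k)"
  let ?T = "{?m 0, ?m (int k), ?m (2 * int k)}"
  have arcs: "(?m s, ?m (s + int k)) \<in> parcs ?X" "(?m (s + int k), ?m (s + 2 * int k)) \<in> parcs ?X"
    "(?m s, ?m (s + 2 * int k)) \<in> parcs ?X" for s
    using cayley_Z3k_arc_mod[OF k, of "s + int k" s "int k"]
      cayley_Z3k_arc_mod[OF k, of "s + 2 * int k" "s + int k" "int k"]
      cayley_Z3k_arc_mod[OF k, of "s + 2 * int k" s "- int k"] by auto
  have sym: "sym (parcs ?X)"
  proof (rule symI)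
    fix x y assume xy: "(x, y) \<in> parcs ?X"
    then obtain a where a: "a \<in> {1, - 1, int k, - int k}" "y = ?m (x + a)" and xV: "x \<in> {0..<3 * int k}"
      unfolding A by blast
    have "x = ?m (y + (- a))" using xV a(2) by (simp add: mod_diff_left_eq)
    then show "(y, x) \<in> parcs ?X" using xy a(1) unfolding A by auto
  qed
  have irrefl: "irrefl (parcs ?X)"
  proof -
    have "x \<noteq> ?m (x + a)" if "a \<in> {1, - 1, int k, - int k}" "x \<in> {0..<3 * int k}" for x a
    proof
      assume "x = ?m (x + a)"
      then have "?m x = ?m (x + a)" using that(2) by simp
      then have "3 * int k dvd a" by (simp add: mod_eq_dvd_iff)
      then have "3 * int k \<le> \<bar>a\<bar>" using that(1) k dvd_imp_le_int[of a "3 * int k"] by auto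
      then show False using that(1) k by auto
    qed
    then show ?thesis unfolding irrefl_def A by blast
  qed
  have nb: "y = ?m (j * int k + 1) \<or> y = ?m (j * int k - 1)"
    if y: "(?m (j * int k), y) \<in> parcs ?X" "y \<notin> ?T" and j: "j \<in> {0, 1, 2}" for y j
  proof -
    obtain a where a: "a \<in> {1, - 1, int k, - int k}" "y = ?m (?m (j * int k) + a)"
      using y(1) unfolding A by blast
    then have "y = ?m (j * int k + a)" by (simp only: mod_add_left_eq)
    note a = a(1) this
    \<comment> \<open>Going down from 0 or up from 2k by \<open>k\<close> leaves the range of
      representatives but stays in \<open>?T\<close>.\<close>
    have wrap: "?m (- int k) = ?m (2 * int k)" "?m (3 * int k) = ?m 0"
      using mod_add_self2[of "- int k" "3 * int k"] by (auto simp del: mod_add_self2)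
    have "a \<noteq> int k" "a \<noteq> - int k"
      using y(2) j a(2) wrap by (auto simp: algebra_simps)
    then show ?thesis using a by auto
  qed
  have "strong_clique ?X ?T"
  proof (rule strong_cliqueI3[OF sym irrefl])
    show "clique ?X ?T"
    proof -
      have "?T \<subseteq> pverts ?X" unfolding V using k by auto
      then show ?thesis
        using arcs[of 0] symD[OF sym] unfolding clique_def by auto
    qed
    show "y = ?m 1 \<or> y = ?m (- 1)" if "(?m 0, y) \<in> parcs ?X" "y \<notin> ?T" for y
      using nb[of 0 y] that by simp
    show "y = ?m (1 + int k) \<or> y = ?m (- 1 + int k)" if "(?m (int k), y) \<in> parcs ?X" "y \<notin> ?T" for y
      using nb[of 1 y] that by (simp add: add.commute)
    show "y = ?m (1 + 2 * int k) \<or> y = ?m (- 1 + 2 * int k)"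
      if "(?m (2 * int k), y) \<in> parcs ?X" "y \<notin> ?T" for y
      using nb[of 2 y] that by (simp add: add.commute)
  qed (rule arcs)+
  then show ?thesis by blast
qed

section \<open>Cliques of size two and five, and intersecting triangles\<close>

context strong_vt_graph
begin

lemma nbs_eqI:
  assumes "E v a" "E v b" "E v c" "E v d" "distinct [a, b, c, d]"
  shows "nbs v = {a, b, c, d}"
proof -
  have "card {a, b, c, d} = card (nbs v)" using assms card_nbs[OF E_V(1)[OF assms(1)]] by simp
  moreover have "{a, b, c, d} \<subseteq> nbs v" using assms by (simp add: nbs_def)
  ultimately show ?thesis by (metis card_subset_eq finite_nbs)
qed

lemma clique2: "E u v \<Longrightarrow> clique G {u, v} \<and> card {u, v} = 2"
  using E_V E_sym by (auto simp: clique_def card_insert_if)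

lemma clique3: "E u v \<Longrightarrow> E u x \<Longrightarrow> E v x \<Longrightarrow> clique G {u, v, x} \<and> card {u, v, x} = 3"
  using E_V E_sym E_irrefl by (auto simp: clique_def card_insert_if)

lemma no_K4:
  assumes w: "card C = 3" and "E u v" "E u x" "E v x" "E u y" "E v y" "x \<noteq> y"
  shows "\<not> E x y"
proof
  assume "E x y"
  then have "clique G {u, v, x, y}" using assms E_V E_sym by (auto simp: clique_def)
  moreover have "card {u, v, x, y} = 4" using assms E_irrefl by (auto simp: card_insert_if)
  ultimately show False using card_clique_le(1) w by fastforce
qed

lemma ex_edge: "\<exists>u v. E u v"
proof -
  obtain u where "u \<in> C" using C_nonempty by blast
  then have "card (nbs u) = 4" using C_clique card_nbs by (auto simp: clique_def)
  then have "nbs u \<noteq> {}" by auto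
  then show ?thesis by (auto simp: nbs_def)
qed

lemma embeds_complete_graph:
  assumes w: "card C = 5"
  shows "\<exists>f. embeds (complete_graph 5) f"
proof -
  obtain f where f: "bij_betw f {0..<5::nat} C"
    using ex_bij_betw_nat_finite[of C] finite_clique[OF C_clique] w by auto
  have "embeds (complete_graph 5) f"
    unfolding embeds_def
  proof (intro conjI allI impI)
    show "inj_on f (pverts (complete_graph 5))"
      using f by (simp add: complete_graph_def bij_betw_def atLeast0LessThan)
    show "f ` pverts (complete_graph 5) \<subseteq> V"
      using f C_clique by (simp add: complete_graph_def bij_betw_def atLeast0LessThan clique_def)
    fix x y assume "(x, y) \<in> parcs (complete_graph 5)"
    then have xy: "x \<in> {0..<5}" "y \<in> {0..<5}" "x \<noteq> y" by (auto simp: complete_graph_def)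
    have "f x \<in> C" "f y \<in> C" using bij_betwE[OF f] xy by auto
    moreover have "f x \<noteq> f y" using f xy unfolding bij_betw_def by (metis inj_onD)
    ultimately show "E (f x) (f y)" using cliqueD[OF C_clique] by blast
  qed
  then show ?thesis by blast
qed

text \<open>There are no triangles, so the neighbourhoods of adjacent \<open>u\<close> and
  \<open>v\<close> are disjoint. A neighbour \<open>a\<close> of \<open>u\<close> and a neighbour
  \<open>b\<close> of \<open>v\<close> dominate the strong clique {u, v}, so they are adjacent; the
  two neighbourhoods span K_{4,4}.\<close>

lemma embeds_complete_bipartite_graph:
  assumes w: "card C = 2"
  shows "\<exists>f. embeds (complete_bipartite_graph 4 4) f"
proof -
  obtain u v where uv: "E u v" using ex_edge by blast
  have no_tri: False if "E u x" "E v x" for x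
    using clique3[OF uv that] card_clique_le(1) w by fastforce
  have adj: "E a b" if "E u a" "E v b" for a b
  proof (rule ccontr)
    assume ab: "\<not> E a b"
    have "independent_set G {a, b}"
      using ab that E_V E_sym by (auto simp: independent_set_def)
    then have "\<exists>q\<in>{u, v}. \<forall>i\<in>{a, b}. \<not> E q i"
      using clique2[OF uv] w by (intro no_dominating) auto
    then show False using that by auto
  qed
  obtain g where g: "bij_betw g {..<4::nat} (nbs u)"
    using ex_bij_betw_nat_finite[OF finite_nbs, of u] card_nbs[OF E_V(1)[OF uv]]
    by (auto simp: atLeast0LessThan)
  obtain h where h: "bij_betw h {..<4::nat} (nbs v)"
    using ex_bij_betw_nat_finite[OF finite_nbs, of v] card_nbs[OF E_V(2)[OF uv]]
    by (auto simp: atLeast0LessThan)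
  have gh: "E u (g i)" "E v (h i)" if "i < 4" for i
    using bij_betwE[OF g] bij_betwE[OF h] that by (auto simp: nbs_def)
  have inj: "inj_on g {..<4}" "inj_on h {..<4}" using g h by (auto simp: bij_betw_def)
  have "embeds (complete_bipartite_graph 4 4) (case_sum g h)"
    unfolding embeds_def
  proof (intro conjI allI impI)
    have "g i \<noteq> h j" if "i < 4" "j < 4" for i j
      using gh(1)[OF that(1)] gh(2)[OF that(2)] no_tri by metis
    then show "inj_on (case_sum g h) (pverts (complete_bipartite_graph 4 4))"
      using inj by (auto simp: complete_bipartite_graph_def inj_on_def) metis+
    show "case_sum g h ` pverts (complete_bipartite_graph 4 4) \<subseteq> V"
      using E_V(2)[OF gh(1)] E_V(2)[OF gh(2)] by (auto simp: complete_bipartite_graph_def)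
    show "E (case_sum g h x) (case_sum g h y)" if "(x, y) \<in> parcs (complete_bipartite_graph 4 4)" for x y
      using that adj[OF gh] E_sym[OF adj[OF gh]] by (auto simp: complete_bipartite_graph_def)
  qed
  then show ?thesis by blast
qed

text \<open>A neighbour \<open>x\<close> of \<open>p\<close> that is not adjacent to
  \<open>r\<close> would make {r, x} an independent set dominating the triangle
  \<open>v q p\<close>: \<open>r\<close> is adjacent to \<open>v\<close> and \<open>q\<close>, and
  \<open>x\<close> to \<open>p\<close>. Equal valencies turn the inclusion of neighbourhoods into
  equality.\<close>

lemma twin_apexes:
  assumes w: "card C = 3" and e: "E v q" "E v p" "E q p" "E v r" "E q r" "p \<noteq> r"
  shows "nbs p = nbs r"
proof -
  have pr: "\<not> E p r" using no_K4[OF w e(1,2,3,4,5,6)] .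
  have "E r x" if x: "E p x" for x
  proof (rule ccontr)
    assume rx: "\<not> E r x"
    have "independent_set G {r, x}"
      using rx x e E_V E_sym by (auto simp: independent_set_def)
    then have "\<exists>y\<in>{v, q, p}. \<forall>i\<in>{r, x}. \<not> E y i"
      using clique3[OF e(1-3)] w by (intro no_dominating) auto
    then show False using x e by auto
  qed
  then have "nbs p \<subseteq> nbs r" by (auto simp: nbs_def)
  moreover have "card (nbs p) = card (nbs r)" using e E_V card_nbs by metis
  ultimately show ?thesis by (metis card_subset_eq finite_nbs)
qed

text \<open>By transitivity \<open>v\<close> and \<open>q\<close> have twins as well. The three
  pairs of twins are completely joined to each other because \<open>v q p\<close> is a
  triangle.\<close>

lemma embeds_lexicographic_product:
  assumes w: "card C = 3" and e: "E v q" "E v p" "E q p" "E v r" "E q r" "p \<noteq> r"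
  shows "\<exists>f. embeds (lexicographic_product (complete_graph 3) (edgeless_graph 2)) f"
proof -
  have pr: "nbs p = nbs r" by (rule twin_apexes[OF assms])
  have twin: "\<exists>y. y \<noteq> x \<and> (\<forall>z. E y z \<longleftrightarrow> E x z)" if x: "x \<in> V" for x
  proof -
    obtain f where f: "f \<in> auts" "f p = x" using ex_aut[OF E_V(2)[OF e(2)] x] by blast
    have "E (f r) z \<longleftrightarrow> E x z" for z
    proof -
      obtain z' where "z = f z'" using autD(4)[OF f(1)] by (metis surjD)
      moreover have "E p z' \<longleftrightarrow> E r z'" using pr by (auto simp: nbs_def)
      ultimately show ?thesis using autD(1)[OF f(1)] f(2) by metis
    qed
    moreover have "f r \<noteq> x" using autD(2)[OF f(1)] f(2) e(6) by metis
    ultimately show ?thesis by blast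
  qed
  obtain v' where v': "v' \<noteq> v" "\<And>z. E v' z \<longleftrightarrow> E v z" using twin[OF E_V(1)[OF e(1)]] by blast
  obtain q' where q': "q' \<noteq> q" "\<And>z. E q' z \<longleftrightarrow> E q z" using twin[OF E_V(2)[OF e(1)]] by blast
  define P where "P = [[v, v'], [q, q'], [p, r]]"
  have arcs: "E x y" if "x \<in> set (P ! i)" "y \<in> set (P ! j)" "i < 3" "j < 3" "i \<noteq> j" for x y i j
  proof -
    have "E x y" if "x \<in> {v, v'}" "y \<in> {q, q', p, r}" for x y
      using that v'(2) q'(2) e E_sym by blast
    moreover have "E x y" if "x \<in> {q, q'}" "y \<in> {p, r}" for x y
      using that q'(2) e by blast
    ultimately show ?thesis
      using that E_sym by (auto simp: less_numeral_cases P_def)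
  qed
  have len: "P ! i ! j \<in> set (P ! i)" if "i < 3" "j < 2" for i j
    using that by (auto simp: less_numeral_cases P_def)
  have dis: "P ! i ! j \<noteq> P ! i ! k" if "i < 3" "j < 2" "k < 2" "j \<noteq> k" for i j k
    using that v' q' e(6) by (auto simp: less_numeral_cases P_def)
  have "embeds (lexicographic_product (complete_graph 3) (edgeless_graph 2)) (\<lambda>(i, j). P ! i ! j)"
    unfolding embeds_def
  proof (intro conjI allI impI)
    show "inj_on (\<lambda>(i, j). P ! i ! j) (pverts (lexicographic_product (complete_graph 3) (edgeless_graph 2)))"
    proof (rule inj_onI)
      fix x y assume xy: "x \<in> pverts (lexicographic_product (complete_graph 3) (edgeless_graph 2))"
        "y \<in> pverts (lexicographic_product (complete_graph 3) (edgeless_graph 2))"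
        "(case x of (i, j) \<Rightarrow> P ! i ! j) = (case y of (i, j) \<Rightarrow> P ! i ! j)"
      obtain i j k l where ij: "x = (i, j)" "y = (k, l)" by (cases x; cases y)
      have b: "i < 3" "j < 2" "k < 3" "l < 2" and eq: "P ! i ! j = P ! k ! l"
        using xy ij by (auto simp: lexicographic_product_def complete_graph_def edgeless_graph_def)
      \<comment> \<open>Vertices in different pairs are adjacent, hence distinct.\<close>
      have "i = k" using arcs[OF len len, of i j k l] b eq by auto
      then show "x = y" using dis[of i j l] b eq ij by auto
    qed
    show "(\<lambda>(i, j). P ! i ! j) ` pverts (lexicographic_product (complete_graph 3) (edgeless_graph 2)) \<subseteq> V"
    proof clarify
      fix i j assume "(i, j) \<in> pverts (lexicographic_product (complete_graph 3) (edgeless_graph 2))"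
      then have ij: "i < 3" "j < 2"
        by (auto simp: lexicographic_product_def complete_graph_def edgeless_graph_def)
      obtain k :: nat where "k < 3" "k \<noteq> i" by (metis zero_less_numeral one_less_numeral_iff semiring_norm(77) zero_neq_one)
      then have "E (P ! i ! j) (P ! k ! 0)" using ij arcs[OF len[of i j] len[of k 0]] by simp
      then show "P ! i ! j \<in> V" by (rule E_V)
    qed
    fix x y assume "(x, y) \<in> parcs (lexicographic_product (complete_graph 3) (edgeless_graph 2))"
    then obtain i j k l where "x = (i, j)" "y = (k, l)" "i < 3" "j < 2" "k < 3" "l < 2" "i \<noteq> k"
      by (auto simp: lexicographic_product_def complete_graph_def edgeless_graph_def)
    then show "E (case x of (i, j) \<Rightarrow> P ! i ! j) (case y of (i, j) \<Rightarrow> P ! i ! j)"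
      using arcs[OF len len] by simp
  qed
  then show ?thesis by blast
qed

text \<open>Each vertex of a triangle \<open>a b c\<close> lies in a second triangle, and by
  \<open>no_dominating\<close> every choice of one vertex from each of the three sets {a1, a2}, {b1,
  b2}, {c1, c2} contains an edge. Since triangles share no edges, this forces perfect matchings
  between these sets, and the nine vertices form a 3 by 3 grid whose rows and columns are
  triangles.\<close>

lemma embeds_prism3:
  assumes w: "card C = 3"
    and diamond_free: "\<And>u v x y. E u v \<Longrightarrow> E u x \<Longrightarrow> E v x \<Longrightarrow> E u y \<Longrightarrow> E v y \<Longrightarrow> x = y"
    and two: "\<And>v. v \<in> V \<Longrightarrow> \<exists>b c d e. distinct [b, c, d, e] \<and> E v b \<and> E v c \<and> E v d \<and> E v e \<and> E b c \<and> E d e"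
  shows "\<exists>f. embeds (cartesian_product (cycle_graph 3) (cycle_graph 3)) f"
proof -
  have other: "\<exists>x y. E a x \<and> E a y \<and> E x y \<and> x \<notin> {b, c} \<and> y \<notin> {b, c}" if abc: "E a b" "E a c" "E b c" for a b c
  proof -
    obtain p q r s where p: "distinct [p, q, r, s]" "E a p" "E a q" "E a r" "E a s" "E p q" "E r s"
      using two[OF E_V(1)[OF abc(1)]] by blast
    have *: "b = y" if "x = c" "E a x" "E a y" "E x y" for x y
      using diamond_free[of a c b y] that \<open>E a b\<close> \<open>E a c\<close> \<open>E b c\<close> E_sym by blast
    have **: "c = y" if "x = b" "E a x" "E a y" "E x y" for x y
      using diamond_free[of a b c y] that \<open>E a b\<close> \<open>E a c\<close> \<open>E b c\<close> E_sym by blast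
    show ?thesis
    proof (cases "p \<in> {b, c} \<or> q \<in> {b, c}")
      case True
      then have "{p, q} = {b, c}" using p * ** E_sym by blast
      then have "r \<notin> {b, c}" "s \<notin> {b, c}" using p(1) by auto
      then show ?thesis using p by blast
    next
      case False
      then show ?thesis using p by blast
    qed
  qed
  obtain Q where Q: "clique G Q" "card Q = 3" using C_clique w by blast
  then obtain a b c where abc: "Q = {a, b, c}" "a \<noteq> b" "a \<noteq> c" "b \<noteq> c" by (auto simp: card_3_iff)
  then have e: "E a b" "E a c" "E b c" using cliqueD[OF Q(1)] by auto
  obtain a1 a2 where a: "E a a1" "E a a2" "E a1 a2" "a1 \<notin> {b, c}" "a2 \<notin> {b, c}" using other[OF e] by blast
  obtain b1 b2 where b: "E b b1" "E b b2" "E b1 b2" "b1 \<notin> {a, c}" "b2 \<notin> {a, c}"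
    using other[of b a c] e E_sym by blast
  obtain c1 c2 where c: "E c c1" "E c c2" "E c1 c2" "c1 \<notin> {a, b}" "c2 \<notin> {a, b}"
    using other[of c a b] e E_sym by blast
  have nAB: "\<not> (E a x \<and> E b x)" if "x \<noteq> c" for x using diamond_free[of a b x c] e that E_sym by blast
  have nAC: "\<not> (E a x \<and> E c x)" if "x \<noteq> b" for x using diamond_free[of a c x b] e that E_sym by blast
  have nBC: "\<not> (E b x \<and> E c x)" if "x \<noteq> a" for x using diamond_free[of b c x a] e that E_sym by blast
  have transversal: "E x y \<or> E y z \<or> E x z" if "x \<in> {a1, a2}" "y \<in> {b1, b2}" "z \<in> {c1, c2}" for x y z
  proof (rule ccontr)
    assume no: "\<not> ?thesis"
    have "E a x" "E b y" "E c z" using that a b c by auto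
    then have "independent_set G {x, y, z}"
      using no E_V E_sym by (auto simp: independent_set_def)
    then have "\<exists>q\<in>Q. \<forall>i\<in>{x, y, z}. \<not> E q i"
      using Q w by (intro no_dominating) auto
    then show False using \<open>E a x\<close> \<open>E b y\<close> \<open>E c z\<close> abc(1) by auto
  qed
  \<comment> \<open>A vertex adjacent to both ends of an edge that lies in a triangle with apex
    \<open>p\<close> must be \<open>p\<close>.\<close>
  have unique: "y = y'" if "E x y" "E x y'" "E p y" "E p y'" "E y y' \<or> y = y'" "x \<noteq> p" for x y y' p
    using diamond_free[of y y' x p] that E_sym by blast
  have uB: "y = y'" if "E x y" "E x y'" "y \<in> {b1, b2}" "y' \<in> {b1, b2}" "x \<noteq> b" for x y y'
    using unique[of x y y' b] that b E_sym by blast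
  have uC: "y = y'" if "E x y" "E x y'" "y \<in> {c1, c2}" "y' \<in> {c1, c2}" "x \<noteq> c" for x y y'
    using unique[of x y y' c] that c E_sym by blast
  have uA: "y = y'" if "E x y" "E x y'" "y \<in> {a1, a2}" "y' \<in> {a1, a2}" "x \<noteq> a" for x y y'
    using unique[of x y y' a] that a E_sym by blast
  have ne: "a1 \<noteq> a2" "b1 \<noteq> b2" "c1 \<noteq> c2" using a b c by auto
  have hitB: "\<exists>y\<in>{b1, b2}. E x y" if x: "x \<in> {a1, a2}" for x
  proof (rule ccontr)
    assume no: "\<not> ?thesis"
    \<comment> \<open>Choosing first \<open>z\<close> not adjacent to \<open>x\<close>, then
      \<open>y\<close> not adjacent to \<open>z\<close>, gives a transversal without edges.\<close>
    have "x \<noteq> c" using x a by auto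
    then obtain z where z: "z \<in> {c1, c2}" "\<not> E x z" using uC[of x c1 c2] ne by blast
    then have "z \<noteq> b" using c by auto
    then obtain y where y: "y \<in> {b1, b2}" "\<not> E z y" using uB[of z b1 b2] ne by blast
    then show False using transversal[OF x y(1) z(1)] no z E_sym by blast
  qed
  have hitC: "\<exists>z\<in>{c1, c2}. E x z" if x: "x \<in> {a1, a2}" for x
  proof (rule ccontr)
    assume no: "\<not> ?thesis"
    have "x \<noteq> b" using x a by auto
    then obtain y where y: "y \<in> {b1, b2}" "\<not> E x y" using uB[of x b1 b2] ne by blast
    then have "y \<noteq> c" using b by auto
    then obtain z where z: "z \<in> {c1, c2}" "\<not> E y z" using uC[of y c1 c2] ne by blast
    then show False using transversal[OF x y(1) z(1)] no y by blast
  qed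
  obtain y1 where y1: "y1 \<in> {b1, b2}" "E a1 y1" using hitB[of a1] by blast
  obtain y2 where y2: "y2 \<in> {b1, b2}" "E a2 y2" using hitB[of a2] by blast
  obtain z1 where z1: "z1 \<in> {c1, c2}" "E a1 z1" using hitC[of a1] by blast
  obtain z2 where z2: "z2 \<in> {c1, c2}" "E a2 z2" using hitC[of a2] by blast
  have ny: "y1 \<noteq> y2"
  proof
    assume "y1 = y2"
    moreover have "y1 \<noteq> a" using y1 b by auto
    ultimately show False using uA[of y1 a1 a2] y1 y2 ne E_sym by blast
  qed
  have nz: "z1 \<noteq> z2"
  proof
    assume "z1 = z2"
    moreover have "z1 \<noteq> a" using z1 c by auto
    ultimately show False using uA[of z1 a1 a2] z1 z2 ne E_sym by blast
  qed
  have disj: "y \<noteq> z" "x \<noteq> y" "x \<noteq> z" if "x \<in> {a1, a2}" "y \<in> {b1, b2}" "z \<in> {c1, c2}" for x y z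
    using nBC[of y] nAB[of x] nAC[of x] that a b c by auto
  have outA: "\<not> E a y" if "y \<in> {b1, b2, c1, c2}" for y
    using nAB[of y] nAC[of y] that b c by auto
  have tri: "E y z" if x: "x \<in> {a1, a2}" "x' \<in> {a1, a2}" "x \<noteq> x'" and yz: "y \<in> {b1, b2}" "z \<in> {c1, c2}" "E x y" "E x z"
    for x x' y z
  proof -
    have xx: "E x a" "E x x'" "E a x'" using x a E_sym by auto
    have "y \<noteq> a" "z \<noteq> a" using yz b c by auto
    moreover have "y \<noteq> x'" "z \<noteq> x'" "y \<noteq> z" using disj[OF x(2) yz(1,2)] by simp_all
    ultimately have nb: "nbs x = {a, x', y, z}"
      using xx yz by (intro nbs_eqI) auto
    \<comment> \<open>The second triangle at \<open>x\<close> avoids \<open>a\<close> and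
      \<open>x'\<close>, so it uses the two remaining neighbours \<open>y\<close> and
      \<open>z\<close>.\<close>
    obtain s t where st: "E x s" "E x t" "E s t" "s \<notin> {a, x'}" "t \<notin> {a, x'}"
      using other[OF xx] by blast
    then have "s \<in> {y, z}" "t \<in> {y, z}" using nb unfolding nbs_def by blast+
    then show ?thesis using st(3) E_irrefl E_sym by auto
  qed
  have t1: "E y1 z1" using tri[of a1 a2] y1 z1 ne by blast
  have t2: "E y2 z2" using tri[of a2 a1] y2 z2 ne by blast
  have yy: "E y1 y2" "E b y1" "E b y2" using y1 y2 ny b E_sym by auto
  have zz: "E z1 z2" "E c z1" "E c z2" using z1 z2 nz c E_sym by auto
  \<comment> \<open>The rows are the second triangles at \<open>a\<close>, \<open>b\<close>,
    \<open>c\<close>; the columns are the triangle \<open>a b c\<close> and the two triangles found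
    by \<open>tri\<close>.\<close>
  define P where "P = [[a, a1, a2], [b, y1, y2], [c, z1, z2]]"
  have row': "E (P ! r ! i) (P ! r ! j)" if "r < 3" "j < 3" "i < j" for r i j
  proof -
    have "i = 0 \<and> j = 1 \<or> i = 0 \<and> j = 2 \<or> i = 1 \<and> j = 2" using that by linarith
    moreover have "r = 0 \<or> r = 1 \<or> r = 2" using that by linarith
    ultimately show ?thesis using a yy zz by (elim disjE) (simp_all add: P_def)
  qed
  have row: "E (P ! r ! i) (P ! r ! j)" if "r < 3" "i < 3" "j < 3" "i \<noteq> j" for r i j
    using row'[of r j i] E_sym[OF row'[of r i j]] that by linarith
  have col': "E (P ! r ! i) (P ! s ! i)" if "s < 3" "i < 3" "r < s" for r s i
  proof -
    have "r = 0 \<and> s = 1 \<or> r = 0 \<and> s = 2 \<or> r = 1 \<and> s = 2" using that by linarith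
    moreover have "i = 0 \<or> i = 1 \<or> i = 2" using that by linarith
    ultimately show ?thesis
      using e y1(2) z1(2) y2(2) z2(2) t1 t2 by (elim disjE) (simp_all add: P_def)
  qed
  have col: "E (P ! r ! i) (P ! s ! i)" if "r < 3" "s < 3" "i < 3" "r \<noteq> s" for r s i
    using col'[of s i r] E_sym[OF col'[of r i s]] that by linarith
  have dis: "distinct [a, a1, a2, b, y1, y2, c, z1, z2]"
  proof -
    have "a1 \<noteq> y2" "a1 \<noteq> z2" "a2 \<noteq> y1" "a2 \<noteq> z1" "y1 \<noteq> z2" "y2 \<noteq> z1"
      using disj[of a1 y2 z2] disj[of a2 y1 z1] disj[of a1 y1 z2] disj[of a1 y2 z1] y1(1) y2(1) z1(1) z2(1)
      by simp_all
    moreover have "y1 \<noteq> a" "y2 \<noteq> a" "z1 \<noteq> a" "z2 \<noteq> a" "y1 \<noteq> c" "y2 \<noteq> c" "z1 \<noteq> b" "z2 \<noteq> b"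
      using y1 y2 z1 z2 b c by auto
    ultimately show ?thesis
      using a(1-5) e y1(2) y2(2) z1(2) z2(2) yy zz t1 t2 E_irrefl by (auto dest: E_irrefl[THEN notE])
  qed
  have inj: "r = s \<and> i = j" if "P ! r ! i = P ! s ! j" "r < 3" "s < 3" "i < 3" "j < 3" for r s i j
  proof -
    \<comment> \<open>Flattening the table reduces injectivity to distinctness of one list of nine
      vertices.\<close>
    have "concat P ! (3 * r + i) = P ! r ! i" if "r < 3" "i < 3" for r i
      using that by (auto simp: less_numeral_cases P_def)
    then have "concat P ! (3 * r + i) = concat P ! (3 * s + j)" using that by simp
    moreover have "distinct (concat P)" "length (concat P) = 9" using dis by (simp_all add: P_def)
    ultimately have "3 * r + i = 3 * s + j" using that by (subst (asm) nth_eq_iff_index_eq) auto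
    then show ?thesis using that by presburger
  qed
  have "embeds (cartesian_product (cycle_graph 3) (cycle_graph 3)) (\<lambda>(r, i). P ! r ! i)"
    unfolding embeds_def
  proof (intro conjI allI impI)
    show "inj_on (\<lambda>(r, i). P ! r ! i) (pverts (cartesian_product (cycle_graph 3) (cycle_graph 3)))"
      unfolding prism_verts by (rule inj_onI) (auto dest: inj)
    show "(\<lambda>(r, i). P ! r ! i) ` pverts (cartesian_product (cycle_graph 3) (cycle_graph 3)) \<subseteq> V"
    proof clarify
      fix r i assume "(r, i) \<in> pverts (cartesian_product (cycle_graph 3) (cycle_graph 3))"
      then have "r < 3" "i < 3" by (auto simp: prism_verts)
      moreover from this have "E (P ! r ! i) (P ! r ! (if i = 0 then 1 else 0))" by (intro row) auto
      ultimately show "P ! r ! i \<in> V" using E_V(1) by blast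
    qed
    fix x y assume xy: "(x, y) \<in> parcs (cartesian_product (cycle_graph 3) (cycle_graph 3))"
    obtain r i s j where rs: "x = (r, i)" "y = (s, j)" by (cases x; cases y)
    have *: "r < 3" "s < 3" "i < 3" "j < 3" "(i = j \<and> r \<noteq> s) \<or> (r = s \<and> (j = Suc i mod 3 \<or> i = Suc j mod 3))"
      using xy unfolding rs by (simp_all add: prism_arcs)
    moreover have "Suc k mod 3 \<noteq> k" for k by (cases "k < 3") (auto simp: less_numeral_cases)
    ultimately have "(i = j \<and> r \<noteq> s) \<or> (r = s \<and> i \<noteq> j)" by metis
    then show "E (case x of (r, i) \<Rightarrow> P ! r ! i) (case y of (r, i) \<Rightarrow> P ! r ! i)"
      using row col * rs by auto
  qed
  then show ?thesis by blast
qed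

end

section \<open>Partition into cliques\<close>

text \<open>Maximum cliques that meet coincide, so they are the blocks of a partition of
  \<open>V\<close>; \<open>B v\<close> is the block of \<open>v\<close>.\<close>

locale unique_clique_graph = strong_vt_graph +
  assumes unique: "clique G Q \<Longrightarrow> card Q = card C \<Longrightarrow> v \<in> Q \<Longrightarrow>
    clique G Q' \<Longrightarrow> card Q' = card C \<Longrightarrow> v \<in> Q' \<Longrightarrow> Q = Q'"
begin

definition B :: "'a \<Rightarrow> 'a set" where
  "B v = (THE Q. clique G Q \<and> card Q = card C \<and> v \<in> Q)"

definition outer :: "'a \<Rightarrow> 'a \<Rightarrow> bool" where
  "outer u v \<longleftrightarrow> E u v \<and> v \<notin> B u"

lemma B_eqI: "clique G Q \<Longrightarrow> card Q = card C \<Longrightarrow> v \<in> Q \<Longrightarrow> B v = Q"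
  unfolding B_def by (rule the_equality) (use unique in blast)+

lemma B_props:
  assumes "v \<in> V"
  shows "clique G (B v)" "card (B v) = card C" "v \<in> B v"
proof -
  obtain Q where Q: "clique G Q" "card Q = card C" "v \<in> Q" using ex_clique[OF assms] by blast
  then have "B v = Q" by (rule B_eqI)
  then show "clique G (B v)" "card (B v) = card C" "v \<in> B v" using Q by simp_all
qed

lemma B_mem: "v \<in> V \<Longrightarrow> u \<in> B v \<Longrightarrow> u \<in> V"
  using B_props(1)[of v] by (auto simp: clique_def)

lemma B_eq: "v \<in> V \<Longrightarrow> u \<in> B v \<Longrightarrow> B u = B v"
  by (rule B_eqI) (simp_all add: B_props)

lemma mem_B_iff: "u \<in> V \<Longrightarrow> v \<in> V \<Longrightarrow> u \<in> B v \<longleftrightarrow> B u = B v"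
  using B_eq[of v u] B_props(3)[of u] by auto

lemma B_adj: "v \<in> V \<Longrightarrow> x \<in> B v \<Longrightarrow> y \<in> B v \<Longrightarrow> x \<noteq> y \<Longrightarrow> E x y"
  using cliqueD[OF B_props(1)] by blast

lemma finite_B: "v \<in> V \<Longrightarrow> finite (B v)"
  using B_props(1) finite_clique by blast

lemma outer_E: "outer u v \<Longrightarrow> E u v"
  by (simp add: outer_def)

lemma outer_V: "outer u v \<Longrightarrow> u \<in> V" "outer u v \<Longrightarrow> v \<in> V"
  using E_V outer_E by blast+

lemma outer_B: "outer u v \<Longrightarrow> B u \<noteq> B v"
  using outer_V[of u v] B_props(3)[of v] by (auto simp: outer_def)

lemma outer_iff: "E u v \<Longrightarrow> outer u v \<longleftrightarrow> B u \<noteq> B v"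
  using E_V[of u v] mem_B_iff[of v u] by (auto simp: outer_def)

lemma outer_sym: "outer u v \<Longrightarrow> outer v u"
  using outer_iff[of v u] outer_B[of u v] E_sym outer_E by metis

lemma card_outer:
  assumes v: "v \<in> V"
  shows "card {u. outer v u} = 5 - card C"
proof -
  have "{u. outer v u} = nbs v - (B v - {v})"
    by (auto simp: outer_def nbs_def)
  moreover have "B v - {v} \<subseteq> nbs v"
    using clique_subset_nbs B_props v by blast
  ultimately have "card {u. outer v u} = card (nbs v) - card (B v - {v})"
    using finite_B[OF v] by (simp add: card_Diff_subset)
  then show ?thesis using card_nbs[OF v] B_props[OF v] finite_B[OF v] card_C by auto
qed

lemma finite_outer: "finite {u. outer v u}"
  by (rule finite_subset[OF _ finite_nbs[of v]]) (auto simp: outer_def nbs_def)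

lemma B_aut:
  assumes f: "f \<in> auts" and v: "v \<in> V"
  shows "B (f v) = f ` B v"
  using clique_image[OF f B_props(1)[OF v]] B_props[OF v] by (intro B_eqI) auto

lemma outer_aut:
  assumes f: "f \<in> auts"
  shows "outer (f u) (f v) \<longleftrightarrow> outer u v"
proof (cases "E u v")
  case True
  have "f v \<in> B (f u) \<longleftrightarrow> v \<in> B u"
    unfolding B_aut[OF f E_V(1)[OF True]] using autD(2)[OF f] by (auto simp: image_iff)
  then show ?thesis using autD(1)[OF f] by (simp add: outer_def)
next
  case False
  then show ?thesis using autD(1)[OF f] by (simp add: outer_def)
qed

lemma transport:
  assumes "P u" "u \<in> V" "v \<in> V" and "\<And>f w. f \<in> auts \<Longrightarrow> w \<in> V \<Longrightarrow> P w \<Longrightarrow> P (f w)"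
  shows "P v"
  using ex_aut[OF assms(2,3)] assms by blast

text \<open>Adjacency in the quotient graph whose vertices are the blocks.\<close>

definition R :: "'a set \<Rightarrow> 'a set \<Rightarrow> bool" where
  "R X Y \<longleftrightarrow> (\<exists>x y. outer x y \<and> X = B x \<and> Y = B y)"

lemma R_sym: "R X Y \<Longrightarrow> R Y X"
  unfolding R_def using outer_sym by blast

lemma R_irrefl: "\<not> R X X"
  unfolding R_def using outer_B by metis

lemma R_blocks: "R X Y \<Longrightarrow> Y \<in> B ` V"
  unfolding R_def using outer_V by blast

lemma block_cycle:
  assumes "\<And>v. v \<in> V \<Longrightarrow> card {Y. R (B v) Y} = 2"
  shows "\<exists>n\<ge>3. \<exists>T :: nat \<Rightarrow> 'a set. inj_on T {..<n} \<and> T ` {..<n} \<subseteq> B ` V \<and> (\<forall>i<n. R (T i) (T (Suc i mod n)))"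
proof (rule two_regular_cycle)
  show "finite (B ` V)" using finite_V by simp
  show "B ` V \<noteq> {}" using ex_edge E_V by blast
  show "card {Y. R X Y} = 2" if "X \<in> B ` V" for X using that assms by auto
qed (rule R_sym R_blocks R_irrefl; assumption?)+

end

section \<open>Cliques of size four are disjoint\<close>

context strong_vt_graph
begin

text \<open>Two different cliques that meet would share a triangle {v, b, c}; with the fourth
  vertices \<open>d\<close> and \<open>e\<close> this triangle has no further neighbours. The
  remaining neighbour \<open>d'\<close> of \<open>d\<close> turns out to be adjacent to
  \<open>e\<close> too. A clique of size 4 at \<open>d'\<close> can contain neither \<open>d\<close>
  nor \<open>e\<close>, and only two other neighbours of \<open>d'\<close> are left for it.\<close>

lemma unique_K4:
  assumes w: "card C = 4"
    and Q: "clique G Q" "card Q = card C" "v \<in> Q" and Q': "clique G Q'" "card Q' = card C" "v \<in> Q'"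
  shows "Q = Q'"
proof (rule ccontr)
  assume ne: "Q \<noteq> Q'"
  have fin: "finite Q" "finite Q'" using finite_clique Q Q' by blast+
  have vV: "v \<in> V" using Q by (auto simp: clique_def)
  \<comment> \<open>Two sets of size 3 inside a neighbourhood of size 4 have at least two vertices
    in common.\<close>
  have "card ((Q - {v}) \<union> (Q' - {v})) \<le> 4"
    using card_mono[OF finite_nbs, of "(Q - {v}) \<union> (Q' - {v})" v] clique_subset_nbs[OF Q(1,3)]
      clique_subset_nbs[OF Q'(1,3)] card_nbs[OF vV] by simp
  moreover have "card (Q - {v}) + card (Q' - {v}) =
      card ((Q - {v}) \<union> (Q' - {v})) + card ((Q - {v}) \<inter> (Q' - {v}))"
    using fin by (intro card_Un_Int) auto
  moreover have "card (Q - {v}) = 3" "card (Q' - {v}) = 3" using Q Q' fin w by simp_all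
  ultimately have "2 \<le> card ((Q - {v}) \<inter> (Q' - {v}))" by linarith
  then obtain S where S: "S \<subseteq> (Q - {v}) \<inter> (Q' - {v})" "card S = 2" by (metis obtain_subset_with_card_n)
  then obtain b c where bc: "S = {b, c}" "b \<noteq> c" by (auto simp: card_2_iff)
  have vbc: "v \<noteq> b" "v \<noteq> c" "b \<in> Q" "c \<in> Q" "b \<in> Q'" "c \<in> Q'" using S bc by auto
  have "card (Q - {v, b, c}) = 1" "card (Q' - {v, b, c}) = 1"
    using Q Q' vbc bc w by (simp_all add: card_Diff_subset)
  then obtain d e where "Q - {v, b, c} = {d}" "Q' - {v, b, c} = {e}" by (auto simp: card_1_singleton_iff)
  then have Qd: "Q = {v, b, c, d}" "d \<notin> {v, b, c}" and Qe: "Q' = {v, b, c, e}" "e \<notin> {v, b, c}"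
    using vbc Q(3) Q'(3) by auto
  then have de: "d \<noteq> e" using ne by auto
  have adjQ: "E x y" if "x \<in> Q" "y \<in> Q" "x \<noteq> y" for x y using cliqueD[OF Q(1)] that .
  have adjQ': "E x y" if "x \<in> Q'" "y \<in> Q'" "x \<noteq> y" for x y using cliqueD[OF Q'(1)] that .
  have nde: "\<not> E d e"
  proof
    assume "E d e"
    have eQ: "E x e" if "x \<in> Q" for x
    proof (cases "x = d")
      case True
      then show ?thesis using \<open>E d e\<close> by simp
    next
      case False
      then have "x \<in> Q'" "x \<noteq> e" using that Qd(1) Qe by auto
      then show ?thesis using adjQ'[of x e] Qe(1) by simp
    qed
    have "clique G (insert e Q)"
      unfolding clique_def
    proof (intro conjI ballI impI)
      show "insert e Q \<subseteq> V" using Q(1) Q'(1) Qe(1) by (auto simp: clique_def)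
      fix x y assume "x \<in> insert e Q" "y \<in> insert e Q" "x \<noteq> y"
      then consider "x \<in> Q" "y \<in> Q" | "x \<in> Q" "y = e" | "x = e" "y \<in> Q" by blast
      then show "E x y"
        by cases (use \<open>x \<noteq> y\<close> adjQ eQ E_sym[OF eQ] in simp_all)
    qed
    moreover have "card (insert e Q) = 5" using Q(2) w fin Qd Qe de by auto
    ultimately show False using card_clique_le(1) w by fastforce
  qed
  have nb: "nbs x = {v, b, c, d, e} - {x}" if "x \<in> {v, b, c}" for x
  proof -
    have "{v, b, c, d, e} - {x} \<subseteq> nbs x"
      using that adjQ[of x] adjQ'[of x] Qd Qe by (auto simp: nbs_def)
    moreover have "card ({v, b, c, d, e} - {x}) = 4" using that vbc bc Qd Qe de by auto
    moreover have "x \<in> V" using that Q(1) vbc Q(3) by (auto simp: clique_def)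
    ultimately show ?thesis using card_nbs by (metis card_subset_eq finite_nbs)
  qed
  have ext: "\<exists>y. y \<notin> {v, b, c} \<and> nbs x = {v, b, c, y}" if "x \<in> {d, e}" for x
  proof -
    have sub: "{v, b, c} \<subseteq> nbs x"
      using that adjQ[of x] adjQ'[of x] Qd Qe by (auto simp: nbs_def)
    have "x \<in> V" using that Q(1) Q'(1) Qd(1) Qe(1) by (auto simp: clique_def)
    then have "card (nbs x - {v, b, c}) = 1"
      using sub card_nbs vbc bc by (simp add: card_Diff_subset)
    then obtain y where "nbs x - {v, b, c} = {y}" by (auto simp: card_1_singleton_iff)
    then show ?thesis using sub by (intro exI[of _ y]) auto
  qed
  obtain d' where d': "d' \<notin> {v, b, c}" "nbs d = {v, b, c, d'}" using ext[of d] by blast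
  obtain e' where e': "e' \<notin> {v, b, c}" "nbs e = {v, b, c, e'}" using ext[of e] by blast
  have Edd': "E d d'" using d' by (auto simp: nbs_def)
  then have d'de: "d' \<noteq> d" "d' \<noteq> e" using nde E_irrefl by metis+
  \<comment> \<open>Otherwise {e, d'} would be independent and dominate \<open>Q\<close>:
    \<open>e\<close> is adjacent to \<open>v\<close>, \<open>b\<close>, \<open>c\<close>, and
    \<open>d'\<close> to \<open>d\<close>.\<close>
  have Eed': "E e d'"
  proof (rule ccontr)
    assume no: "\<not> E e d'"
    have "e \<in> V" "d' \<in> V" using Q'(1) Qe(1) Edd' E_V by (auto simp: clique_def)
    then have "independent_set G {e, d'}"
      using no E_sym by (auto simp: independent_set_def)
    then obtain q where "q \<in> Q" "\<not> E q e" "\<not> E q d'" using no_dominating[OF Q(1,2), of "{e, d'}"] by auto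
    then show False using Edd' adjQ'[of q e] Qd(1) Qe de by auto
  qed
  then have e'd': "e' = d'" using e' d' by (auto simp: nbs_def)
  obtain K where K: "clique G K" "card K = 4" "d' \<in> K" using ex_clique[of d'] Edd' E_V w by metis
  have noE: "\<not> E x d'" if "x \<in> {v, b, c}" for x
    using nb[OF that] d'(1) d'de by (auto simp: nbs_def)
  have "d \<notin> K \<and> e \<notin> K"
  proof (rule ccontr)
    assume "\<not> ?thesis"
    then obtain y where y: "y \<in> K" "y \<in> {d, e}" by blast
    have "card (K - {y, d'}) \<noteq> 0" using K y d'de by (auto simp: card_Diff_subset)
    then obtain x where x: "x \<in> K" "x \<noteq> y" "x \<noteq> d'" by (metis Diff_iff card.empty ex_in_conv insertCI)
    have "E y x" "E x d'" using cliqueD[OF K(1)] x y K(3) by auto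
    then have "x \<in> {v, b, c}" using y d' e' e'd' x(3) by (auto simp: nbs_def)
    then show False using noE \<open>E x d'\<close> by blast
  qed
  then have "K - {d'} \<subseteq> nbs d' - {d, e}" using clique_subset_nbs[OF K(1,3)] by blast
  then have "card (K - {d'}) \<le> card (nbs d' - {d, e})" by (intro card_mono) auto
  moreover have "{d, e} \<subseteq> nbs d'" using Edd' Eed' E_sym by (auto simp: nbs_def)
  then have "card (nbs d' - {d, e}) = 2" using card_nbs[of d'] Edd' E_V de by (auto simp: card_Diff_subset)
  ultimately show False using K finite_clique[OF K(1)] by simp
qed

end

section \<open>Cliques of size four: from the matching of outer edges to H_n\<close>

context unique_clique_graph
begin

context
  assumes w: "card C = 4"
begin

lemma outer_unique: "outer v x \<Longrightarrow> outer v y \<Longrightarrow> x = y"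
proof -
  assume xy: "outer v x" "outer v y"
  have "card {u. outer v u} \<le> 1" using card_outer[OF outer_V(1)[OF xy(1)]] w by simp
  then have "card {u. outer v u} \<le> Suc 0" by simp
  then show "x = y" using xy finite_outer[of v] by (simp add: card_le_Suc0_iff_eq)
qed

lemma outer_ex:
  assumes "v \<in> V"
  shows "\<exists>x. outer v x"
proof -
  have "card {u. outer v u} = 1" using card_outer[OF assms] w by simp
  then obtain x where "{u. outer v u} = {x}" by (auto simp: card_1_singleton_iff)
  then show ?thesis by blast
qed

text \<open>The outer neighbours of a block dominate it, so two of them are adjacent. An
  automorphism moves this situation to a pair of vertices containing \<open>v\<close>.\<close>

lemma partner:
  assumes v: "v \<in> V"
  shows "\<exists>v' x x'. v' \<in> B v \<and> v' \<noteq> v \<and> outer v x \<and> outer v' x' \<and> B x = B x'"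
proof -
  let ?P = "\<lambda>v. \<exists>v' x x'. v' \<in> B v \<and> v' \<noteq> v \<and> outer v x \<and> outer v' x' \<and> E x x'"
  let ?I = "{x. \<exists>q\<in>B v. outer q x}"
  have "\<not> independent_set G ?I"
  proof
    assume "independent_set G ?I"
    then obtain q where q: "q \<in> B v" "\<forall>i\<in>?I. \<not> E q i"
      using no_dominating[OF B_props(1,2)[OF v], of ?I] by blast
    obtain x where "outer q x" using outer_ex B_mem[OF v q(1)] by blast
    then show False using q outer_E by blast
  qed
  moreover have "?I \<subseteq> V" using outer_V by blast
  ultimately obtain x x' where "x \<in> ?I" "x' \<in> ?I" "E x x'" by (auto simp: independent_set_def)
  then obtain q q' where q: "q \<in> B v" "q' \<in> B v" "outer q x" "outer q' x'" "E x x'" by blast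
  have "q \<noteq> q'" using outer_unique q E_irrefl by metis
  moreover have "B q = B v" using B_eq[OF v q(1)] .
  ultimately have "?P q" using q by metis
  moreover have "q \<in> V" using B_mem[OF v q(1)] .
  ultimately have "?P v"
  proof (rule transport[OF _ _ v])
    fix f w assume f: "f \<in> auts" and w: "w \<in> V" and "?P w"
    then obtain v' x x' where p: "v' \<in> B w" "v' \<noteq> w" "outer w x" "outer v' x'" "E x x'" by blast
    then have "f v' \<in> B (f w)" "f v' \<noteq> f w" "outer (f w) (f x)" "outer (f v') (f x')" "E (f x) (f x')"
      using B_aut[OF f w] outer_aut[OF f] autD[OF f] by auto
    then show "?P (f w)" by blast
  qed
  then obtain v' x x' where p: "v' \<in> B v" "v' \<noteq> v" "outer v x" "outer v' x'" "E x x'" by blast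
  have "B x = B x'"
  proof (rule ccontr)
    \<comment> \<open>The edge between \<open>x\<close> and \<open>x'\<close> would be a second
      outer edge at \<open>x\<close>, besides the one to \<open>v\<close>.\<close>
    assume "B x \<noteq> B x'"
    then have "outer x x'" using outer_iff p(5) by blast
    then have "x' = v" using outer_unique[of x] outer_sym[OF p(3)] by blast
    then have "v' = x" using outer_unique[of v] outer_sym[OF p(4)] p(3) by blast
    then show False using p(1,3) by (simp add: outer_def)
  qed
  then show ?thesis using p by blast
qed

text \<open>The links leave the block \<open>T i\<close> at \<open>z i\<close> and
  \<open>w' i\<close> and enter the next block at \<open>x i\<close> and \<open>y i\<close>. The
  premise \<open>dis\<close> separates entries from exits, so that together they fill a block of
  four vertices.\<close>

lemma embeds_H_graph_blocks:
  assumes n: "n \<ge> 2" and T: "inj_on T {..<n}"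
    and zT: "\<And>i. i < n \<Longrightarrow> z i \<in> T i" and wT: "\<And>i. i < n \<Longrightarrow> w' i \<in> T i"
    and TB: "\<And>i. i < n \<Longrightarrow> T i \<in> B ` V"
    and zw: "\<And>i. i < n \<Longrightarrow> z i \<noteq> w' i"
    and outer: "\<And>i. i < n \<Longrightarrow> outer (z i) (x i)" "\<And>i. i < n \<Longrightarrow> outer (w' i) (y i)"
    and xT: "\<And>i. i < n \<Longrightarrow> x i \<in> T (Suc i mod n)" and yT: "\<And>i. i < n \<Longrightarrow> y i \<in> T (Suc i mod n)"
    and dis: "\<And>i. i < n \<Longrightarrow> {x i, y i} \<inter> {z (Suc i mod n), w' (Suc i mod n)} = {}"
  shows "\<exists>f. embeds (H_graph n) f"
proof -
  \<comment> \<open>\<open>T\<close> counts blocks from 0 and \<open>H_graph\<close> from 1: block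
    \<open>j\<close> is \<open>T (j - 1)\<close>, and its vertices \<open>x_j\<close> and
    \<open>y_j\<close> are the ends of links that leave \<open>T (prev j)\<close>.\<close>
  define prev where "prev j = (if j = 1 then n - 1 else j - 2)" for j
  have prev: "prev j < n" "Suc (prev j) mod n = j - 1" if "j \<in> {1..n}" for j
    using that n by (auto simp: prev_def mod_Suc)
  have pred: "j - 1 < n" if "j \<in> {1..n}" for j
    using that by auto
  have prev_succ: "prev (H_succ n j) = j - 1" if "j \<in> {1..n}" for j
    using that n by (auto simp: prev_def H_succ_def)
  define f where "f = (\<lambda>(a, j). case a of Hx \<Rightarrow> x (prev j) | Hy \<Rightarrow> y (prev j) | Hz \<Rightarrow> z (j - 1) | Hw \<Rightarrow> w' (j - 1))"
  have fT: "f (a, j) \<in> T (j - 1)" if "j \<in> {1..n}" for a j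
    using that prev[OF that] zT[OF pred[OF that]] wT[OF pred[OF that]] xT[OF prev(1)[OF that]] yT[OF prev(1)[OF that]]
    by (cases a) (auto simp: f_def)
  have fdis: "f (a, j) \<noteq> f (b, j)" if j: "j \<in> {1..n}" and "a \<noteq> b" for a b j
  proof -
    have "x (prev j) \<noteq> y (prev j)"
      using outer_sym[OF outer(1)[OF prev(1)[OF j]]] outer_sym[OF outer(2)[OF prev(1)[OF j]]]
        outer_unique zw[OF prev(1)[OF j]] by metis
    moreover have "z (j - 1) \<noteq> w' (j - 1)" using zw[OF pred[OF j]] .
    moreover have "{x (prev j), y (prev j)} \<inter> {z (j - 1), w' (j - 1)} = {}"
      using dis[OF prev(1)[OF j]] prev(2)[OF j] by simp
    ultimately show ?thesis using \<open>a \<noteq> b\<close> by (cases a; cases b) (auto simp: f_def)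
  qed
  have block: "E (f (a, j)) (f (b, j))" if j: "j \<in> {1..n}" and "a \<noteq> b" for a b j
  proof -
    obtain v where v: "v \<in> V" "T (j - 1) = B v" using TB[OF pred[OF j]] by auto
    then show ?thesis using B_adj[OF v(1)] fT[OF j] fdis[OF that] by metis
  qed
  have link: "E (f p) (f q)" if pq: "(p, q) \<in> H_links n" for p q
  proof -
    obtain i where i: "i \<in> {1..n}" "p = (Hz, i) \<and> q = (Hx, H_succ n i) \<or> p = (Hw, i) \<and> q = (Hy, H_succ n i)"
      using pq by (auto simp: H_links_def)
    then show ?thesis
      using outer_E[OF outer(1)[OF pred[OF i(1)]]] outer_E[OF outer(2)[OF pred[OF i(1)]]] prev_succ[OF i(1)]
      by (auto simp: f_def)
  qed
  have V: "pverts (H_graph n) = UNIV \<times> {1..n}"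
    using H_letter.exhaust by (auto simp: H_graph_def H_verts_def)
  have "embeds (H_graph n) f"
    unfolding embeds_def V
  proof (intro conjI allI impI)
    show "inj_on f (UNIV \<times> {1..n})"
    proof (rule inj_onI, clarify)
      fix a j b k assume jk: "j \<in> {1..n}" "k \<in> {1..n}" and eq: "f (a, j) = f (b, k)"
      obtain u v where uv: "u \<in> V" "T (j - 1) = B u" "v \<in> V" "T (k - 1) = B v"
        using TB[OF pred[OF jk(1)]] TB[OF pred[OF jk(2)]] by auto
      have "f (a, j) \<in> B u" "f (a, j) \<in> B v"
        using fT[OF jk(1), of a] fT[OF jk(2), of b] eq uv by simp_all
      then have "B u = B v" using B_eq uv by metis
      then have "j - 1 = k - 1" using inj_onD[OF T, of "j - 1" "k - 1"] uv pred[OF jk(1)] pred[OF jk(2)] by auto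
      then have "j = k" using jk by auto
      then show "a = b \<and> j = k" using fdis[OF jk(1), of a b] eq by auto
    qed
    show "f ` (UNIV \<times> {1..n}) \<subseteq> V"
    proof clarify
      fix a j assume j: "j \<in> {1..n}"
      obtain v where "v \<in> V" "T (j - 1) = B v" using TB[OF pred[OF j]] by auto
      then show "f (a, j) \<in> V" using fT[OF j] B_mem by metis
    qed
    fix p q assume "(p, q) \<in> parcs (H_graph n)"
    then consider a b i where "i \<in> {1..n}" "a \<noteq> b" "p = (a, i)" "q = (b, i)"
      | "(p, q) \<in> H_links n" | "(q, p) \<in> H_links n"
      by (auto simp: H_graph_def)
    then show "E (f p) (f q)"
      by cases (use block link E_sym in blast)+
  qed
  then show ?thesis by blast
qed

text \<open>By \<open>partner\<close>, the four outer edges of a block lead to a single block or,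
  two each, to two blocks. A single block gives \<open>n = 2\<close>, where the cycle of blocks
  degenerates to a double link that \<open>block_cycle\<close> cannot describe.\<close>

lemma embeds_H_graph: "\<exists>n\<ge>2. \<exists>f. embeds (H_graph n) f"
proof (cases "\<exists>v\<in>V. \<exists>Y. \<forall>u\<in>B v. \<forall>x. outer u x \<longrightarrow> B x = Y")
  case True
  then obtain v Y where v: "v \<in> V" and Y: "\<forall>u\<in>B v. \<forall>x. outer u x \<longrightarrow> B x = Y" by blast
  obtain a b c d where abcd: "B v = {a, b, c, d}" "distinct [a, b, c, d]"
    using B_props(2)[OF v] w by (auto simp: card_Suc_eq numeral_eq_Suc)
  have V4: "a \<in> V" "b \<in> V" "c \<in> V" "d \<in> V" using abcd(1) B_mem[OF v] by auto
  obtain a' b' c' d' where o: "outer a a'" "outer b b'" "outer c c'" "outer d d'"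
    using outer_ex[OF V4(1)] outer_ex[OF V4(2)] outer_ex[OF V4(3)] outer_ex[OF V4(4)] by blast
  have Y': "B a' = Y" "B b' = Y" "B c' = Y" "B d' = Y"
    using Y[rule_format, OF _ o(1)] Y[rule_format, OF _ o(2)] Y[rule_format, OF _ o(3)]
      Y[rule_format, OF _ o(4)] abcd(1) by simp_all
  have ne: "B v \<noteq> Y" using outer_B[OF o(1)] Y' B_eq[OF v, of a] abcd(1) by auto
  have mem: "a' \<in> Y" "b' \<in> Y" "c' \<in> Y" "d' \<in> Y" 
    using Y' B_props(3)[OF outer_V(2)[OF o(1)]] B_props(3)[OF outer_V(2)[OF o(2)]]
      B_props(3)[OF outer_V(2)[OF o(3)]] B_props(3)[OF outer_V(2)[OF o(4)]] by simp_all
  have dis: "distinct [a', b', c', d']"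
  proof -
    have "p = q" if "outer p r" "outer q r" for p q r
      using outer_unique[OF outer_sym outer_sym] that by blast
    then show ?thesis using abcd(2) o by (metis distinct_length_2_or_more distinct_singleton)
  qed
  define T where "T i = (if i = 0 then B v else Y)" for i :: nat
  have "\<exists>f. embeds (H_graph 2) f"
    \<comment> \<open>Of the four edges between \<open>B v\<close> and \<open>Y\<close>, those at
      \<open>c\<close> and \<open>d\<close> are read as leaving \<open>B v\<close> and those at
      \<open>a'\<close> and \<open>b'\<close> as leaving \<open>Y\<close>.\<close>
    by (rule embeds_H_graph_blocks[of 2 T "\<lambda>i. if i = 0 then c else a'" "\<lambda>i. if i = 0 then d else b'"
          "\<lambda>i. if i = 0 then c' else a" "\<lambda>i. if i = 0 then d' else b"])
      (use ne mem dis abcd Y' outer_V(2)[OF o(1)] v o outer_sym[OF o(1)] outer_sym[OF o(2)] in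
        \<open>auto simp: less_numeral_cases T_def inj_on_def\<close>)
  then show ?thesis by blast
next
  case False
  have "card {Y. R (B v) Y} = 2" if v: "v \<in> V" for v
  proof -
    obtain v1 x x1 where 1: "v1 \<in> B v" "v1 \<noteq> v" "outer v x" "outer v1 x1" "B x = B x1" using partner[OF v] by blast
    obtain u y where u: "u \<in> B v" "outer u y" "B y \<noteq> B x" using False v by metis
    then have uV: "u \<in> V" and Bu: "B u = B v" using B_mem[OF v] B_eq[OF v] by blast+
    obtain u1 y' y1 where "u1 \<in> B u" "u1 \<noteq> u" "outer u y'" "outer u1 y1" "B y' = B y1" using partner[OF uV] by blast
    then have 2: "u1 \<in> B v" "u1 \<noteq> u" "outer u1 y1" "B y = B y1" using outer_unique u(2) Bu by metis+
    \<comment> \<open>The edges at \<open>u\<close> and \<open>u1\<close> lead to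
      \<open>B y\<close>, those at \<open>v\<close> and \<open>v1\<close> to \<open>B x\<close>; one
      outer edge per vertex keeps the pairs disjoint.\<close>
    have "u \<noteq> v" "u \<noteq> v1" "u1 \<noteq> v" "u1 \<noteq> v1" using outer_unique 1 2 u by metis+
    then have "card {v, v1, u, u1} = card (B v)" using 1 2 B_props(2)[OF v] w by auto
    then have Bv: "B v = {v, v1, u, u1}"
      using 1 2 u B_props(3)[OF v] finite_B[OF v] by (metis card_subset_eq empty_subsetI insert_subset)
    have "{Y. R (B v) Y} = {B x, B y}"
    proof (intro equalityI subsetI)
      fix Y assume "Y \<in> {Y. R (B v) Y}"
      then obtain p q where pq: "outer p q" "B v = B p" "Y = B q" by (auto simp: R_def)
      then have "p \<in> {v, v1, u, u1}" using Bv B_props(3)[OF outer_V(1)[OF pq(1)]] by simp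
      then show "Y \<in> {B x, B y}" using outer_unique[OF pq(1)] 1 2 u pq(3) by auto
    next
      fix Y assume "Y \<in> {B x, B y}"
      then show "Y \<in> {Y. R (B v) Y}" using 1(3) u(2) Bu by (auto simp: R_def)
    qed
    then show ?thesis using u(3) by simp
  qed
  then obtain n T where n: "n \<ge> 3" and T: "inj_on T {..<n}" "T ` {..<n} \<subseteq> B ` V"
    and R: "\<And>i. i < n \<Longrightarrow> R (T i) (T (Suc i mod n))"
    using block_cycle by blast
  have "\<exists>z w' x y. z \<in> T i \<and> w' \<in> T i \<and> z \<noteq> w' \<and> outer z x \<and> outer w' y \<and> x \<in> T (Suc i mod n) \<and> y \<in> T (Suc i mod n)"
    if i: "i < n" for i
  proof -
    obtain z x where z: "outer z x" "T i = B z" "T (Suc i mod n) = B x" using R[OF i] by (auto simp: R_def)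
    obtain w' x' y where p: "w' \<in> B z" "w' \<noteq> z" "outer z x'" "outer w' y" "B x' = B y" using partner[OF outer_V(1)[OF z(1)]] by blast
    then have "B x = B y" using outer_unique z(1) by metis
    then show ?thesis
      using z p B_props(3)[OF outer_V(1)[OF z(1)]] B_props(3)[OF outer_V(2)[OF z(1)]] B_props(3)[OF outer_V(2)[OF p(4)]] by metis
  qed
  then obtain z w' x y where q: "\<And>i. i < n \<Longrightarrow> z i \<in> T i \<and> w' i \<in> T i \<and> z i \<noteq> w' i \<and> outer (z i) (x i) \<and> outer (w' i) (y i) \<and>
      x i \<in> T (Suc i mod n) \<and> y i \<in> T (Suc i mod n)" by metis
  have T_disj: "i = j" if ij: "i < n" "j < n" "v \<in> T i" "v \<in> T j" for i j v
  proof -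
    have "T i \<in> B ` V" "T j \<in> B ` V" using T(2) ij(1,2) by auto
    then obtain a b where "a \<in> V" "b \<in> V" "T i = B a" "T j = B b" by blast
    then have "T i = T j" using ij(3,4) B_eq by metis
    then show ?thesis using inj_onD[OF T(1)] ij by auto
  qed
  have "{x i, y i} \<inter> {z (Suc i mod n), w' (Suc i mod n)} = {}" if i: "i < n" for i
  proof -
    \<comment> \<open>The outer edge of an entry leads back to \<open>T i\<close>, that of an exit
      two blocks further on; for \<open>n \<ge> 3\<close> these blocks differ.\<close>
    have ne: "Suc (Suc i mod n) mod n \<noteq> i" using n i by (auto simp: mod_Suc)
    have lt: "Suc i mod n < n" "Suc (Suc i mod n) mod n < n" using n by auto
    have F: False if "outer p p'" "p' \<in> T i" "outer p p''" "p'' \<in> T (Suc (Suc i mod n) mod n)" for p p' p''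
      using outer_unique[OF that(1,3)] T_disj[OF i lt(2), of p'] that ne by metis
    have a: "\<exists>p'. outer p p' \<and> p' \<in> T i" if "p \<in> {x i, y i}" for p
      using that q[OF i] outer_sym by blast
    have b: "\<exists>p'. outer p p' \<and> p' \<in> T (Suc (Suc i mod n) mod n)" if "p \<in> {z (Suc i mod n), w' (Suc i mod n)}" for p
      using that q[OF lt(1)] by blast
    show ?thesis using a b F by blast
  qed
  then have "\<exists>f. embeds (H_graph n) f"
    using n T q by (intro embeds_H_graph_blocks[of n T z w' x y]) auto
  then show ?thesis using n by (intro exI[of _ n]) auto
qed

end

end

section \<open>Outer edges between triangles\<close>

context unique_clique_graph
begin

text \<open>\<open>full\<close> and \<open>paired\<close> measure the multiplicity of adjacency
  between blocks. When blocks are triangles, a vertex sends at most one edge to any other block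
  (\<open>outer_inj\<close>), so \<open>full\<close> means three edges and \<open>paired\<close> at
  least two.\<close>

definition full :: "'a \<Rightarrow> 'a \<Rightarrow> bool" where
  "full a x \<longleftrightarrow> outer a x \<and> (\<forall>b\<in>B a. \<exists>y. outer b y \<and> B y = B x)"

definition paired :: "'a \<Rightarrow> 'a \<Rightarrow> bool" where
  "paired a x \<longleftrightarrow> outer a x \<and> (\<exists>b\<in>B a. b \<noteq> a \<and> (\<exists>y. outer b y \<and> B y = B x))"

text \<open>For an outer neighbour \<open>x\<close> of \<open>v\<close>: a walk of three outer edges
  that starts with \<open>v\<close>, \<open>x\<close> returns to the block of \<open>v\<close> at
  another vertex. It is an invariant that separates patterns of equal multiplicities.\<close>

definition closing :: "'a \<Rightarrow> 'a \<Rightarrow> bool" where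
  "closing v x \<longleftrightarrow> (\<exists>y z. outer x y \<and> outer y z \<and> z \<in> B v \<and> z \<noteq> v)"

lemma full_aut1: "f \<in> auts \<Longrightarrow> full a x \<Longrightarrow> full (f a) (f x)"
proof -
  assume f: "f \<in> auts" and ax: "full a x"
  have oax: "outer a x" using ax by (simp add: full_def)
  have "\<exists>y. outer b' y \<and> B y = B (f x)" if b': "b' \<in> B (f a)" for b'
  proof -
    obtain b where b: "b \<in> B a" "b' = f b" using b' B_aut[OF f outer_V(1)[OF oax]] by auto
    then obtain y where y: "outer b y" "B y = B x" using ax by (auto simp: full_def)
    then have "outer b' (f y)" "B (f y) = B (f x)"
      using b outer_aut[OF f] B_aut[OF f outer_V(2)[OF y(1)]] B_aut[OF f outer_V(2)[OF oax]] by simp_all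
    then show ?thesis by blast
  qed
  then show ?thesis using oax outer_aut[OF f] by (simp add: full_def)
qed

lemma paired_aut1: "f \<in> auts \<Longrightarrow> paired a x \<Longrightarrow> paired (f a) (f x)"
proof -
  assume f: "f \<in> auts" and ax: "paired a x"
  then obtain b y where b: "outer a x" "b \<in> B a" "b \<noteq> a" "outer b y" "B y = B x" by (auto simp: paired_def)
  then have "outer (f a) (f x)" "f b \<in> B (f a)" "f b \<noteq> f a" "outer (f b) (f y)" "B (f y) = B (f x)"
    using outer_aut[OF f] B_aut[OF f outer_V(1)[OF b(1)]] B_aut[OF f outer_V(2)[OF b(1)]]
      B_aut[OF f outer_V(2)[OF b(4)]] autD(2)[OF f] by simp_all
  then show ?thesis unfolding paired_def by blast
qed

lemma aut_inverse:
  assumes "f \<in> auts"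
  shows "\<exists>g\<in>auts. \<forall>x. g (f x) = x \<and> f (g x) = x"
  using aut_inv[OF assms] permutes_inverses[of f V] assms by (auto simp: auts_def)

lemma full_aut: "f \<in> auts \<Longrightarrow> full (f a) (f x) \<longleftrightarrow> full a x"
  using full_aut1 aut_inverse by metis

lemma paired_aut: "f \<in> auts \<Longrightarrow> paired (f a) (f x) \<longleftrightarrow> paired a x"
  using paired_aut1 aut_inverse by metis

lemma transport_nb:
  assumes "\<exists>v x. outer v x \<and> P v x" and v: "v \<in> V"
    and inv: "\<And>f a x. f \<in> auts \<Longrightarrow> P a x \<Longrightarrow> P (f a) (f x)"
  shows "\<exists>x. outer v x \<and> P v x"
proof -
  obtain u x where u: "outer u x" "P u x" using assms by blast
  obtain f where f: "f \<in> auts" "f u = v" using ex_aut[OF outer_V(1)[OF u(1)] v] by blast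
  then have "outer v (f x)" "P v (f x)" using u outer_aut[OF f(1), of u x] inv[OF f(1) u(2)] by simp_all
  then show ?thesis by blast
qed

text \<open>The property is taken for all outer neighbours at once because it is not known to which
  of them an automorphism sends a given one.\<close>

lemma transport_closing:
  assumes "\<forall>x. outer u x \<longrightarrow> closing u x" "u \<in> V" "v \<in> V"
  shows "\<forall>x. outer v x \<longrightarrow> closing v x"
proof (intro allI impI)
  fix x assume x: "outer v x"
  obtain f where f: "f \<in> auts" "f u = v" using ex_aut[OF assms(2,3)] by blast
  obtain x' where x': "x = f x'" using autD(4)[OF f(1)] by (metis surjD)
  then have "outer u x'" using x f outer_aut[OF f(1), of u x'] by simp
  then obtain y z where "outer x' y" "outer y z" "z \<in> B u" "z \<noteq> u" using assms(1) by (auto simp: closing_def)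
  then have "outer x (f y)" "outer (f y) (f z)" "f z \<in> B v" "f z \<noteq> v"
    using x' f outer_aut[OF f(1)] B_aut[OF f(1) assms(2)] autD(2)[OF f(1)] by auto
  then show "closing v x" unfolding closing_def by blast
qed

section \<open>Triangular blocks with two outer edges at each vertex\<close>

context
  assumes w: "card C = 3"
begin

lemma ex_mate:
  assumes "v \<in> V"
  shows "\<exists>b. b \<in> B v \<and> b \<noteq> v"
proof (rule ccontr)
  assume "\<not> ?thesis"
  then have "B v \<subseteq> {v}" by blast
  then have "card (B v) \<le> 1" using card_mono[of "{v}" "B v"] by simp
  then show False using B_props(2)[OF assms] w by simp
qed

lemma outer_two:
  assumes "v \<in> V"
  shows "\<exists>x y. x \<noteq> y \<and> {u. outer v u} = {x, y}"
  using card_outer[OF assms] w by (auto simp: card_2_iff)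

lemma outer_deg: "outer v x \<Longrightarrow> outer v y \<Longrightarrow> x \<noteq> y \<Longrightarrow> outer v z \<Longrightarrow> z = x \<or> z = y"
proof -
  assume *: "outer v x" "outer v y" "x \<noteq> y" "outer v z"
  obtain p q where pq: "{u. outer v u} = {p, q}" using outer_two[OF outer_V(1)[OF *(1)]] by blast
  have "u = p \<or> u = q" if "outer v u" for u using pq that by blast
  then show ?thesis using * by metis
qed

text \<open>Such a triangle would have to be the block of \<open>a\<close>.\<close>

lemma outer_no_triangle: "outer a x \<Longrightarrow> outer a y \<Longrightarrow> \<not> E x y"
proof
  assume xy: "outer a x" "outer a y" "E x y"
  have "clique G {a, x, y}" "card {a, x, y} = card C"
    using clique3[OF outer_E[OF xy(1)] outer_E[OF xy(2)] xy(3)] w by simp_all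
  then have "B a = {a, x, y}" by (intro B_eqI) auto
  then show False using xy(1) by (simp add: outer_def)
qed

lemma outer_inj: "outer a x \<Longrightarrow> outer a y \<Longrightarrow> B x = B y \<Longrightarrow> x = y"
proof (rule ccontr)
  assume xy: "outer a x" "outer a y" "B x = B y" "x \<noteq> y"
  have "E x y"
    using B_adj[OF outer_V(2)[OF xy(1)] B_props(3)[OF outer_V(2)[OF xy(1)]], of y]
      B_props(3)[OF outer_V(2)[OF xy(2)]] xy by simp
  then show False using outer_no_triangle xy by blast
qed

lemma outer_inj': "outer a x \<Longrightarrow> outer b x \<Longrightarrow> B a = B b \<Longrightarrow> a = b"
  using outer_inj outer_sym by blast

lemma B_third:
  assumes "v \<in> V" "p \<in> B v" "q \<in> B v" "x \<in> B v" "y \<in> B v" "p \<noteq> q" "x \<notin> {p, q}" "y \<notin> {p, q}"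
  shows "x = y"
proof (rule ccontr)
  assume "x \<noteq> y"
  then have "card {p, q, x, y} = 4" using assms by auto
  moreover have "card {p, q, x, y} \<le> card (B v)" using assms finite_B[OF assms(1)] by (intro card_mono) auto
  ultimately show False using B_props(2)[OF assms(1)] w by simp
qed

text \<open>A block with all of its outer neighbours, two at each vertex. An argument made for one
  labelling is repeated for the others through \<open>conf_rot\<close> and
  \<open>conf_swap\<close>.\<close>

definition conf :: "'a \<Rightarrow> 'a \<Rightarrow> 'a \<Rightarrow> 'a \<Rightarrow> 'a \<Rightarrow> 'a \<Rightarrow> 'a \<Rightarrow> 'a \<Rightarrow> 'a \<Rightarrow> bool" where
  "conf a b c a1 a2 b1 b2 c1 c2 \<longleftrightarrow> B a = {a, b, c} \<and> distinct [a, b, c] \<and> a1 \<noteq> a2 \<and> b1 \<noteq> b2 \<and> c1 \<noteq> c2 \<and>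
     outer a a1 \<and> outer a a2 \<and> outer b b1 \<and> outer b b2 \<and> outer c c1 \<and> outer c c2"

lemma conf_rot: "conf a b c a1 a2 b1 b2 c1 c2 \<Longrightarrow> conf b c a b1 b2 c1 c2 a1 a2"
  using B_eq[of a b] outer_V(1)[of a a1] by (auto simp: conf_def)

lemma conf_swap: "conf a b c a1 a2 b1 b2 c1 c2 \<Longrightarrow> conf b a c b1 b2 a1 a2 c1 c2"
  using B_eq[of a b] outer_V(1)[of a a1] by (auto simp: conf_def)

lemma conf_ex:
  assumes "outer a a1" "b \<in> B a" "b \<noteq> a" "outer b b1"
  shows "\<exists>c a2 b2 c1 c2. conf a b c a1 a2 b1 b2 c1 c2"
proof -
  have aV: "a \<in> V" using outer_V assms by blast
  obtain p q r where pqr: "B a = {p, q, r}" "p \<noteq> q" "p \<noteq> r" "q \<noteq> r"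
    using B_props(2)[OF aV] w by (auto simp: card_3_iff)
  have "a \<in> {p, q, r}" "b \<in> {p, q, r}" using B_props(3)[OF aV] assms(2) pqr(1) by simp_all
  then have "\<exists>c. B a = {a, b, c} \<and> c \<noteq> a \<and> c \<noteq> b" using pqr assms(3) by (elim insertE emptyE) auto
  then obtain c where c: "B a = {a, b, c}" "c \<noteq> a" "c \<noteq> b" by blast
  then have V: "b \<in> V" "c \<in> V" using B_mem[OF aV] by auto
  obtain x y where x: "x \<noteq> y" "{u. outer a u} = {x, y}" using outer_two[OF aV] by blast
  have "a1 \<in> {x, y}" using assms(1) x(2) by blast
  moreover have "outer a x" "outer a y" using x(2) by blast+
  ultimately obtain a2 where a2: "outer a a2" "a1 \<noteq> a2" using x(1) by blast
  obtain x' y' where x': "x' \<noteq> y'" "{u. outer b u} = {x', y'}" using outer_two[OF V(1)] by blast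
  have "b1 \<in> {x', y'}" using assms(4) x'(2) by blast
  moreover have "outer b x'" "outer b y'" using x'(2) by blast+
  ultimately obtain b2 where b2: "outer b b2" "b1 \<noteq> b2" using x'(1) by blast
  obtain c1 c2 where c12: "c1 \<noteq> c2" "{u. outer c u} = {c1, c2}" using outer_two[OF V(2)] by blast
  then have "outer c c1" "outer c c2" by blast+
  then have "conf a b c a1 a2 b1 b2 c1 c2"
    using c a2 b2 c12(1) assms by (auto simp: conf_def)
  then show ?thesis by blast
qed

lemma confD:
  assumes "conf a b c a1 a2 b1 b2 c1 c2"
  shows "outer a a1" "outer a a2" "outer b b1" "outer b b2" "outer c c1" "outer c c2"
    and "B a = {a, b, c}" "B b = B a" "B c = B a" "a \<noteq> b" "a \<noteq> c" "b \<noteq> c"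
    and "B a1 \<noteq> B a" "B a2 \<noteq> B a" "B b1 \<noteq> B a" "B b2 \<noteq> B a" "B c1 \<noteq> B a" "B c2 \<noteq> B a"
    and "B a1 \<noteq> B a2" "B b1 \<noteq> B b2" "B c1 \<noteq> B c2"
    and "distinct [a1, a2, b1, b2, c1, c2]"
    and "outer a x \<Longrightarrow> x = a1 \<or> x = a2" "outer b x \<Longrightarrow> x = b1 \<or> x = b2" "outer c x \<Longrightarrow> x = c1 \<or> x = c2"
proof -
  show o: "outer a a1" "outer a a2" "outer b b1" "outer b b2" "outer c c1" "outer c c2"
    and Ba: "B a = {a, b, c}" and d: "a \<noteq> b" "a \<noteq> c" "b \<noteq> c"
    using assms by (simp_all add: conf_def)
  have ne: "a1 \<noteq> a2" "b1 \<noteq> b2" "c1 \<noteq> c2" using assms by (simp_all add: conf_def)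
  show Bb: "B b = B a" "B c = B a" using B_eq[OF outer_V(1)[OF o(1)]] Ba by simp_all
  show "B a1 \<noteq> B a" "B a2 \<noteq> B a" "B b1 \<noteq> B a" "B b2 \<noteq> B a" "B c1 \<noteq> B a" "B c2 \<noteq> B a"
    using outer_B o Bb by metis+
  show "B a1 \<noteq> B a2" "B b1 \<noteq> B b2" "B c1 \<noteq> B c2"
    using outer_inj o ne by metis+
  have D: "x \<noteq> y" if "outer p x" "outer q y" "B p = B q" "p \<noteq> q" for p q x y
    using outer_inj' that by blast
  have bc: "B a = B b" "B a = B c" "B b = B c" using Bb by simp_all
  show "distinct [a1, a2, b1, b2, c1, c2]"
    using ne D[OF o(1) o(3) bc(1) d(1)] D[OF o(1) o(4) bc(1) d(1)] D[OF o(2) o(3) bc(1) d(1)]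
      D[OF o(2) o(4) bc(1) d(1)] D[OF o(1) o(5) bc(2) d(2)] D[OF o(1) o(6) bc(2) d(2)]
      D[OF o(2) o(5) bc(2) d(2)] D[OF o(2) o(6) bc(2) d(2)] D[OF o(3) o(5) bc(3) d(3)]
      D[OF o(3) o(6) bc(3) d(3)] D[OF o(4) o(5) bc(3) d(3)] D[OF o(4) o(6) bc(3) d(3)]
    by simp
  show "outer a x \<Longrightarrow> x = a1 \<or> x = a2" "outer b x \<Longrightarrow> x = b1 \<or> x = b2" "outer c x \<Longrightarrow> x = c1 \<or> x = c2"
    using outer_deg o ne by blast+
qed

section \<open>Excluding simple and double adjacency of triangles\<close>

lemma E_outer: "E x y \<Longrightarrow> B x \<noteq> B y \<Longrightarrow> outer x y"
  using outer_iff by blast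

lemma conf_transversal:
  assumes c: "conf a b c a1 a2 b1 b2 c1 c2" and xyz: "x \<in> {a1, a2}" "y \<in> {b1, b2}" "z \<in> {c1, c2}"
  shows "E x y \<or> E y z \<or> E x z"
proof (rule ccontr)
  assume no: "\<not> ?thesis"
  have o: "outer a x" "outer b y" "outer c z" using confD(1-6)[OF c] xyz by auto
  then have "{x, y, z} \<subseteq> V" using outer_V(2) by blast
  then have "independent_set G {x, y, z}"
    using no E_commute by (auto simp: independent_set_def)
  then obtain q where q: "q \<in> B a" "\<not> E q x" "\<not> E q y" "\<not> E q z"
    using no_dominating[OF B_props(1,2)[OF outer_V(1)[OF o(1)]], of "{x, y, z}"] by auto
  then show False using o outer_E confD(7)[OF c] by auto
qed

lemma conf_distinct:
  assumes "conf a b c a1 a2 b1 b2 c1 c2"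
  shows "distinct [a, b, c, a1, a2, b1, b2, c1, c2]"
proof -
  note d = confD[OF assms]
  have "a \<notin> {a1, a2, b1, b2, c1, c2}" using d(13-18) by auto
  moreover have "b \<notin> {a1, a2, b1, b2, c1, c2}" using d(8) d(13-18) by auto
  moreover have "c \<notin> {a1, a2, b1, b2, c1, c2}" using d(9) d(13-18) by auto
  ultimately show ?thesis using d(10-12,22) by simp
qed

text \<open>With the edge \<open>a1 b1\<close> the vertex \<open>a1\<close> has no outer edge left.
  The transversals through \<open>a1\<close>, \<open>b2\<close> and either of \<open>c1\<close>,
  \<open>c2\<close> then force \<open>b2\<close> to be adjacent to both, which with \<open>b\<close>
  makes three outer neighbours.\<close>

lemma no_pairs_core:
  assumes c: "conf a b c a1 a2 b1 b2 c1 c2" and o: "outer a1 b1"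
    and np: "B a1 \<noteq> B b2" "B b2 \<noteq> B c1" "B b2 \<noteq> B c2" "B a1 \<noteq> B c1" "B a1 \<noteq> B c2"
  shows False
proof -
  note d = confD[OF c] and ds = conf_distinct[OF c]
  have o1: "x = a \<or> x = b1" if "outer a1 x" for x
    using outer_deg[OF outer_sym[OF d(1)] o _ that] ds by auto
  have 1: "\<not> E a1 b2" using E_outer[OF _ np(1)] o1[of b2] ds by auto
  have 2: "\<not> E a1 c1" using E_outer[OF _ np(4)] o1[of c1] ds by auto
  have 3: "\<not> E a1 c2" using E_outer[OF _ np(5)] o1[of c2] ds by auto
  have "outer b2 c1" using conf_transversal[OF c, of a1 b2 c1] 1 2 E_outer[OF _ np(2)] by blast
  moreover have "outer b2 c2" using conf_transversal[OF c, of a1 b2 c2] 1 3 E_outer[OF _ np(3)] by blast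
  ultimately show False
    using outer_deg[OF _ _ _ outer_sym[OF d(4)], of c1 c2] ds by auto
qed

lemma no_pairs:
  assumes c: "conf a b c a1 a2 b1 b2 c1 c2"
    and np: "\<And>x y. (x, y) \<in> {a1, a2} \<times> {b1, b2} \<union> {b1, b2} \<times> {c1, c2} \<union> {a1, a2} \<times> {c1, c2} \<Longrightarrow> B x \<noteq> B y"
  shows False
proof -
  have n: "B a1 \<noteq> B b1" "B a1 \<noteq> B b2" "B a2 \<noteq> B b1" "B a2 \<noteq> B b2"
    "B b1 \<noteq> B c1" "B b1 \<noteq> B c2" "B b2 \<noteq> B c1" "B b2 \<noteq> B c2"
    "B a1 \<noteq> B c1" "B a1 \<noteq> B c2" "B a2 \<noteq> B c1" "B a2 \<noteq> B c2"
    by (rule np; simp)+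
  consider "outer a1 b1" | "outer b1 c1" | "outer a1 c1"
    using conf_transversal[OF c, of a1 b1 c1] E_outer[OF _ n(1)] E_outer[OF _ n(5)] E_outer[OF _ n(9)] by blast
  then show False
  proof cases
    case 1
    show False by (rule no_pairs_core[OF c 1]) (rule n)+
  next
    case 2
    show False by (rule no_pairs_core[OF conf_rot[OF c] 2]) (rule n n[symmetric])+
  next
    case 3
    have "conf a c b a1 a2 c1 c2 b1 b2" using conf_swap[OF conf_rot[OF conf_rot[OF c]]] .
    then show False by (rule no_pairs_core[OF _ 3]) (rule n n[symmetric])+
  qed
qed

text \<open>The edge \<open>a2 b2\<close> uses up the outer edges of \<open>a2\<close> and
  \<open>b2\<close>. The transversals \<open>a1 b2 c2\<close> and \<open>a2 b1 c2\<close> force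
  \<open>c2\<close> to be adjacent to \<open>a1\<close> and \<open>b1\<close>, in addition to
  \<open>c\<close>: one outer edge too many.\<close>

lemma one_full_core:
  assumes c: "conf a b c a1 a2 b1 b2 c1 c2" and o: "outer a2 b2"
    and np: "\<And>x y. x \<in> {a1, b1, c1} \<Longrightarrow> y \<in> {a2, b2, c2} \<Longrightarrow> B x \<noteq> B y"
      "B b2 \<noteq> B c2" "B a2 \<noteq> B c2"
  shows False
proof -
  note d = confD[OF c] and ds = conf_distinct[OF c]
  have oa: "x = a \<or> x = b2" if "outer a2 x" for x
    using outer_deg[OF outer_sym[OF d(2)] o _ that] ds by auto
  have ob: "x = b \<or> x = a2" if "outer b2 x" for x
    using outer_deg[OF outer_sym[OF d(4)] outer_sym[OF o] _ that] ds by auto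
  have np': "B a1 \<noteq> B b2" "B a1 \<noteq> B c2" "B b1 \<noteq> B c2" "B a2 \<noteq> B b1"
    using np(1)[of a1 b2] np(1)[of a1 c2] np(1)[of b1 c2] np(1)[of b1 a2] by auto
  have "\<not> E b2 c2" using E_outer[OF _ np(2)] ob[of c2] ds by auto
  moreover have "\<not> E a1 b2" using outer_sym[OF E_outer[OF _ np'(1)]] ob[of a1] ds by auto
  ultimately have "E a1 c2" using conf_transversal[OF c, of a1 b2 c2] by blast
  then have 1: "outer c2 a1" using outer_sym[OF E_outer[OF _ np'(2)]] by blast
  have "\<not> E a2 c2" using E_outer[OF _ np(3)] oa[of c2] ds by auto
  moreover have "\<not> E a2 b1" using E_outer[OF _ np'(4)] oa[of b1] ds by auto
  ultimately have "E b1 c2" using conf_transversal[OF c, of a2 b1 c2] by blast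
  then have 2: "outer c2 b1" using outer_sym[OF E_outer[OF _ np'(3)]] by blast
  show False using outer_deg[OF 1 2 _ outer_sym[OF d(6)]] ds by auto
qed

lemma one_full:
  assumes c: "conf a b c a1 a2 b1 b2 c1 c2" and b: "B a1 = B b1" "B a1 = B c1"
    and np: "B a2 \<noteq> B b2" "B b2 \<noteq> B c2" "B a2 \<noteq> B c2"
  shows False
proof -
  note d = confD[OF c]
  have np': "B x \<noteq> B y" if "x \<in> {a1, b1, c1}" "y \<in> {a2, b2, c2}" for x y
  proof -
    have "B x = B a1" "B x = B b1" "B x = B c1" using that(1) b by auto
    then show ?thesis using that(2) d(19-21) by auto
  qed
  consider "outer a2 b2" | "outer b2 c2" | "outer a2 c2"
    using conf_transversal[OF c, of a2 b2 c2] E_outer[OF _ np(1)] E_outer[OF _ np(2)] E_outer[OF _ np(3)] by blast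
  then show False
  proof cases
    case 1
    show False by (rule one_full_core[OF c 1 np']) (use np in simp_all)
  next
    case 2
    show False by (rule one_full_core[OF conf_rot[OF c] 2 np']) (use np np[symmetric] in auto)
  next
    case 3
    have "conf a c b a1 a2 c1 c2 b1 b2" using conf_swap[OF conf_rot[OF conf_rot[OF c]]] .
    then show False by (rule one_full_core[OF _ 3 np']) (use np np[symmetric] in auto)
  qed
qed

lemma full_iff: "conf a b c a1 a2 b1 b2 c1 c2 \<Longrightarrow> B b1 = B a1 \<Longrightarrow> B c1 = B a1 \<Longrightarrow> full a a1 \<and> full b b1 \<and> full c c1"
proof -
  assume c: "conf a b c a1 a2 b1 b2 c1 c2" and b: "B b1 = B a1" "B c1 = B a1"
  note d = confD[OF c]
  have "\<exists>y. outer v y \<and> B y = B a1" if "v \<in> {a, b, c}" for v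
    using that d(1,3,5) b by blast
  then show ?thesis using d b by (simp add: full_def)
qed

lemma closing_conf:
  assumes c: "conf a b c a1 a2 b1 b2 c1 c2" and cl: "closing c x"
  shows "outer a1 x \<or> outer a2 x \<or> outer b1 x \<or> outer b2 x"
proof -
  note d = confD[OF c]
  obtain y z where y: "outer x y" "outer y z" "z \<in> B c" "z \<noteq> c" using cl by (auto simp: closing_def)
  have "z = a \<or> z = b" using y(3,4) d(7,9) by simp
  then have "y = a1 \<or> y = a2 \<or> y = b1 \<or> y = b2" using outer_sym[OF y(2)] d(23,24) by blast
  then show ?thesis using outer_sym[OF y(1)] by blast
qed

lemma closing_confI:
  assumes c: "conf a b c a1 a2 b1 b2 c1 c2"
  shows "outer x b1 \<or> outer x b2 \<or> outer x c1 \<or> outer x c2 \<Longrightarrow> closing a x"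
  using confD[OF c] outer_sym unfolding closing_def by (metis insertCI)

text \<open>Every triangle is joined to three other triangles by two edges each. The last two edges between the
  neighbouring blocks form, with the third vertices of these blocks, a triangle of outer edges.\<close>

lemma all_paired_core:
  assumes c: "conf a b c a1 a2 b1 b2 c1 c2"
    and m: "B a1 = B b2" "B b1 = B c2" "B c1 = B a2" and o: "outer a1 b1"
    and ap: "\<And>v x. outer v x \<Longrightarrow> paired v x"
  shows False
proof -
  note d = confD[OF c]
  have V: "a \<in> V" "b \<in> V" "c \<in> V" "a1 \<in> V" "b1 \<in> V" "c1 \<in> V"
    using outer_V[OF d(1)] outer_V[OF d(3)] outer_V[OF d(5)] by simp_all
  note ds = conf_distinct[OF c]
  have ne: "B a1 \<noteq> B b1" "B b1 \<noteq> B c1" "B a1 \<noteq> B c1" using d(19-21) m by simp_all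
  have nT: "B a1 \<noteq> B a" "B b1 \<noteq> B a" "B c1 \<noteq> B a" by (rule d)+
  have oa1: "x = a \<or> x = b1" if "outer a1 x" for x
    using outer_deg[OF outer_sym[OF d(1)] o _ that] ds by auto
  have ob1: "x = b \<or> x = a1" if "outer b1 x" for x
    using outer_deg[OF outer_sym[OF d(3)] outer_sym[OF o] _ that] ds by auto
  have ne2: "B a2 \<noteq> B b2" "B b2 \<noteq> B c2" "B a2 \<noteq> B c2" using ne m by simp_all
  consider "outer a2 b2" | "outer b2 c2" | "outer a2 c2"
    using conf_transversal[OF c, of a2 b2 c2] E_outer[OF _ ne2(1)] E_outer[OF _ ne2(2)] E_outer[OF _ ne2(3)] by blast
  then show False
  proof cases
    case 1
    \<comment> \<open>Both walks from \<open>a\<close> return to its block, so the same holds at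
      \<open>c\<close>; but \<open>a1\<close>, \<open>a2\<close>, \<open>b1\<close>,
      \<open>b2\<close> have no outer edge left for \<open>c1\<close>.\<close>
    have "closing a a1" "closing a a2" using closing_confI[OF c] o 1 by blast+
    then have "\<forall>x. outer a x \<longrightarrow> closing a x" using d(23) by blast
    then have "closing c c1" using transport_closing[OF _ V(1) V(3)] d(5) by blast
    then have *: "outer a1 c1 \<or> outer a2 c1 \<or> outer b1 c1 \<or> outer b2 c1" by (rule closing_conf[OF c])
    have "x = a \<or> x = b2" if "outer a2 x" for x
      using outer_deg[OF outer_sym[OF d(2)] 1 _ that] ds by auto
    moreover have "x = b \<or> x = a2" if "outer b2 x" for x
      using outer_deg[OF outer_sym[OF d(4)] outer_sym[OF 1] _ that] ds by auto
    ultimately show False using * oa1[of c1] ob1[of c1] ds by auto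
  next
    case 2
    \<comment> \<open>Now \<open>b\<close> is closing on both sides, hence so is \<open>a\<close>;
      yet no outer neighbour of \<open>b\<close> or \<open>c\<close> can be adjacent to
      \<open>a2\<close>.\<close>
    have "closing b b1" "closing b b2" using closing_confI[OF conf_rot[OF c]] outer_sym[OF o] 2 by blast+
    then have "\<forall>x. outer b x \<longrightarrow> closing b x" using d(24) by blast
    then have "closing a a2" using transport_closing[OF _ V(2) V(1)] d(2) by blast
    then have *: "outer b1 a2 \<or> outer b2 a2 \<or> outer c1 a2 \<or> outer c2 a2"
      by (rule closing_conf[OF conf_rot[OF c]])
    have "x = b \<or> x = c2" if "outer b2 x" for x
      using outer_deg[OF outer_sym[OF d(4)] 2 _ that] ds by auto
    moreover have "x = c \<or> x = b2" if "outer c2 x" for x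
      using outer_deg[OF outer_sym[OF d(6)] outer_sym[OF 2] _ that] ds by auto
    moreover have "\<not> outer c1 a2" using m(3) outer_B by blast
    ultimately show False using * ob1[of a2] ds by auto
  next
    case 3
    have oa2: "x = a \<or> x = c2" if "outer a2 x" for x
      using outer_deg[OF outer_sym[OF d(2)] 3 _ that] ds by auto
    have oc2: "x = c \<or> x = a2" if "outer c2 x" for x
      using outer_deg[OF outer_sym[OF d(6)] outer_sym[OF 3] _ that] ds by auto
    \<comment> \<open>In this pattern, closing at \<open>b\<close> leaves only the edge
      \<open>b2 c1\<close>, so the six outer neighbours are matched by \<open>a1 b1\<close>,
      \<open>b2 c1\<close> and \<open>c2 a2\<close>.\<close>
    have "closing a a1" "closing a a2" using closing_confI[OF c] o 3 by blast+
    then have "\<forall>x. outer a x \<longrightarrow> closing a x" using d(23) by blast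
    then have "closing b b2" using transport_closing[OF _ V(1) V(2)] d(4) by blast
    then have "outer c1 b2 \<or> outer c2 b2 \<or> outer a1 b2 \<or> outer a2 b2"
      by (rule closing_conf[OF conf_rot[OF conf_rot[OF c]]])
    then have "outer c1 b2" using oa1[of b2] oa2[of b2] oc2[of b2] ds by auto
    then have o3: "outer b2 c1" by (rule outer_sym)
    have ob2: "x = b \<or> x = c1" if "outer b2 x" for x
      using outer_deg[OF outer_sym[OF d(4)] o3 _ that] ds by auto
    have oc1: "x = c \<or> x = b2" if "outer c1 x" for x
      using outer_deg[OF outer_sym[OF d(5)] outer_sym[OF o3] _ that] ds by auto
    \<comment> \<open>For each of the three edges, \<open>paired\<close> supplies another edge
      between the same two blocks; it can only join their third vertices.\<close>
    obtain p y where p: "p \<in> B a1" "p \<noteq> a1" "outer p y" "B y = B b1" using ap[OF o] by (auto simp: paired_def)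
    have Bp: "B p = B a1" using B_eq[OF V(4) p(1)] .
    have "p \<noteq> b2" using ob2[of y] p(3,4) d(8) nT ne by auto
    have Bne: "B b \<noteq> B a1" "B c \<noteq> B a1" "B c \<noteq> B b1" "B a2 \<noteq> B a1" "B b2 \<noteq> B b1" using d(8,9) nT ne m by simp_all
    have "p \<noteq> b" "p \<noteq> c" "p \<noteq> a2" using Bp Bne by auto
    then have y: "y \<noteq> b1" "y \<noteq> c2"
      using ob1[of p] oc2[of p] outer_sym[OF p(3)] p(2) by auto
    obtain q z where q: "q \<in> B b2" "q \<noteq> b2" "outer q z" "B z = B c1" using ap[OF o3] by (auto simp: paired_def)
    have "q \<noteq> a1" using oa1[of z] q(3,4) nT ne by auto
    have "q = p"
      using B_third[OF V(4) B_props(3)[OF V(4)], of b2 q p] q(1,2) p(1,2) m(1) \<open>q \<noteq> a1\<close> \<open>p \<noteq> b2\<close>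
        B_props(3)[OF outer_V(2)[OF d(4)]] ds by auto
    have z: "z \<noteq> c1" "z \<noteq> a2"
    proof -
      have "p \<noteq> a" using Bp nT(1) by metis
      moreover have "p \<noteq> c2" using Bp ne(1) m(2) by metis
      ultimately have "q \<noteq> c" "q \<noteq> b2" "q \<noteq> a" "q \<noteq> c2"
        using \<open>q = p\<close> \<open>p \<noteq> c\<close> \<open>p \<noteq> b2\<close> by simp_all
      then show "z \<noteq> c1" "z \<noteq> a2" using oc1[of q] oa2[of q] outer_sym[OF q(3)] by auto
    qed
    obtain r z' where r: "r \<in> B c2" "r \<noteq> c2" "outer r z'" "B z' = B a2"
      using ap[OF outer_sym[OF 3]] by (auto simp: paired_def)
    have Br: "B r = B b1" using B_eq[OF outer_V(2)[OF d(6)] r(1)] m by simp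
    have "r \<noteq> b1" using ob1[of z'] r(3,4) d(8) nT ne m by auto
    have yV: "y \<in> V" "z \<in> V" "z' \<in> V" using outer_V(2) p(3) q(3) r(3) by blast+
    have "r = y"
      using B_third[OF V(5) B_props(3)[OF V(5)], of c2 r y] r(1,2) m(2) \<open>r \<noteq> b1\<close> y p(4) B_props(3)[OF yV(1)]
        B_props(3)[OF outer_V(2)[OF d(6)]] ds by auto
    have z': "z' \<noteq> c1" "z' \<noteq> a2"
    proof -
      have "r \<noteq> c" using Br Bne(3) by metis
      moreover have "r \<noteq> b2" using Br Bne(5) by metis
      moreover have "r \<noteq> a" using Br nT(2) by metis
      ultimately show "z' \<noteq> c1" "z' \<noteq> a2" using oc1[of r] oa2[of r] outer_sym[OF r(3)] r(2) by auto
    qed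
    have "z' = z"
      using B_third[OF V(6) B_props(3)[OF V(6)], of a2 z' z] z z' r(4) q(4) m(3) B_props(3)[OF yV(2)] B_props(3)[OF yV(3)]
        B_props(3)[OF outer_V(2)[OF d(2)]] ds by auto
    then show False
      using outer_no_triangle[OF p(3), of z] q(3) outer_E[OF r(3)] \<open>q = p\<close> \<open>r = y\<close> by simp
  qed
qed

lemma all_paired:
  assumes c: "conf a b c a1 a2 b1 b2 c1 c2"
    and m: "B a1 = B b2" "B b1 = B c2" "B c1 = B a2"
    and ap: "\<And>v x. outer v x \<Longrightarrow> paired v x"
  shows False
proof -
  note d = confD[OF c]
  have ne: "B a1 \<noteq> B b1" "B b1 \<noteq> B c1" "B a1 \<noteq> B c1" using d(19-21) m by simp_all
  consider "outer a1 b1" | "outer b1 c1" | "outer c1 a1"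
    using conf_transversal[OF c, of a1 b1 c1] E_outer[OF _ ne(1)] E_outer[OF _ ne(2)]
      outer_sym[OF E_outer[OF _ ne(3)]] by blast
  then show False
  proof cases
    case 1
    show False by (rule all_paired_core[OF c m 1 ap])
  next
    case 2
    show False by (rule all_paired_core[OF conf_rot[OF c] m(2) m(3) m(1) 2 ap])
  next
    case 3
    show False by (rule all_paired_core[OF conf_rot[OF conf_rot[OF c]] m(3) m(1) m(2) 3 ap])
  qed
qed

lemma paired_conf:
  assumes c: "conf a b c a1 a2 b1 b2 c1 c2" and p: "paired c x"
  shows "B x \<in> {B a1, B a2, B b1, B b2}"
proof -
  note d = confD[OF c]
  obtain e y where e: "e \<in> B c" "e \<noteq> c" "outer e y" "B y = B x" using p by (auto simp: paired_def)
  then have "e = a \<or> e = b" using d(7,9) by simp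
  then have "y = a1 \<or> y = a2 \<or> y = b1 \<or> y = b2" using e(3) d(23,24) by blast
  then show ?thesis using e(4) by auto
qed

lemma paired_confI:
  assumes c: "conf a b c a1 a2 b1 b2 c1 c2"
  shows "outer a x \<Longrightarrow> B x \<in> {B b1, B b2, B c1, B c2} \<Longrightarrow> paired a x"
  using confD(3-12)[OF c] unfolding paired_def by (metis insertCI insertE empty_iff)

text \<open>\<open>a2\<close> is a neighbour that is paired but not full, so by transitivity
  \<open>c\<close> has one too, necessarily \<open>c2\<close>. Then \<open>c2\<close> lies in the
  common block of \<open>a2\<close> and \<open>b2\<close>, which makes that adjacency full after
  all.\<close>

lemma one_full_pair:
  assumes c: "conf a b c a1 a2 b1 b2 c1 c2" and b: "B a1 = B b1" "B a1 = B c1"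
    and nf: "\<not> full a a2" "\<not> full c c2" and m: "B a2 = B b2"
  shows False
proof -
  note d = confD[OF c]
  have V: "a \<in> V" "c \<in> V" using outer_V[OF d(1)] outer_V[OF d(5)] by simp_all
  have "paired a a2" using paired_confI[OF c d(2)] m by simp
  then have "\<exists>x. outer c x \<and> \<not> full c x \<and> paired c x"
    using transport_nb[of "\<lambda>v x. \<not> full v x \<and> paired v x" c] nf(1) d(2) V full_aut paired_aut by blast
  then obtain x where x: "outer c x" "\<not> full c x" "paired c x" by blast
  have "full c c1" using full_iff[OF c] b by simp
  then have "x = c2" using x d(25) by blast
  then have "B c2 \<in> {B a1, B a2, B b1, B b2}" using paired_conf[OF c x(3)] by simp
  then have "B c2 = B a2" using d b m by auto
  have "conf a b c a2 a1 b2 b1 c2 c1" using c by (auto simp: conf_def)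
  then show False using full_iff m \<open>B c2 = B a2\<close> nf(1) by metis
qed

text \<open>Multiplicities are invariant, so every vertex sees the same mixture. One full and one
  non-full edge at each vertex contradict \<open>one_full\<close>. Without full edges, exactly one
  paired edge at each vertex would group the three vertices of a block into pairs; two paired edges
  are refuted by \<open>all_paired\<close>, and none by \<open>no_pairs\<close>.\<close>

lemma outer_full: "outer v x \<Longrightarrow> full v x"
proof (rule ccontr)
  assume vx: "outer v x" "\<not> full v x"
  have nf: "\<exists>x. outer a x \<and> \<not> full a x" if "a \<in> V" for a
    using transport_nb[of "\<lambda>v x. \<not> full v x" a] vx that full_aut by blast
  have vV: "v \<in> V" using vx outer_V by blast
  show False
  proof (cases "\<exists>u y. full u y")
    case True
    then have "\<exists>y. outer v y \<and> full v y"
      using transport_nb[of full v] full_aut vV by (auto simp: full_def)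
    then obtain y where y: "outer v y" "full v y" by blast
    obtain b where b: "b \<in> B v" "b \<noteq> v"
      using ex_mate[OF vV] by blast
    obtain b1 where b1: "outer b b1" "B b1 = B y" using y(2) b(1) by (auto simp: full_def)
    obtain c x2 b2 c1' c2' where c: "conf v b c y x2 b1 b2 c1' c2'" using conf_ex[OF y(1) b b1(1)] by blast
    note d = confD[OF c]
    obtain c1 where c1: "outer c c1" "B c1 = B y" using y(2) d(7) by (auto simp: full_def)
    have "\<exists>c2. conf v b c y x2 b1 b2 c1 c2"
      using c c1(1) d(25)[OF c1(1)] by (auto simp: conf_def)
    then obtain c2 where c: "conf v b c y x2 b1 b2 c1 c2" by blast
    note d = confD[OF c]
    have V: "b \<in> V" "c \<in> V" using outer_V d by blast+
    have fu: "full v y" "full b b1" "full c c1" using full_iff[OF c b1(2) c1(2)] by simp_all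
    have n: "\<not> full v x2" "\<not> full b b2" "\<not> full c c2"
      using nf[OF vV] nf[OF V(1)] nf[OF V(2)] fu d(23-25) by blast+
    have bb: "B y = B b1" "B y = B c1" "B b1 = B c1" "B b1 = B y" "B c1 = B y" using b1 c1 by simp_all
    have "B x2 \<noteq> B b2" using one_full_pair[OF c bb(1,2) n(1,3)] by blast
    moreover have "B b2 \<noteq> B c2" using one_full_pair[OF conf_rot[OF c] bb(3,4) n(2,1)] by blast
    moreover have "B c2 \<noteq> B x2"
      using one_full_pair[OF conf_rot[OF conf_rot[OF c]] bb(5) bb(3)[symmetric] n(3,2)] by blast
    ultimately show False using one_full[OF c bb(1,2)] by metis
  next
    case False
    show False
    proof (cases "\<exists>u y. paired u y")
      case True
      have pa: "\<exists>y. outer a y \<and> paired a y" if "a \<in> V" for a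
        using transport_nb[of paired a] that paired_aut True by (auto simp: paired_def)
      obtain y where y: "outer v y" "paired v y" using pa[OF vV] by blast
      then obtain b b1 where b: "b \<in> B v" "b \<noteq> v" "outer b b1" "B b1 = B y" by (auto simp: paired_def)
      obtain c y2 b2 c1 c2 where c: "conf v b c y y2 b1 b2 c1 c2" using conf_ex[OF y(1) b(1-3)] by blast
      note d = confD[OF c]
      have V: "b \<in> V" "c \<in> V" using outer_V d by blast+
      have not_y: "B z \<noteq> B y" if "outer c z" for z
      proof
        assume z: "B z = B y"
        have "\<exists>c2. conf v b c y y2 b1 b2 z c2"
          using c that d(25)[OF that] by (auto simp: conf_def)
        then show False using full_iff b(4) z False by metis
      qed
      have inC: "B z = B y2 \<or> B z = B b2" if "paired c z" "outer c z" for z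
        using paired_conf[OF c that(1)] not_y[OF that(2)] b(4) by auto
      show False
      proof (cases "\<exists>u z. outer u z \<and> \<not> paired u z")
        case True
        have np: "\<exists>z. outer a z \<and> \<not> paired a z" if "a \<in> V" for a
          using transport_nb[of "\<lambda>u z. \<not> paired u z" a] that paired_aut True by blast
        have py: "paired v y" "paired b b1"
          using y(2) paired_confI[OF conf_swap[OF c] d(3)] b(4) by simp_all
        \<comment> \<open>The paired neighbour of \<open>c\<close> lies in the block of
          \<open>y2\<close> or of \<open>b2\<close>. This makes both outer neighbours of
          \<open>v\<close>, or both of \<open>b\<close>, paired.\<close>
        obtain z where z: "outer c z" "paired c z" using pa[OF V(2)] by blast
        then have zc: "B z \<in> {B c1, B c2}" using d(25) by blast
        consider "B z = B y2" | "B z = B b2" using inC z by blast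
        then show False
        proof cases
          case 1
          then have "paired v y2" using paired_confI[OF c d(2)] zc by auto
          then show False using np[OF vV] d(23) py by blast
        next
          case 2
          then have "paired b b2" using paired_confI[OF conf_swap[OF c] d(4)] zc by auto
          then show False using np[OF V(1)] d(24) py by blast
        qed
      next
        case nonp: False
        have ap: "paired u z" if "outer u z" for u z using nonp that by blast
        have c': "conf v b c y y2 b2 b1 c1 c2" "conf v b c y y2 b2 b1 c2 c1" using c by (auto simp: conf_def)
        consider "B c1 = B y2" "B c2 = B b2" | "B c2 = B y2" "B c1 = B b2"
          using inC[OF ap[OF d(5)] d(5)] inC[OF ap[OF d(6)] d(6)] d(21) by metis
        then show False
        proof cases
          case 1
          show False by (rule all_paired[OF c'(1) _ _ _ ap]) (use 1 b(4) in simp_all)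
        next
          case 2
          show False by (rule all_paired[OF c'(2) _ _ _ ap]) (use 2 b(4) in simp_all)
        qed
      qed
    next
      case nop: False
      obtain b where b: "b \<in> B v" "b \<noteq> v"
        using ex_mate[OF vV] by blast
      obtain b1 where "outer b b1" using outer_two[OF B_mem[OF vV b(1)]] by blast
      then obtain c x2 b2 c1 c2 where c: "conf v b c x x2 b1 b2 c1 c2" using conf_ex[OF vx(1) b] by blast
      note d = confD[OF c]
      show False
      proof (rule no_pairs[OF c])
        fix p q assume "(p, q) \<in> {x, x2} \<times> {b1, b2} \<union> {b1, b2} \<times> {c1, c2} \<union> {x, x2} \<times> {c1, c2}"
        then have "outer v p \<and> B q \<in> {B b1, B b2, B c1, B c2} \<or> outer b p \<and> B q \<in> {B c1, B c2}" using d(1-6) by auto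
        then show "B p \<noteq> B q"
          using paired_confI[OF c, of p] paired_confI[OF conf_rot[OF c], of p] nop by auto
      qed
    qed
  qed
qed

end

end

section \<open>Cycles of triangles\<close>

text \<open>On a cycle of length at least 3 the predecessor and the successor of a point
  differ.\<close>

lemma mod_add_2_neq: "(k + 2) mod n \<noteq> k mod n" if "n \<ge> 3" for k n :: nat
proof
  assume "(k + 2) mod n = k mod n"
  then have "n dvd 2" using mod_eq_dvd_iff_nat[of k "k + 2" n] by simp
  then show False using that by (auto dest: dvd_imp_le)
qed

context unique_clique_graph
begin

context
  assumes w: "card C = 3"
begin

text \<open>By \<open>outer_full\<close> every block adjacent to \<open>B v\<close> is reached from
  \<open>v\<close> itself, and the two outer neighbours of \<open>v\<close> lie in different
  blocks.\<close>

lemma card_neighbour_blocks: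
  assumes v: "v \<in> V"
  shows "card {Y. R (B v) Y} = 2"
proof -
  obtain x y where xy: "x \<noteq> y" "{u. outer v u} = {x, y}" using outer_two[OF w v] by blast
  have o: "outer v x" "outer v y" using xy(2) by blast+
  have "{Y. R (B v) Y} = {B x, B y}"
  proof (intro equalityI subsetI)
    fix Y assume "Y \<in> {Y. R (B v) Y}"
    then obtain p q where pq: "outer p q" "B v = B p" "Y = B q" by (auto simp: R_def)
    then obtain z where z: "outer v z" "B z = B q"
      using outer_full[OF w pq(1)] B_props(3)[OF v] by (auto simp: full_def)
    then have "z = x \<or> z = y" using xy(2) by blast
    then show "Y \<in> {B x, B y}" using z(2) pq(3) by auto
  next
    fix Y assume "Y \<in> {B x, B y}"
    then show "Y \<in> {Y. R (B v) Y}" using o by (auto simp: R_def)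
  qed
  moreover have "B x \<noteq> B y" using outer_inj[OF w o] xy(1) by blast
  ultimately show ?thesis by simp
qed

text \<open>\<open>S\<close> is a cyclic sequence of blocks, extended periodically.\<close>

context
  fixes n :: nat and S :: "nat \<Rightarrow> 'a set"
  assumes n: "n \<ge> 3"
    and S_block: "\<And>i. S i \<in> B ` V"
    and S_eq: "\<And>i j. S i = S j \<longleftrightarrow> i mod n = j mod n"
    and S_R: "\<And>i. R (S i) (S (Suc i))"
begin

lemma S_V: "u \<in> S i \<Longrightarrow> u \<in> V \<and> B u = S i"
proof -
  assume u: "u \<in> S i"
  obtain v where v: "v \<in> V" "S i = B v" using S_block[of i] by blast
  then show "u \<in> V \<and> B u = S i" using u B_mem[OF v(1)] B_eq[OF v(1)] by simp
qed

lemma mem_S: "v \<in> V \<Longrightarrow> B v = S i \<Longrightarrow> v \<in> S i"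
  using B_props(3) by metis

lemma S_unique: "u \<in> S i \<Longrightarrow> u \<in> S j \<Longrightarrow> i mod n = j mod n"
  using S_V S_eq by metis

lemma S_adj: "x \<in> S i \<Longrightarrow> y \<in> S i \<Longrightarrow> x \<noteq> y \<Longrightarrow> E x y"
  using S_V[of x i] S_V[of y i] B_adj[of x x y] mem_B_iff[of y x] B_props(3)[of x] by simp

lemma link:
  assumes u: "u \<in> S i" and R: "R (S i) (S j)"
  shows "\<exists>x. x \<in> S j \<and> outer u x"
proof -
  obtain p q where pq: "outer p q" "S i = B p" "S j = B q" using R by (auto simp: R_def)
  then obtain x where x: "outer u x" "B x = B q"
    using outer_full[OF w pq(1)] u by (auto simp: full_def)
  then show ?thesis using mem_S[OF outer_V(2)[OF x(1)], of j] pq(3) by auto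
qed

text \<open>\<open>i + n - 1\<close> represents the index before \<open>i\<close>; adding
  \<open>n\<close> avoids truncated subtraction at 0.\<close>

lemma S_pred: "R (S i) (S (i + n - 1))"
proof -
  have "S (Suc (i + n - 1)) = S i" using n by (simp add: S_eq)
  then show ?thesis using R_sym[OF S_R[of "i + n - 1"]] by simp
qed

text \<open>\<open>u\<close> has an outer neighbour in the next block and one in the previous block.
  They differ since \<open>n \<ge> 3\<close>, so they are the only two.\<close>

lemma outer_S:
  assumes u: "u \<in> S i" and x: "outer u x"
  shows "x \<in> S (Suc i) \<or> x \<in> S (i + n - 1)"
proof -
  obtain p where p: "p \<in> S (Suc i)" "outer u p" using link[OF u S_R] by blast
  obtain q where q: "q \<in> S (i + n - 1)" "outer u q" using link[OF u S_pred] by blast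
  have "p \<noteq> q"
  proof
    assume "p = q"
    then have "Suc i mod n = (i + n - 1) mod n" using S_unique p q by blast
    moreover have "i + n - 1 + 2 = Suc i + n" using n by simp
    then have "(i + n - 1 + 2) mod n = Suc i mod n" by (simp only: mod_add_self2)
    ultimately show False using mod_add_2_neq[OF n, of "i + n - 1"] by simp
  qed
  then show ?thesis using outer_deg[OF w p(2) q(2) _ x] p q by blast
qed

text \<open>Path lifting: the walk from \<open>u\<close> that climbs the cycle of blocks along outer
  edges. For \<open>u\<close> in \<open>S 0\<close> the vertex chosen by \<open>SOME\<close> is
  unique by \<open>outer_unique_S\<close>.\<close>

primrec lift :: "'a \<Rightarrow> nat \<Rightarrow> 'a" where
  "lift u 0 = u"
| "lift u (Suc i) = (SOME x. x \<in> S (Suc i) \<and> outer (lift u i) x)"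

lemma lift_step:
  assumes "lift u i \<in> S i"
  shows "lift u (Suc i) \<in> S (Suc i)" "outer (lift u i) (lift u (Suc i))"
proof -
  have "lift u (Suc i) \<in> S (Suc i) \<and> outer (lift u i) (lift u (Suc i))"
    unfolding lift.simps(2) by (rule someI_ex) (rule link[OF assms S_R])
  then show "lift u (Suc i) \<in> S (Suc i)" "outer (lift u i) (lift u (Suc i))" by blast+
qed

lemma lift_S: "u \<in> S 0 \<Longrightarrow> lift u i \<in> S i"
  by (induction i) (auto intro: lift_step(1) simp del: lift.simps(2))

lemma lift_outer: "u \<in> S 0 \<Longrightarrow> outer (lift u i) (lift u (Suc i))"
  by (rule lift_step(2)[OF lift_S])

lemma lift_inj: "u \<in> S 0 \<Longrightarrow> v \<in> S 0 \<Longrightarrow> lift u i = lift v i \<Longrightarrow> u = v"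
proof (induction i)
  case (Suc i)
  have "outer (lift u i) (lift u (Suc i))" "outer (lift v i) (lift u (Suc i))"
    using lift_outer[OF Suc.prems(1), of i] lift_outer[OF Suc.prems(2), of i] Suc.prems(3) by simp_all
  moreover have "B (lift u i) = B (lift v i)"
    using S_V[OF lift_S[OF Suc.prems(1), of i]] S_V[OF lift_S[OF Suc.prems(2), of i]] by simp
  ultimately have "lift u i = lift v i" using outer_inj'[OF w] by blast
  then show ?case using Suc.IH Suc.prems by blast
qed simp

lemma outer_unique_S: "outer u x \<Longrightarrow> outer u y \<Longrightarrow> x \<in> S i \<Longrightarrow> y \<in> S i \<Longrightarrow> x = y"
  using outer_inj[OF w] S_V by metis

text \<open>A vertex has only one outer neighbour in the next block, so a climbing walk is
  determined by its start.\<close>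

lemma lift_unique:
  assumes "g 0 \<in> S 0" "\<And>i. i < m \<Longrightarrow> g (Suc i) \<in> S (Suc i) \<and> outer (g i) (g (Suc i))"
  shows "g m = lift (g 0) m"
  using assms(2)
proof (induction m)
  case (Suc m)
  have "g m = lift (g 0) m" using Suc by simp
  then have "outer (g m) (lift (g 0) (Suc m))" using lift_outer[OF assms(1), of m] by simp
  then show ?case
    using outer_unique_S[of "g m" "g (Suc m)" "lift (g 0) (Suc m)" "Suc m"] Suc.prems[of m]
      lift_S[OF assms(1), of "Suc m"] by blast
qed simp

definition monodromy :: "'a \<Rightarrow> 'a" where "monodromy u = lift u n"

lemma S_add [simp]: "S (i + n) = S i"
  by (simp add: S_eq)

lemma monodromy_S: "u \<in> S 0 \<Longrightarrow> monodromy u \<in> S 0"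
  using lift_S[of u n] S_eq[of n 0] by (simp add: monodromy_def)

lemma monodromy_inj: "u \<in> S 0 \<Longrightarrow> v \<in> S 0 \<Longrightarrow> monodromy u = monodromy v \<Longrightarrow> u = v"
  unfolding monodromy_def by (rule lift_inj)

text \<open>After a full turn the walk climbs the same blocks again, now starting from
  \<open>monodromy u\<close>, so \<open>lift_unique\<close> applies to the shifted walk.\<close>

lemma lift_add:
  assumes u: "u \<in> S 0"
  shows "lift u (i + n) = lift (monodromy u) i"
proof -
  let ?g = "\<lambda>i. lift u (i + n)"
  have "?g i = lift (?g 0) i"
  proof (rule lift_unique)
    show "lift u (0 + n) \<in> S 0" using monodromy_S[OF u] by (simp add: monodromy_def)
    show "lift u (Suc i + n) \<in> S (Suc i) \<and> outer (lift u (i + n)) (lift u (Suc i + n))" for i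
      using lift_S[OF u, of "Suc i + n"] lift_outer[OF u, of "i + n"] S_add[of "Suc i"]
      by (simp del: lift.simps(2))
  qed
  then show ?thesis by (simp add: monodromy_def)
qed

text \<open>An automorphism moves the closed walk through \<open>u\<close> to a closed walk through \<open>v\<close>, which
  traverses the cycle of blocks in one of the two directions.\<close>

lemma monodromy_fix:
  assumes u: "u \<in> S 0" "monodromy u = u" and v: "v \<in> S 0"
  shows "monodromy v = v"
proof -
  obtain h where h: "h \<in> auts" "h u = v" using ex_aut S_V u(1) v by blast
  define g where "g i = h (lift u i)" for i
  have g0: "g 0 = v" "g n = v" using h(2) u(2) by (simp_all add: g_def monodromy_def)
  have step: "outer (g i) (g (Suc i))" for i
    unfolding g_def using outer_aut[OF h(1)] lift_outer[OF u(1)] by blast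
  \<comment> \<open>The moved walk never turns back, since two steps of a lift end in another block.
    Hence its first step decides the direction for good.\<close>
  have nb: "g (Suc (Suc i)) \<noteq> g i" for i
  proof
    assume "g (Suc (Suc i)) = g i"
    then have "lift u (Suc (Suc i)) = lift u i" using autD(2)[OF h(1)] by (simp add: g_def del: lift.simps(2))
    then have "Suc (Suc i) mod n = i mod n" using S_unique lift_S[OF u(1)] by metis
    then show False using mod_add_2_neq[OF n, of i] by simp
  qed
  have g1: "g 1 \<in> S 1 \<or> g 1 \<in> S (n - 1)"
    using outer_S[OF v, of "g 1"] step[of 0] g0 by simp
  then show ?thesis
  proof
    assume 1: "g 1 \<in> S 1"
    have "g i \<in> S i \<and> g (Suc i) \<in> S (Suc i)" for i
    proof (induction i)
      case 0
      then show ?case using 1 g0 v by simp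
    next
      case (Suc i)
      have "g (Suc (Suc i)) \<in> S (Suc (Suc i)) \<or> g (Suc (Suc i)) \<in> S (Suc i + n - 1)"
        using outer_S[OF _ step[of "Suc i"], of "Suc i"] Suc by simp
      moreover have "S (Suc i + n - 1) = S i" using n S_add[of i] by simp
      ultimately show ?case
        using outer_unique_S[OF step[of "Suc i"] outer_sym[OF step[of i]], of i] nb[of i] Suc by auto
    qed
    then have "g n = lift (g 0) n" using step by (intro lift_unique) blast+
    then show ?thesis using g0 by (simp add: monodromy_def)
  next
    assume 1: "g 1 \<in> S (n - 1)"
    have *: "g i \<in> S (n - i) \<and> g (Suc i) \<in> S (n - Suc i)" if "Suc i \<le> n" for i
      using that
    proof (induction i)
      case 0
      then show ?case using 1 g0 v S_eq[of n 0] by simp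
    next
      case (Suc i)
      define j where "j = n - Suc (Suc i)"
      have j: "n - Suc i = Suc j" "n - i = Suc (Suc j)" using Suc.prems by (auto simp: j_def)
      have IH: "g i \<in> S (Suc (Suc j))" "g (Suc i) \<in> S (Suc j)" using Suc j by simp_all
      have "g (Suc (Suc i)) \<in> S (Suc (Suc j)) \<or> g (Suc (Suc i)) \<in> S (Suc j + n - 1)"
        using outer_S[OF IH(2) step[of "Suc i"]] .
      moreover have "S (Suc j + n - 1) = S j" using n S_add[of j] by simp
      moreover have "g (Suc (Suc i)) \<notin> S (Suc (Suc j))"
        using outer_unique_S[OF step[of "Suc i"] outer_sym[OF step[of i]] _ IH(1)] nb[of i] by blast
      ultimately show ?case using IH(2) j j_def by simp
    qed
    \<comment> \<open>When the moved walk descends, its reversal climbs from \<open>v\<close> to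
      \<open>v\<close> and is therefore the lift of \<open>v\<close>.\<close>
    define g' where "g' i = g (n - i)" for i
    have "g' n = lift (g' 0) n"
    proof (rule lift_unique)
      show "g' 0 \<in> S 0" using g0 v by (simp add: g'_def)
      fix i assume i: "i < n"
      define j where "j = n - Suc i"
      have j: "n - i = Suc j" "Suc j \<le> n" "n - j = Suc i" using i by (auto simp: j_def)
      have "g j \<in> S (n - j)" using *[OF j(2)] by blast
      then show "g' (Suc i) \<in> S (Suc i) \<and> outer (g' i) (g' (Suc i))"
        using outer_sym[OF step[of j]] j by (simp add: g'_def j_def[symmetric])
    qed
    then show ?thesis using g0 by (simp add: g'_def monodromy_def)
  qed
qed

section \<open>The two kinds of monodromy\<close>

lemma S0_triple: "\<exists>a b c. S 0 = {a, b, c} \<and> distinct [a, b, c]"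
proof -
  obtain v where v: "v \<in> V" "S 0 = B v" using S_block[of 0] by blast
  then have "card (S 0) = 3" using B_props(2)[OF v(1)] w by simp
  then show ?thesis by (auto simp: card_3_iff)
qed

lemma embeds_prism:
  assumes fix_all: "\<And>u. u \<in> S 0 \<Longrightarrow> monodromy u = u"
  shows "\<exists>f. embeds (cartesian_product (cycle_graph 3) (cycle_graph n)) f"
proof -
  obtain a b c where abc: "S 0 = {a, b, c}" "distinct [a, b, c]" using S0_triple by blast
  define t where "t = nth [a, b, c]"
  have t: "t r \<in> S 0" if "r < 3" for r
  proof -
    have "r = 0 \<or> r = 1 \<or> r = 2" using that by linarith
    then show ?thesis using abc(1) by (elim disjE) (simp_all add: t_def)
  qed
  have t_inj: "r = s" if "t r = t s" "r < 3" "s < 3" for r s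
    using that abc(2) nth_eq_iff_index_eq[OF abc(2), of r s] by (simp add: t_def)
  have "embeds (cartesian_product (cycle_graph 3) (cycle_graph n)) (\<lambda>(r, i). lift (t r) i)"
    unfolding embeds_def
  proof (intro conjI allI impI)
    show "inj_on (\<lambda>(r, i). lift (t r) i) (pverts (cartesian_product (cycle_graph 3) (cycle_graph n)))"
      unfolding prism_verts
    proof (rule inj_onI)
      fix x y assume xy: "x \<in> {..<3::nat} \<times> {..<n}" "y \<in> {..<3::nat} \<times> {..<n}"
        "(case x of (r, i) \<Rightarrow> lift (t r) i) = (case y of (r, i) \<Rightarrow> lift (t r) i)"
      obtain r i s j where rs: "x = (r, i)" "y = (s, j)" by (cases x; cases y)
      have ri: "r < 3" "i < n" "s < 3" "j < n" and eq: "lift (t r) i = lift (t s) j"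
        using xy unfolding rs by simp_all
      have "i mod n = j mod n" using S_unique lift_S t ri eq by metis
      then have "i = j" using ri by simp
      moreover have "r = s"
        using lift_inj[OF t[OF ri(1)] t[OF ri(3)], of i] t_inj[OF _ ri(1,3)] eq \<open>i = j\<close> by simp
      ultimately show "x = y" using rs by simp
    qed
    show "(\<lambda>(r, i). lift (t r) i) ` pverts (cartesian_product (cycle_graph 3) (cycle_graph n)) \<subseteq> V"
      unfolding prism_verts using S_V lift_S t by fastforce
    fix x y assume xy: "(x, y) \<in> parcs (cartesian_product (cycle_graph 3) (cycle_graph n))"
    obtain r i s j where rs: "x = (r, i)" "y = (s, j)" by (cases x; cases y)
    have *: "r < 3" "s < 3" "i < n" "j < n" "(i = j \<and> r \<noteq> s) \<or> (r = s \<and> (j = Suc i mod n \<or> i = Suc j mod n))"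
      using xy unfolding rs prism_arcs[OF n] by simp_all
    \<comment> \<open>The edge from the last layer back to the first exists because the walk from
      \<open>t r\<close> closes after \<open>n\<close> steps.\<close>
    have next_E: "E (lift (t r) i) (lift (t r) (Suc i mod n))" if "i < n" "r < 3" for r i
    proof (cases "Suc i = n")
      case True
      then have "lift (t r) (Suc i) = lift (t r) (Suc i mod n)"
        using fix_all[OF t[OF that(2)]] by (simp add: monodromy_def del: lift.simps(2))
      then show ?thesis using outer_E[OF lift_outer[OF t[OF that(2)], of i]] by simp
    next
      case False
      then have "Suc i mod n = Suc i" using that by simp
      then show ?thesis using outer_E[OF lift_outer[OF t[OF that(2)], of i]] by simp
    qed
    from *(5) consider "i = j" "r \<noteq> s" | "r = s" "j = Suc i mod n" | "r = s" "i = Suc j mod n" by blast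
    then have "E (lift (t r) i) (lift (t s) j)"
    proof cases
      case 1
      have "lift (t r) i \<noteq> lift (t s) i" using lift_inj[OF t t] t_inj * 1 by blast
      then show ?thesis using S_adj[OF lift_S[OF t] lift_S[OF t]] * 1 by blast
    next
      case 2
      then show ?thesis using next_E * by simp
    next
      case 3
      then show ?thesis using E_sym[OF next_E[of j r]] * by simp
    qed
    then show "E (case x of (r, i) \<Rightarrow> lift (t r) i) (case y of (r, i) \<Rightarrow> lift (t r) i)" using rs by simp
  qed
  then show ?thesis by blast
qed

text \<open>A permutation of three points without fixed points is a 3-cycle. The walk from
  \<open>a\<close> therefore closes only after three turns and visits all 3n vertices of the blocks.
  Numbering them along the walk, consecutive numbers are joined by outer edges and numbers that
  differ by \<open>n\<close> modulo 3n by edges of a block.\<close>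

lemma embeds_cayley_Z3k:
  assumes fix_none: "\<And>u. u \<in> S 0 \<Longrightarrow> monodromy u \<noteq> u"
  shows "\<exists>f. embeds (cayley_Z3k n) f"
proof -
  have n1: "n \<ge> 1" using n by simp
  obtain a where a: "a \<in> S 0" using S0_triple by blast
  define b c where "b = monodromy a" and "c = monodromy b"
  have bc: "b \<in> S 0" "c \<in> S 0" using monodromy_S a by (simp_all add: b_def c_def)
  have ne: "a \<noteq> b" "b \<noteq> c" using fix_none[OF a] fix_none[OF bc(1)] by (auto simp: b_def c_def)
  have third: "x = y" if "x \<in> S 0" "y \<in> S 0" "p \<in> S 0" "q \<in> S 0" "p \<noteq> q" "x \<notin> {p, q}" "y \<notin> {p, q}" for x y p q
  proof -
    have "B a = S 0" "a \<in> V" using S_V[OF a] by simp_all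
    then show ?thesis using B_third[OF w, of a p q x y] that by simp
  qed
  \<comment> \<open>If the monodromy exchanged \<open>a\<close> and \<open>b\<close>, it would fix
    the third vertex.\<close>
  have "c \<noteq> a"
  proof
    assume ca: "c = a"
    obtain d where d: "d \<in> S 0" "d \<notin> {a, b}"
      using S0_triple by (metis distinct_length_2_or_more insertCI insertE empty_iff)
    have "monodromy d \<noteq> b" "monodromy d \<noteq> a"
      using monodromy_inj[OF d(1) a] monodromy_inj[OF d(1) bc(1)] d(2) ca by (auto simp: b_def c_def)
    then have "monodromy d = d"
      using third[OF monodromy_S[OF d(1)] d(1) a bc(1) ne(1)] d(2) by blast
    then show False using fix_none d(1) by blast
  qed
  have "monodromy c \<noteq> b" "monodromy c \<noteq> c"
    using monodromy_inj[OF bc(2) a] \<open>c \<noteq> a\<close> fix_none[OF bc(2)] by (auto simp: b_def)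
  then have mc: "monodromy c = a"
    using third[OF monodromy_S[OF bc(2)] a bc ne(2)] ne(1) \<open>c \<noteq> a\<close> by blast
  define g where "g = lift a"
  have g_n: "g (i + n) = lift b i" "g (i + 2 * n) = lift c i" "g (i + 3 * n) = g i" for i
  proof -
    show 1: "g (i + n) = lift b i" for i by (simp add: g_def lift_add[OF a] b_def)
    have 2: "g (i + 2 * n) = lift c i" for i
      using 1[of "i + n"] lift_add[OF bc(1), of i] by (simp add: c_def add.assoc mult_2)
    show "g (i + 2 * n) = lift c i" by (rule 2)
    have "i + 3 * n = (i + n) + 2 * n" by simp
    then show "g (i + 3 * n) = g i"
      using 2[of "i + n"] lift_add[OF bc(2), of i] mc by (simp add: g_def add.commute)
  qed
  have g_mod: "g (i mod (3 * n)) = g i" for i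
  proof -
    have "g (j + k * (3 * n)) = g j" for j k
    proof (induction k)
      case (Suc k)
      have "j + Suc k * (3 * n) = (j + k * (3 * n)) + 3 * n" by simp
      then show ?case using g_n(3)[of "j + k * (3 * n)"] Suc by metis
    qed simp
    from this[of "i mod (3 * n)" "i div (3 * n)"] show ?thesis
      by (simp only: mod_div_mult_eq)
  qed
  have gS: "g i \<in> S i" for i unfolding g_def by (rule lift_S[OF a])
  have g1: "E (g i) (g (i + 1))" for i
    using outer_E[OF lift_outer[OF a, of i]] by (simp add: g_def del: lift.simps(2))
  have lift_ne: "lift a i \<noteq> lift b i" "lift b i \<noteq> lift c i" "lift a i \<noteq> lift c i" for i
    using lift_inj a bc ne \<open>c \<noteq> a\<close> by metis+
  have g_ne: "g i \<noteq> g (i + n)" for i using g_n(1)[of i] lift_ne(1)[of i] by (simp add: g_def)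
  have gn: "E (g i) (g (i + n))" for i
    using S_adj[OF gS[of i] _ g_ne[of i]] gS[of "i + n"] by simp
  define f where "f z = g (nat z)" for z
  have f_mod: "f ((x + int j) mod (3 * int n)) = g (nat x + j)" if "x \<ge> 0" for x j
  proof -
    have "(x + int j) mod (3 * int n) = int ((nat x + j) mod (3 * n))" using that by (simp add: zmod_int)
    then show ?thesis by (simp add: f_def g_mod)
  qed
  have "embeds (cayley_Z3k n) f"
    unfolding embeds_def
  proof (intro conjI allI impI)
    show "f ` pverts (cayley_Z3k n) \<subseteq> V" using gS S_V by (auto simp: f_def)
    show "inj_on f (pverts (cayley_Z3k n))"
      unfolding cayley_Z3k_verts[OF n1]
    proof (rule inj_onI)
      fix x y assume xy: "x \<in> {0..<3 * int n}" "y \<in> {0..<3 * int n}" "f x = f y"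
      \<comment> \<open>The quotient counts completed turns and so selects the starting vertex; the
        remainder is the position within the turn.\<close>
      have rep: "g i = lift ([a, b, c] ! (i div n)) (i mod n)" if "i < 3 * n" for i
      proof -
        have "i div n < 3" using that n by (simp add: div_less_iff_less_mult)
        then have "i div n = 0 \<or> i div n = 1 \<or> i div n = 2" by linarith
        moreover have "i = i mod n + i div n * n" by simp
        ultimately show ?thesis
          using g_n(1)[of "i mod n"] g_n(2)[of "i mod n"] by (elim disjE) (simp_all add: g_def)
      qed
      let ?i = "nat x" and ?j = "nat y"
      have lt: "?i < 3 * n" "?j < 3 * n" using xy by auto
      have eq: "g ?i = g ?j" using xy(3) by (simp add: f_def)
      have m: "?i mod n = ?j mod n" using S_unique gS eq by metis
      have d: "?i div n < 3" "?j div n < 3" using lt n by (simp_all add: div_less_iff_less_mult)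
      have mem: "[a, b, c] ! k \<in> S 0" if "k < 3" for k
      proof -
        have "k = 0 \<or> k = 1 \<or> k = 2" using that by linarith
        then show ?thesis using a bc by (elim disjE) simp_all
      qed
      have "[a, b, c] ! (?i div n) = [a, b, c] ! (?j div n)"
        using lift_inj[OF mem[OF d(1)] mem[OF d(2)], of "?i mod n"] rep[OF lt(1)] rep[OF lt(2)] eq m by simp
      moreover have "distinct [a, b, c]" using ne \<open>c \<noteq> a\<close> by auto
      ultimately have "?i div n = ?j div n"
        using nth_eq_iff_index_eq[of "[a, b, c]" "?i div n" "?j div n"] d by simp
      then have "?i = ?j" using m by (metis div_mult_mod_eq)
      then show "x = y" using xy by auto
    qed
    \<comment> \<open>\<open>f_mod\<close> covers shifts by natural numbers; the generators -1 and
      -n are reduced to these by reversing the arc.\<close>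
    have fwd: "E (f x) (f y)" if "x \<ge> 0" "y = (x + d) mod (3 * int n)" "d \<in> {1, int n}" for x y d
      using that g1[of "nat x"] gn[of "nat x"] f_mod[OF that(1), of 1] f_mod[OF that(1), of n]
      by (auto simp: f_def)
    fix x y assume "(x, y) \<in> parcs (cayley_Z3k n)"
    then obtain d where xy: "x \<in> {0..<3 * int n}" "y \<in> {0..<3 * int n}"
      and d: "d \<in> {1, - 1, int n, - int n}" "y = (x + d) mod (3 * int n)"
      unfolding cayley_Z3k_arcs[OF n1] by blast
    show "E (f x) (f y)"
    proof (cases "d \<in> {1, int n}")
      case True
      then show ?thesis using fwd d(2) xy by simp
    next
      case False
      then have "- d \<in> {1, int n}" using d(1) by auto
      moreover have "x = (y + (- d)) mod (3 * int n)" using d(2) xy(1) by (simp add: mod_diff_left_eq)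
      ultimately show ?thesis using E_sym[OF fwd[of y x "- d"]] xy by simp
    qed
  qed
  then show ?thesis by blast
qed

lemma embeds_cases:
  "(\<exists>f. embeds (cartesian_product (cycle_graph 3) (cycle_graph n)) f) \<or> (\<exists>f. embeds (cayley_Z3k n) f)"
  using embeds_prism embeds_cayley_Z3k monodromy_fix by metis

end

lemma embeds_prism_or_cayley:
  "\<exists>n\<ge>3. (\<exists>f. embeds (cartesian_product (cycle_graph 3) (cycle_graph n)) f) \<or> (\<exists>f. embeds (cayley_Z3k n) f)"
proof -
  obtain n T where n: "n \<ge> 3" and T: "inj_on T {..<n}" "T ` {..<n} \<subseteq> B ` V"
    and R: "\<And>i. i < n \<Longrightarrow> R (T i) (T (Suc i mod n))"
    using block_cycle[OF card_neighbour_blocks] by blast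
  have "(\<exists>f. embeds (cartesian_product (cycle_graph 3) (cycle_graph n)) f) \<or> (\<exists>f. embeds (cayley_Z3k n) f)"
  proof (rule embeds_cases[where S = "\<lambda>i. T (i mod n)"])
    show "n \<ge> 3" by (rule n)
    have lt: "i mod n < n" for i using n by simp
    show "T (i mod n) \<in> B ` V" for i using T(2) lt by auto
    show "T (i mod n) = T (j mod n) \<longleftrightarrow> i mod n = j mod n" for i j
      using inj_onD[OF T(1)] lt by auto
    show "R (T (i mod n)) (T (Suc i mod n))" for i
      using R[OF lt[of i]] by (simp add: mod_Suc_eq)
  qed
  then show ?thesis using n by blast
qed

end

end

section \<open>The classification\<close>

context strong_vt_graph
begin

lemma unique_clique_graphI:
  assumes "\<And>v Q Q'. clique G Q \<Longrightarrow> card Q = card C \<Longrightarrow> v \<in> Q \<Longrightarrow>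
    clique G Q' \<Longrightarrow> card Q' = card C \<Longrightarrow> v \<in> Q' \<Longrightarrow> Q = Q'"
  shows "unique_clique_graph G C"
  by unfold_locales (rule assms)

text \<open>Two triangles at \<open>v\<close> that share no other vertex are excluded by
  \<open>not_two\<close>; if they share a second vertex, \<open>diamond_free\<close> identifies the
  third.\<close>

lemma unique_triangle:
  assumes w: "card C = 3"
    and diamond_free: "\<And>u v x y. E u v \<Longrightarrow> E u x \<Longrightarrow> E v x \<Longrightarrow> E u y \<Longrightarrow> E v y \<Longrightarrow> x = y"
    and not_two: "\<not> (\<exists>b c d e. distinct [b, c, d, e] \<and> E v b \<and> E v c \<and> E v d \<and> E v e \<and> E b c \<and> E d e)"
    and Q: "clique G Q" "card Q = card C" "v \<in> Q" and Q': "clique G Q'" "card Q' = card C" "v \<in> Q'"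
  shows "Q = Q'"
proof -
  have shape: "\<exists>b c. K = {v, b, c} \<and> b \<noteq> c \<and> E v b \<and> E v c \<and> E b c"
    if K: "clique G K" "card K = card C" "v \<in> K" for K
  proof -
    have "card (K - {v}) = 2" using K w finite_clique[OF K(1)] by simp
    then obtain b c where bc: "K - {v} = {b, c}" "b \<noteq> c" by (auto simp: card_2_iff)
    then have "K = {v, b, c}" "b \<noteq> v" "c \<noteq> v" using K(3) by auto
    moreover from this have "E v b" "E v c" "E b c" using cliqueD[OF K(1)] bc(2) by auto
    ultimately show ?thesis using bc(2) by blast
  qed
  obtain b c where bc: "Q = {v, b, c}" "b \<noteq> c" "E v b" "E v c" "E b c" using shape[OF Q] by blast
  obtain d e where de: "Q' = {v, d, e}" "d \<noteq> e" "E v d" "E v e" "E d e" using shape[OF Q'] by blast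
  have "\<not> distinct [b, c, d, e]" using not_two bc(3-5) de(3-5) by blast
  then consider "b = d" | "b = e" | "c = d" | "c = e" using bc(2) de(2) by auto
  then show ?thesis
  proof cases
    case 1
    then have "c = e" using diamond_free[of v b c e] bc de by simp
    then show ?thesis using 1 bc(1) de(1) by simp
  next
    case 2
    then have "c = d" using diamond_free[of v b c d] bc de E_sym[OF de(5)] by simp
    then show ?thesis using 2 bc(1) de(1) by (simp add: insert_commute)
  next
    case 3
    then have "b = e" using diamond_free[of v c b e] bc de E_sym[OF bc(5)] by simp
    then show ?thesis using 3 bc(1) de(1) by (simp add: insert_commute)
  next
    case 4
    then have "b = d" using diamond_free[of v c b d] bc de E_sym[OF bc(5)] E_sym[OF de(5)] by simp
    then show ?thesis using 4 bc(1) de(1) by simp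
  qed
qed

lemma embeds_triangle_case:
  assumes w: "card C = 3"
  shows "(\<exists>f. embeds (lexicographic_product (complete_graph 3) (edgeless_graph 2)) f) \<or>
    (\<exists>k\<ge>3. \<exists>f. embeds (cayley_Z3k k) f) \<or>
    (\<exists>n\<ge>3. \<exists>f. embeds (cartesian_product (cycle_graph 3) (cycle_graph n)) f)"
proof (cases "\<exists>v q p r. E v q \<and> E v p \<and> E q p \<and> E v r \<and> E q r \<and> p \<noteq> r")
  case True
  then show ?thesis using embeds_lexicographic_product[OF w] by metis
next
  case False
  then have df: "x = y" if "E u v" "E u x" "E v x" "E u y" "E v y" for u v x y
    using that by blast
  let ?P = "\<lambda>v. \<exists>b c d e. distinct [b, c, d, e] \<and> E v b \<and> E v c \<and> E v d \<and> E v e \<and> E b c \<and> E d e"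
  show ?thesis
  proof (cases "\<exists>v. ?P v")
    case True
    then obtain u b c d e where u: "distinct [b, c, d, e]" "E u b" "E u c" "E u d" "E u e" "E b c" "E d e" by blast
    have two: "?P v" if v: "v \<in> V" for v
    proof -
      obtain f where f: "f \<in> auts" "f u = v" using ex_aut[OF E_V(1)[OF u(2)] v] by blast
      have "distinct [f b, f c, f d, f e]" using u(1) autD(2)[OF f(1)] by simp
      moreover have "E v (f b)" "E v (f c)" "E v (f d)" "E v (f e)" "E (f b) (f c)" "E (f d) (f e)"
        using u autD(1)[OF f(1)] f(2) by metis+
      ultimately show ?thesis by blast
    qed
    have "\<exists>f. embeds (cartesian_product (cycle_graph 3) (cycle_graph 3)) f"
    proof (rule embeds_prism3[OF w])
      show "x = y" if "E u v" "E u x" "E v x" "E u y" "E v y" for u v x y by (rule df[OF that])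
      show "?P v" if "v \<in> V" for v by (rule two[OF that])
    qed
    then show ?thesis by blast
  next
    case False
    have "unique_clique_graph G C"
    proof (rule unique_clique_graphI)
      fix v Q Q' assume Q: "clique G Q" "card Q = card C" "v \<in> Q" "clique G Q'" "card Q' = card C" "v \<in> Q'"
      show "Q = Q'"
      proof (rule unique_triangle[OF w _ _ Q])
        show "x = y" if "E u v" "E u x" "E v x" "E u y" "E v y" for u v x y by (rule df[OF that])
        show "\<not> ?P v" using False by blast
      qed
    qed
    then have "\<exists>n\<ge>3. (\<exists>f. embeds (cartesian_product (cycle_graph 3) (cycle_graph n)) f) \<or> (\<exists>f. embeds (cayley_Z3k n) f)"
      by (rule unique_clique_graph.embeds_prism_or_cayley) (rule w)
    then show ?thesis by blast
  qed
qed

lemma embeds_H_case: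
  assumes w: "card C = 4"
  shows "\<exists>n\<ge>2. \<exists>f. embeds (H_graph n) f"
proof -
  have "unique_clique_graph G C"
    using unique_K4[OF w] by (intro unique_clique_graphI) blast
  then show ?thesis by (rule unique_clique_graph.embeds_H_graph) (rule w)
qed

lemma localizable: "localizable G"
  and classification: "Digraph_Component.connected (with_proj G) \<Longrightarrow>
    digraph_iso (with_proj G) (with_proj (complete_bipartite_graph 4 4)) \<or>
    digraph_iso (with_proj G) (with_proj (complete_graph 5)) \<or>
    digraph_iso (with_proj G) (with_proj (lexicographic_product (complete_graph 3) (edgeless_graph 2))) \<or>
    (\<exists>n\<ge>2. digraph_iso (with_proj G) (with_proj (H_graph n))) \<or>
    (\<exists>k\<ge>3. digraph_iso (with_proj G) (with_proj (cayley_Z3k k))) \<or>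
    (\<exists>n\<ge>3. digraph_iso (with_proj G) (with_proj (cartesian_product (cycle_graph 3) (cycle_graph n))))"
proof -
  consider f where "card C = 2" "embeds (complete_bipartite_graph 4 4) f"
    | f where "card C = 5" "embeds (complete_graph 5) f"
    | f where "card C = 3" "embeds (lexicographic_product (complete_graph 3) (edgeless_graph 2)) f"
    | n f where "card C = 4" "n \<ge> 2" "embeds (H_graph n) f"
    | k f where "card C = 3" "k \<ge> 3" "embeds (cayley_Z3k k) f"
    | n f where "card C = 3" "n \<ge> 3" "embeds (cartesian_product (cycle_graph 3) (cycle_graph n)) f"
    using card_C embeds_complete_bipartite_graph embeds_complete_graph embeds_triangle_case embeds_H_case
    by (elim insertE emptyE) metis+
  note cases = this
  show "localizable G"
    by (rule cases) (use embeds_localizable tiled_complete_bipartite_graph tiled_complete_graph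
        tiled_lexicographic_product tiled_H_graph tiled_cayley_Z3k tiled_prism in metis)+
  assume conn: "Digraph_Component.connected (with_proj G)"
  show "digraph_iso (with_proj G) (with_proj (complete_bipartite_graph 4 4)) \<or>
    digraph_iso (with_proj G) (with_proj (complete_graph 5)) \<or>
    digraph_iso (with_proj G) (with_proj (lexicographic_product (complete_graph 3) (edgeless_graph 2))) \<or>
    (\<exists>n\<ge>2. digraph_iso (with_proj G) (with_proj (H_graph n))) \<or>
    (\<exists>k\<ge>3. digraph_iso (with_proj G) (with_proj (cayley_Z3k k))) \<or>
    (\<exists>n\<ge>3. digraph_iso (with_proj G) (with_proj (cartesian_product (cycle_graph 3) (cycle_graph n))))"
    by (rule cases) (use embeds_iso[OF _ _ conn] tiled_complete_bipartite_graph tiled_complete_graph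
        tiled_lexicographic_product tiled_H_graph tiled_cayley_Z3k tiled_prism in metis)+
qed

end

theorem theorem5p3:
  fixes G :: "'a pair_pre_digraph"
  assumes "pair_graph G" and "valent 4 G" and "vertex_transitive G"
  shows "(Digraph_Component.connected (with_proj G) \<longrightarrow>
            ((\<exists>C. strong_clique G C) \<longleftrightarrow>
               digraph_iso (with_proj G) (with_proj (complete_bipartite_graph 4 4)) \<or>
               digraph_iso (with_proj G) (with_proj (complete_graph 5)) \<or>
               digraph_iso (with_proj G)
                 (with_proj (lexicographic_product (complete_graph 3) (edgeless_graph 2))) \<or>
               digraph_iso (with_proj G) (with_proj (line_graph (complete_bipartite_graph 3 3))) \<or>
               (\<exists>n\<ge>2. digraph_iso (with_proj G) (with_proj (H_graph n))) \<or>
               (\<exists>k\<ge>1. digraph_iso (with_proj G) (with_proj (cayley_Z3k k))) \<or>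
               (\<exists>n\<ge>3. digraph_iso (with_proj G)
                 (with_proj (cartesian_product (cycle_graph 3) (cycle_graph n))))))
         \<and> ((\<exists>C. strong_clique G C) \<longrightarrow> localizable G)"
proof -
  interpret pair_graph G by (rule assms(1))
  have wf: "pair_wf_digraph G" by unfold_locales
  have vt: "strong_vt_graph G C" if "strong_clique G C" for C
    using assms that by (simp add: strong_vt_graph_def)
  have wf_line: "pair_wf_digraph (line_graph (complete_bipartite_graph 3 3))"
    by (rule pair_wf_digraphI) (auto simp: line_graph_def)
  \<comment> \<open>\<open>tiled_cayley_Z3k\<close> gives well-formedness for
    \<open>k \<ge> 3\<close>; the converse direction also has to treat k = 1 and k = 2.\<close>
  have wf_cayley: "pair_wf_digraph (cayley_Z3k k)" for k
    by (rule pair_wf_digraphI) (auto simp: cayley_Z3k_def cayley_graph_def)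
  show ?thesis
  proof (intro conjI impI iffI)
    assume conn: "Digraph_Component.connected (with_proj G)" and "\<exists>C. strong_clique G C"
    then obtain C where "strong_clique G C" by blast
    from strong_vt_graph.classification[OF vt[OF this] conn]
    show "digraph_iso (with_proj G) (with_proj (complete_bipartite_graph 4 4)) \<or>
      digraph_iso (with_proj G) (with_proj (complete_graph 5)) \<or>
      digraph_iso (with_proj G) (with_proj (lexicographic_product (complete_graph 3) (edgeless_graph 2))) \<or>
      digraph_iso (with_proj G) (with_proj (line_graph (complete_bipartite_graph 3 3))) \<or>
      (\<exists>n\<ge>2. digraph_iso (with_proj G) (with_proj (H_graph n))) \<or>
      (\<exists>k\<ge>1. digraph_iso (with_proj G) (with_proj (cayley_Z3k k))) \<or>
      (\<exists>n\<ge>3. digraph_iso (with_proj G) (with_proj (cartesian_product (cycle_graph 3) (cycle_graph n))))"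
      by (meson le_trans one_le_numeral)
  next
    assume "digraph_iso (with_proj G) (with_proj (complete_bipartite_graph 4 4)) \<or>
      digraph_iso (with_proj G) (with_proj (complete_graph 5)) \<or>
      digraph_iso (with_proj G) (with_proj (lexicographic_product (complete_graph 3) (edgeless_graph 2))) \<or>
      digraph_iso (with_proj G) (with_proj (line_graph (complete_bipartite_graph 3 3))) \<or>
      (\<exists>n\<ge>2. digraph_iso (with_proj G) (with_proj (H_graph n))) \<or>
      (\<exists>k\<ge>1. digraph_iso (with_proj G) (with_proj (cayley_Z3k k))) \<or>
      (\<exists>n\<ge>3. digraph_iso (with_proj G) (with_proj (cartesian_product (cycle_graph 3) (cycle_graph n))))"
    then show "\<exists>C. strong_clique G C"
    proof (elim disjE exE conjE)
      assume "digraph_iso (with_proj G) (with_proj (complete_bipartite_graph 4 4))"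
      then show ?thesis
        using iso_strong_clique[OF wf] tiled_complete_bipartite_graph strong_clique_complete_bipartite_graph
        unfolding tiled_graph_def by blast
    next
      assume "digraph_iso (with_proj G) (with_proj (complete_graph 5))"
      then show ?thesis
        using iso_strong_clique[OF wf] tiled_complete_graph strong_clique_complete_graph
        unfolding tiled_graph_def by blast
    next
      assume "digraph_iso (with_proj G) (with_proj (lexicographic_product (complete_graph 3) (edgeless_graph 2)))"
      then show ?thesis
        using iso_strong_clique[OF wf] tiled_lexicographic_product strong_clique_lexicographic_product
        unfolding tiled_graph_def by blast
    next
      assume "digraph_iso (with_proj G) (with_proj (line_graph (complete_bipartite_graph 3 3)))"
      then show ?thesis
        using iso_strong_clique[OF wf wf_line] strong_clique_line_graph by blast
    next
      fix n :: nat assume "2 \<le> n" "digraph_iso (with_proj G) (with_proj (H_graph n))"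
      then show ?thesis
        using iso_strong_clique[OF wf] tiled_H_graph[of n] strong_clique_H_graph[of n]
        unfolding tiled_graph_def by blast
    next
      fix k :: nat assume "1 \<le> k" "digraph_iso (with_proj G) (with_proj (cayley_Z3k k))"
      then show ?thesis
        using iso_strong_clique[OF wf wf_cayley] strong_clique_cayley_Z3k[of k] by blast
    next
      fix n :: nat assume "3 \<le> n" "digraph_iso (with_proj G) (with_proj (cartesian_product (cycle_graph 3) (cycle_graph n)))"
      then show ?thesis
        using iso_strong_clique[OF wf] tiled_prism[of n] strong_clique_prism[of n]
        unfolding tiled_graph_def by blast
    qed
  next
    assume "\<exists>C. strong_clique G C"
    then show "localizable G" using strong_vt_graph.localizable[OF vt] by blast
  qed
qed

end
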